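(* For $\mathfrak g$ of type $\mathsf D$, there is a nontrivial element $[B]$ in $\mathbb P R_2$.
   Context: $\mathfrak g$ is a complex simple Lie algebra of type $\mathsf D$, written $\mathfrak g=\mathfrak{so}_{n+4}$ with $n\ge 4$ even (type $\mathsf D_{(n+4)/2}$). $G$ is the identity component of $\mathrm{Aut}\,\mathfrak g$. $X\subset\mathbb P\mathfrak g$ is the adjoint variety, i.e. the unique closed $G$-orbit in $\mathbb P\mathfrak g$, and $P\subset G$ is the stabiliser of a point $o\in X$. It is a parabolic subgroup with Levi decomposition $P=G_0\ltimes P_+$, where $P_+$ is the unipotent radical and $G_0$ is reductive. This induces the contact grading $\mathfrak g=\mathfrak g_{-2}\oplus\mathfrak g_{-1}\oplus\mathfrak g_0\oplus\mathfrak g_1\oplus\mathfrak g_2$, where $\mathfrak g_0=\mathrm{Lie}(G_0)$, $\dim\mathfrak g_{-2}=1$, $\dim\mathfrak g_{-1}=2n$, and the Lie bracket gives a non-degenerate $\mathfrak g_{-2}$-valued symplectic form $\omega:\Lambda^2\mathfrak g_{-1}\to\mathfrak g_{-2}$. In type $\mathsf D$ one has $\mathfrak g_0\simeq\mathfrak{gl}_2\oplus\mathfrak{so}_n$ and $\mathfrak g_{-1}\simeq\mathbb C^2\otimes\mathbb C^n$. $G_0^{\mathrm{ss}}=[G_0,G_0]$ is the semisimple part of $G_0$; it has Lie algebra $\mathfrak{sl}_2\oplus\mathfrak{so}_n$ and is a quotient of $\mathrm{SL}_2\times\mathrm{SO}_n$ by a finite subgroup. $\Lambda^n_0\mathfrak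 g_{-1}$ (the Plücker space) is the kernel of the map $\Lambda^n\mathfrak g_{-1}\to\Lambda^{n-2}\mathfrak g_{-1}\otimes\mathfrak g_{-2}$ given by contraction with $\omega$. The Lagrangian Grassmannian $\mathrm{LGr}(\mathfrak g_{-1})$ of $n$-dimensional subspaces $L\subset\mathfrak g_{-1}$ with $\omega|_L=0$ is embedded in $\mathbb P\Lambda^n_0\mathfrak g_{-1}$ by the Plücker embedding $L\mapsto\Lambda^nL$. $I=\bigoplus_d I_d\subset S^\bullet\Lambda^n_0\mathfrak g_{-1}^*$ is its homogeneous ideal, where $S^\bullet$ denotes the symmetric algebra and $\Lambda^n_0\mathfrak g_{-1}^*$ is the dual of the Plücker space. $R=(S^\bullet\Lambda^n_0\mathfrak g_{-1}^*/I)^{G_0^{\mathrm{ss}}}$ is the ring of $G_0^{\mathrm{ss}}$-invariants in the homogeneous coordinate ring of $\mathrm{LGr}(\mathfrak g_{-1})$, and $R_d=(S^d\Lambda^n_0\mathfrak g_{-1}^*/I_d)^{G_0^{\mathrm{ss}}}$ is its degree $d$ component. $\mathbb P R_2$ is the projectivisation of $R_2$. Giving an element of $\mathbb P R_2$ amounts to giving a $G_0^{\mathrm{ss}}$-invariant quadratic form on $\Lambda^n_0\mathfrak g_{-1}$ that does not vanish identically on $\mathrm{LGr}(\mathfrak g_{-1})$, taken modulo invariant forms in $I_2$ and up to a nonzero scalar. $[B]$ is merely a name for the element asserted to exist. *)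

theory Defs
  imports
    "HOL-Analysis.Analysis"
    "HOL-Library.Function_Algebras"
    "HOL-Algebra.Bij"
    "HOL-Algebra.Generated_Groups"
begin

section \<open>Complex vector spaces of matrices and of functions\<close>

text \<open>The distribution has no type class of complex vector spaces. Both ambient spaces below
  are interpretations of the locale \<^locale>\<open>vector_space\<close>; all other vector spaces are
  subspaces of one of them.\<close>

type_synonym 'm cmat = "complex^'m^'m"

definition mscale :: "complex \<Rightarrow> 'm cmat \<Rightarrow> 'm::finite cmat" where
  "mscale c A = (\<chi> i j. c * A $ i $ j)"

global_interpretation cmat: vector_space "mscale :: complex \<Rightarrow> 'm cmat \<Rightarrow> 'm::finite cmat"
  by unfold_locales (simp_all add: mscale_def vec_eq_iff algebra_simps)

definition fscale :: "complex \<Rightarrow> ('x \<Rightarrow> complex) \<Rightarrow> 'x \<Rightarrow> complex" where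
  "fscale c f = (\<lambda>x. c * f x)"

global_interpretation cfun: vector_space "fscale :: complex \<Rightarrow> ('x \<Rightarrow> complex) \<Rightarrow> 'x \<Rightarrow> complex"
  by unfold_locales (simp_all add: fscale_def fun_eq_iff algebra_simps)

definition linear_on ::
  "(complex \<Rightarrow> 'a \<Rightarrow> 'a::ab_group_add) \<Rightarrow> (complex \<Rightarrow> 'b \<Rightarrow> 'b::ab_group_add) \<Rightarrow> 'a set \<Rightarrow> ('a \<Rightarrow> 'b) \<Rightarrow> bool"
where
  "linear_on s1 s2 V f \<longleftrightarrow>
     (\<forall>x\<in>V. \<forall>y\<in>V. f (x + y) = f x + f y) \<and> (\<forall>c. \<forall>x\<in>V. f (s1 c x) = s2 c (f x))"

text \<open>Linear forms on a subspace \<open>V\<close>, normalised to vanish off \<open>V\<close> so that they are determined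
  by their values on \<open>V\<close>.\<close>

definition dual_space ::
  "(complex \<Rightarrow> 'a \<Rightarrow> 'a::ab_group_add) \<Rightarrow> 'a set \<Rightarrow> ('a \<Rightarrow> complex) set" where
  "dual_space s V = {l. linear_on s (*) V l \<and> (\<forall>x. x \<notin> V \<longrightarrow> l x = 0)}"


section \<open>The Lie algebra and its adjoint group\<close>

definition lie :: "'m::finite cmat \<Rightarrow> 'm cmat \<Rightarrow> 'm cmat" where
  "lie A B = A ** B - B ** A"

definition so :: "'m::finite cmat set" where
  "so = {A. transpose A = - A}"

text \<open>Endomorphisms of \<open>so\<close> are extensional functions. They carry the topology of pointwise
  convergence (the product topology on the function type), which on linear maps is the usual
  topology.\<close>

abbreviation Perm_so :: "('m::finite cmat \<Rightarrow> 'm cmat) monoid" where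
  "Perm_so \<equiv> BijGroup so"

definition Aut_so :: "('m::finite cmat \<Rightarrow> 'm cmat) set" where
  "Aut_so = {\<phi> \<in> Bij so. linear_on mscale mscale so \<phi> \<and>
               (\<forall>x\<in>so. \<forall>y\<in>so. \<phi> (lie x y) = lie (\<phi> x) (\<phi> y))}"

definition adjoint_group :: "('m::finite cmat \<Rightarrow> 'm cmat) set" where
  "adjoint_group = connected_component_set Aut_so \<one>\<^bsub>Perm_so\<^esub>"

definition exp_ad :: "'m::finite cmat \<Rightarrow> 'm cmat \<Rightarrow> 'm cmat" where
  "exp_ad x = (\<lambda>y\<in>so. \<Sum>k. ((lie x) ^^ k) y /\<^sub>R fact k)"

text \<open>The Lie algebra of a subgroup of the adjoint group, as a subset of \<open>so\<close> via \<open>ad\<close>.\<close>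

definition lie_algebra :: "('m::finite cmat \<Rightarrow> 'm cmat) set \<Rightarrow> 'm cmat set" where
  "lie_algebra H = {x \<in> so. \<forall>t::real. exp_ad (t *\<^sub>R x) \<in> H}"


section \<open>The adjoint variety and its point stabilisers\<close>

definition line :: "'m::finite cmat \<Rightarrow> 'm cmat set" where
  "line v = cmat.span {v}"

definition proj_so :: "'m::finite cmat set set" where
  "proj_so = line ` (so - {0})"

text \<open>Closedness is meant in the quotient topology of \<open>so - {0}\<close>.\<close>

definition closed_in_proj_so :: "'m::finite cmat set set \<Rightarrow> bool" where
  "closed_in_proj_so S \<longleftrightarrow> S \<subseteq> proj_so \<and>
     closedin (top_of_set (so - {0})) {v \<in> so - {0}. line v \<in> S}"

definition adjoint_variety :: "'m::finite cmat set set \<Rightarrow> bool" where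
  "adjoint_variety X \<longleftrightarrow>
     (\<exists>l\<in>proj_so. X = (\<lambda>\<phi>. \<phi> ` l) ` adjoint_group) \<and> closed_in_proj_so X"

definition point_stabiliser :: "'m::finite cmat set \<Rightarrow> ('m cmat \<Rightarrow> 'm cmat) set" where
  "point_stabiliser p = {\<phi> \<in> adjoint_group. \<phi> ` p = p}"


section \<open>Levi decomposition and contact grading\<close>

definition unipotent :: "('m::finite cmat \<Rightarrow> 'm cmat) \<Rightarrow> bool" where
  "unipotent \<phi> \<longleftrightarrow> (\<exists>k. \<forall>x\<in>so. ((\<lambda>y. \<phi> y - y) ^^ k) x = 0)"

definition normal_unipotent ::
  "('m::finite cmat \<Rightarrow> 'm cmat) set \<Rightarrow> ('m cmat \<Rightarrow> 'm cmat) set \<Rightarrow> bool" where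
  "normal_unipotent H U \<longleftrightarrow>
     U \<lhd> Perm_so\<lparr>carrier := H\<rparr> \<and> closedin (top_of_set H) U \<and> connected U \<and> (\<forall>\<phi>\<in>U. unipotent \<phi>)"

definition unipotent_radical ::
  "('m::finite cmat \<Rightarrow> 'm cmat) set \<Rightarrow> ('m cmat \<Rightarrow> 'm cmat) set \<Rightarrow> bool" where
  "unipotent_radical H U \<longleftrightarrow>
     normal_unipotent H U \<and> (\<forall>U'. normal_unipotent H U' \<longrightarrow> U' \<subseteq> U)"

definition reductive :: "('m::finite cmat \<Rightarrow> 'm cmat) set \<Rightarrow> bool" where
  "reductive H \<longleftrightarrow> unipotent_radical H {\<one>\<^bsub>Perm_so\<^esub>}"

definition levi_decomposition ::
  "('m::finite cmat \<Rightarrow> 'm cmat) set \<Rightarrow> ('m cmat \<Rightarrow> 'm cmat) set \<Rightarrow> ('m cmat \<Rightarrow> 'm cmat) set \<Rightarrow> bool"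
where
  "levi_decomposition P G0 Pp \<longleftrightarrow>
     unipotent_radical P Pp \<and>
     subgroup G0 (Perm_so\<lparr>carrier := P\<rparr>) \<and> closedin (top_of_set P) G0 \<and> reductive G0 \<and>
     G0 \<inter> Pp = {\<one>\<^bsub>Perm_so\<^esub>} \<and> G0 <#>\<^bsub>Perm_so\<^esub> Pp = P"

definition contact_grading ::
  "nat \<Rightarrow> ('m::finite cmat \<Rightarrow> 'm cmat) set \<Rightarrow> ('m cmat \<Rightarrow> 'm cmat) set \<Rightarrow> ('m cmat \<Rightarrow> 'm cmat) set \<Rightarrow>
   (int \<Rightarrow> 'm cmat set) \<Rightarrow> bool"
where
  "contact_grading n P G0 Pp gr \<longleftrightarrow>
     (\<forall>i. cmat.subspace (gr i) \<and> gr i \<subseteq> so) \<and>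
     (\<forall>i. \<bar>i\<bar> > 2 \<longrightarrow> gr i = {0}) \<and>
     (\<forall>x\<in>so. \<exists>!f. (\<forall>i. f i \<in> gr i) \<and> x = (\<Sum>i = -2..2. f i)) \<and>
     (\<forall>i j. \<forall>x\<in>gr i. \<forall>y\<in>gr j. lie x y \<in> gr (i + j)) \<and>
     lie_algebra G0 = gr 0 \<and>
     lie_algebra P = {x + y + z |x y z. x \<in> gr 0 \<and> y \<in> gr 1 \<and> z \<in> gr 2} \<and>
     lie_algebra Pp = {y + z |y z. y \<in> gr 1 \<and> z \<in> gr 2} \<and>
     cmat.dim (gr (-2)) = 1 \<and> cmat.dim (gr (-1)) = 2 * n \<and>
     (\<forall>x\<in>gr (-1). (\<forall>y\<in>gr (-1). lie x y = 0) \<longrightarrow> x = 0)"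

definition semisimple_part ::
  "('m::finite cmat \<Rightarrow> 'm cmat) set \<Rightarrow> ('m cmat \<Rightarrow> 'm cmat) set" where
  "semisimple_part G0 = derived Perm_so G0"


section \<open>Exterior powers and the Lagrangian Grassmannian\<close>

text \<open>Alternating \<open>k\<close>-linear forms on \<open>W\<close>, as functions of lists of length \<open>k\<close> over \<open>W\<close>;
  values on other lists are unconstrained, and no element of \<open>ext_power k W\<close> sees them.\<close>

definition alt_forms :: "nat \<Rightarrow> 'm::finite cmat set \<Rightarrow> ('m cmat list \<Rightarrow> complex) set" where
  "alt_forms k W = {\<alpha>. \<forall>vs. length vs = k \<and> set vs \<subseteq> W \<longrightarrow>
     (\<forall>i<k. linear_on mscale (*) W (\<lambda>x. \<alpha> (vs[i := x]))) \<and>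
     (\<forall>i<k. \<forall>j<k. i \<noteq> j \<and> vs ! i = vs ! j \<longrightarrow> \<alpha> vs = 0)}"

text \<open>For finite-dimensional \<open>W\<close> the space \<open>\<Lambda>\<^sup>kW\<close> is the dual of the space of alternating
  \<open>k\<close>-linear forms on \<open>W\<close>, and \<open>v\<^sub>1 \<and> \<dots> \<and> v\<^sub>k\<close> is evaluation at \<open>(v\<^sub>1, \<dots>, v\<^sub>k)\<close>.\<close>

definition wedge :: "nat \<Rightarrow> 'm::finite cmat set \<Rightarrow> 'm cmat list \<Rightarrow> ('m cmat list \<Rightarrow> complex) \<Rightarrow> complex"
where
  "wedge k W vs = (\<lambda>\<alpha>. if \<alpha> \<in> alt_forms k W then \<alpha> vs else 0)"

definition ext_power ::
  "nat \<Rightarrow> 'm::finite cmat set \<Rightarrow> (('m cmat list \<Rightarrow> complex) \<Rightarrow> complex) set" where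
  "ext_power k W = cfun.span {wedge k W vs |vs. length vs = k \<and> set vs \<subseteq> W}"

text \<open>The map induced on \<open>\<Lambda>\<^sup>kW\<close> by a linear map \<open>\<phi>\<close> preserving \<open>W\<close>:
  \<open>v\<^sub>1 \<and> \<dots> \<and> v\<^sub>k\<close> goes to \<open>\<phi>(v\<^sub>1) \<and> \<dots> \<and> \<phi>(v\<^sub>k)\<close>.\<close>

definition ext_map ::
  "nat \<Rightarrow> 'm::finite cmat set \<Rightarrow> ('m cmat \<Rightarrow> 'm cmat) \<Rightarrow>
   (('m cmat list \<Rightarrow> complex) \<Rightarrow> complex) \<Rightarrow> ('m cmat list \<Rightarrow> complex) \<Rightarrow> complex" where
  "ext_map k W \<phi> T = (\<lambda>\<alpha>. if \<alpha> \<in> alt_forms k W then T (\<lambda>vs. \<alpha> (map \<phi> vs)) else 0)"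

text \<open>The exterior product of a 2-form \<open>\<omega>\<close> with an alternating form \<open>\<beta>\<close>.\<close>

definition wedge_2form ::
  "('m::finite cmat \<Rightarrow> 'm cmat \<Rightarrow> complex) \<Rightarrow> ('m cmat list \<Rightarrow> complex) \<Rightarrow> 'm cmat list \<Rightarrow> complex"
where
  "wedge_2form \<omega> \<beta> vs =
     (\<Sum>j<length vs. \<Sum>i<j. (-1) ^ (i + j + 1) * \<omega> (vs ! i) (vs ! j) * \<beta> (nths vs (- {i, j})))"

text \<open>Contraction with the bracket \<open>\<omega> : \<Lambda>\<^sup>2W \<rightarrow> Z\<close>, sending \<open>v\<^sub>1 \<and> \<dots> \<and> v\<^sub>k\<close> to the sum over \<open>i < j\<close> of
  \<open>\<plusminus> (v\<^sub>1 \<and> \<dots> \<and> v\<^sub>k\<close> without \<open>v\<^sub>i, v\<^sub>j) \<otimes> [v\<^sub>i, v\<^sub>j]\<close>. An element of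
  \<open>\<Lambda>\<^bsup>k-2\<^esup>W \<otimes> Z\<close> is given through its pairings with linear forms \<open>l\<close> on \<open>Z\<close> and
  alternating forms \<open>\<beta>\<close> on \<open>W\<close>; pairing with \<open>\<beta>\<close> makes contraction the transpose of
  \<open>\<beta> \<mapsto> (l \<circ> \<omega>) \<and> \<beta>\<close>.\<close>

definition contraction ::
  "(('m::finite cmat list \<Rightarrow> complex) \<Rightarrow> complex) \<Rightarrow>
   ('m cmat \<Rightarrow> complex) \<Rightarrow> ('m cmat list \<Rightarrow> complex) \<Rightarrow> complex" where
  "contraction T = (\<lambda>l \<beta>. T (wedge_2form (\<lambda>x y. l (lie x y)) \<beta>))"

definition pluecker_space ::
  "nat \<Rightarrow> (int \<Rightarrow> 'm::finite cmat set) \<Rightarrow> (('m cmat list \<Rightarrow> complex) \<Rightarrow> complex) set" where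
  "pluecker_space n gr = {T \<in> ext_power n (gr (-1)).
     \<forall>l\<in>dual_space mscale (gr (-2)). \<forall>\<beta>\<in>alt_forms (n - 2) (gr (-1)). contraction T l \<beta> = 0}"

definition LGr :: "nat \<Rightarrow> (int \<Rightarrow> 'm::finite cmat set) \<Rightarrow> 'm cmat set set" where
  "LGr n gr = {L. cmat.subspace L \<and> L \<subseteq> gr (-1) \<and> cmat.dim L = n \<and> (\<forall>x\<in>L. \<forall>y\<in>L. lie x y = 0)}"

text \<open>The line \<open>\<Lambda>\<^sup>nL\<close> in \<open>\<Lambda>\<^sup>nW\<close>.\<close>

definition pluecker ::
  "nat \<Rightarrow> 'm::finite cmat set \<Rightarrow> 'm cmat set \<Rightarrow> (('m cmat list \<Rightarrow> complex) \<Rightarrow> complex) set" where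
  "pluecker n W L = cfun.span {wedge n W vs |vs. length vs = n \<and> set vs \<subseteq> L}"


section \<open>Invariants in the homogeneous coordinate ring\<close>

text \<open>\<open>S\<^sup>dV\<^sup>*\<close>, realised as the space of homogeneous polynomial functions of degree \<open>d\<close> on \<open>V\<close>
  (extended by zero off \<open>V\<close>).\<close>

definition sym_power_dual :: "nat \<Rightarrow> ('x \<Rightarrow> complex) set \<Rightarrow> (('x \<Rightarrow> complex) \<Rightarrow> complex) set" where
  "sym_power_dual d V = cfun.span
     {\<lambda>\<xi>. if \<xi> \<in> V then \<Prod>i<d. l i \<xi> else 0 |l. \<forall>i<d. l i \<in> dual_space fscale V}"

definition LGr_ideal ::
  "nat \<Rightarrow> (int \<Rightarrow> 'm::finite cmat set) \<Rightarrow> nat \<Rightarrow>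
   ((('m cmat list \<Rightarrow> complex) \<Rightarrow> complex) \<Rightarrow> complex) set" where
  "LGr_ideal n gr d = {f \<in> sym_power_dual d (pluecker_space n gr).
     \<forall>L\<in>LGr n gr. \<forall>\<xi>\<in>pluecker n (gr (-1)) L. f \<xi> = 0}"

definition poly_act ::
  "nat \<Rightarrow> (int \<Rightarrow> 'm::finite cmat set) \<Rightarrow> ('m cmat \<Rightarrow> 'm cmat) \<Rightarrow>
   ((('m cmat list \<Rightarrow> complex) \<Rightarrow> complex) \<Rightarrow> complex) \<Rightarrow>
   (('m cmat list \<Rightarrow> complex) \<Rightarrow> complex) \<Rightarrow> complex" where
  "poly_act n gr \<phi> f =
     (\<lambda>\<xi>. if \<xi> \<in> pluecker_space n gr then f (ext_map n (gr (-1)) (inv\<^bsub>Perm_so\<^esub> \<phi>) \<xi>) else 0)"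

definition coset ::
  "nat \<Rightarrow> (int \<Rightarrow> 'm::finite cmat set) \<Rightarrow> nat \<Rightarrow>
   ((('m cmat list \<Rightarrow> complex) \<Rightarrow> complex) \<Rightarrow> complex) \<Rightarrow>
   ((('m cmat list \<Rightarrow> complex) \<Rightarrow> complex) \<Rightarrow> complex) set" where
  "coset n gr d f = (\<lambda>h. f + h) ` LGr_ideal n gr d"

definition invariant_ring ::
  "nat \<Rightarrow> ('m::finite cmat \<Rightarrow> 'm cmat) set \<Rightarrow> (int \<Rightarrow> 'm cmat set) \<Rightarrow> nat \<Rightarrow>
   ((('m cmat list \<Rightarrow> complex) \<Rightarrow> complex) \<Rightarrow> complex) set set" where
  "invariant_ring n G0 gr d = {coset n gr d f |f. f \<in> sym_power_dual d (pluecker_space n gr) \<and>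
     (\<forall>\<phi>\<in>semisimple_part G0. coset n gr d (poly_act n gr \<phi> f) = coset n gr d f)}"

text \<open>A point of the projectivisation is the line spanned by a nonzero class in the quotient by
  \<open>I\<^sub>d\<close>; the zero class is \<open>I\<^sub>d\<close> itself.\<close>

definition proj_invariant_ring ::
  "nat \<Rightarrow> ('m::finite cmat \<Rightarrow> 'm cmat) set \<Rightarrow> (int \<Rightarrow> 'm cmat set) \<Rightarrow> nat \<Rightarrow>
   ((('m cmat list \<Rightarrow> complex) \<Rightarrow> complex) \<Rightarrow> complex) set set set" where
  "proj_invariant_ring n G0 gr d = {range (\<lambda>c. coset n gr d (fscale c f)) |f.
     f \<in> sym_power_dual d (pluecker_space n gr) \<and>
     coset n gr d f \<in> invariant_ring n G0 gr d \<and> coset n gr d f \<noteq> LGr_ideal n gr d}"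

end

theory Submission
  imports "Jordan_Normal_Form.Determinant" Defs
begin

text \<open>Up to conjugation, \<open>so\<close> carries only one contact grading: \<open>gr (-2)\<close> is spanned by an extremal element
  \<open>u \<and> v\<close> with \<open>\<langle>u, v\<rangle>\<close> an isotropic plane, and with a dual isotropic plane \<open>\<langle>u', v'\<rangle>\<close> and
  \<open>U = \<langle>u, v, u', v'\<rangle>\<^sup>\<bottom>\<close> the grading is by eigenvalues of \<open>h = u \<and> u' + v \<and> v'\<close>, so that
  \<open>gr (-1) = \<langle>u, v\<rangle> \<and> U\<close> is \<open>\<complex>\<^sup>2 \<otimes> \<complex>\<^sup>n\<close>.

  An element of \<open>G0\<close> fixes \<open>h\<close>, hence preserves the grading. It maps pure tensors of \<open>gr (-1)\<close> to
  pure tensors, so it acts as \<open>g \<otimes> K\<close> with \<open>g\<close> in \<open>GL 2\<close>.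

  Let \<open>x\<^sub>i, y\<^sub>i\<close> be the coordinates of \<open>\<complex>\<^sup>2 \<otimes> \<complex>\<^sup>n\<close>. The \<open>n\<close>-form
  \<open>(s x\<^sub>1 + t y\<^sub>1) \<and> \<dots> \<and> (s x\<^sub>n + t y\<^sub>n)\<close> is a binary form of degree \<open>n\<close> in \<open>(s, t)\<close> on which \<open>g \<otimes> K\<close>
  acts through \<open>det K\<close> and the substitution \<open>g\<close>. Pairing this binary form with itself under the apolar pairing,
  which is symmetric for even \<open>n\<close>, gives a quadratic form on the Pluecker space that \<open>G0\<close> multiplies by
  scalars and that is therefore fixed by commutators. On the Lagrangian subspace spanned by
  \<open>u \<and> e\<^sub>i\<close> for \<open>i < n/2\<close> and \<open>v \<and> e\<^sub>i\<close> for \<open>i \<ge> n/2\<close>, with \<open>e\<close> an orthonormal basis of \<open>U\<close>, the binary form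
  is a multiple of \<open>(s t)\<^bsup>n/2\<^esup>\<close>, which is not apolar to itself.\<close>

section \<open>Bivectors and extremal elements\<close>

text \<open>The hypotheses describe the grading and \<open>G0\<close> only through brackets and Lie
  algebras of abstract groups, so the geometry has to be recovered from the bracket alone. The lever
  is extremality: \<open>gr (-2)\<close> is a line in lowest degree, hence (ad z)^2 maps
  \<open>so\<close> into the multiples of z for each z in it, and for matrices of size above 6 this
  forces z to be the bivector of an isotropic plane. Automorphisms preserve extremality, which also
  settles the pure tensors f \<and> a with a isotropic; for other a the connectedness of the group
  has to come in. The binary form originates in the summand S^n C^2 \<otimes> \<Lambda>^n C^n of
  \<Lambda>^n (C^2 \<otimes> C^n), and the apolar pairing is the invariant form on S^n C^2. Working
  up to scalars spares determining either \<open>G0\<close> or its derived group.\<close>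

no_notation Matrix.vec_index (infixl "$" 100)

text \<open>The complex bilinear form preserved by \<open>so\<close>, not a Hermitian product:
  nonzero vectors can be isotropic.\<close>

definition cdot :: "complex^'m::finite \<Rightarrow> complex^'m \<Rightarrow> complex" (infixl "\<star>" 75) where
  "a \<star> b = (\<Sum>i\<in>UNIV. a $ i * b $ i)"

text \<open>The bivector a \<and> b of the overview, under the identification of \<Lambda>^2 C^m
  with \<open>so\<close>: it sends c to (b \<star> c) a - (a \<star> c) b.\<close>

definition skew :: "complex^'m::finite \<Rightarrow> complex^'m \<Rightarrow> 'm cmat" (infixl "\<bowtie>" 75) where
  "a \<bowtie> b = (\<chi> i j. a $ i * b $ j - b $ i * a $ j)"

lemma cdot_commute: "a \<star> b = b \<star> a"
  by (simp add: cdot_def mult.commute)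

lemma cdot_simps [simp]:
  "(a + b) \<star> c = a \<star> c + b \<star> c" "a \<star> (b + c) = a \<star> b + a \<star> c"
  "(a - b) \<star> c = a \<star> c - b \<star> c" "a \<star> (b - c) = a \<star> b - a \<star> c"
  "(- a) \<star> c = - (a \<star> c)" "a \<star> (- c) = - (a \<star> c)"
  "(k *s a) \<star> c = k * (a \<star> c)" "a \<star> (k *s c) = k * (a \<star> c)"
  "0 \<star> a = 0" "a \<star> 0 = 0"
  by (simp_all add: cdot_def algebra_simps sum.distrib sum_subtractf sum_negf sum_distrib_left)

lemma cdot_axis [simp]: "a \<star> axis i 1 = a $ i" "axis i 1 \<star> a = a $ i"
  by (simp_all add: cdot_def axis_def if_distrib[of "\<lambda>x. _ * x"] if_distrib[of "\<lambda>x. x * _"] cong: if_cong)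

lemma cdot_eq_0_imp: "(\<And>y. x \<star> y = 0) \<Longrightarrow> x = 0"
  by (metis cdot_axis(1) vec_eq_iff zero_index)

lemma cdot_sum_left: "(\<Sum>i\<in>I. f i) \<star> c = (\<Sum>i\<in>I. f i \<star> c)"
  by (induction I rule: infinite_finite_induct) auto

lemma skew_mult_vec [simp]: "(a \<bowtie> b) *v c = (b \<star> c) *s a - (a \<star> c) *s b"
  by (simp add: vec_eq_iff skew_def cdot_def matrix_vector_mult_def algebra_simps sum_subtractf sum_distrib_left sum_distrib_right)

lemma skew_in_so [simp]: "a \<bowtie> b \<in> so"
  by (simp add: so_def skew_def transpose_def vec_eq_iff)

lemma mscale_mult_vec [simp]: "mscale c A *v x = c *s (A *v x)"
  by (simp add: vec_eq_iff mscale_def matrix_vector_mult_def sum_distrib_left algebra_simps)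

lemma matrix_minus_mult_vec [simp]: "(- A :: 'm::finite cmat) *v x = - (A *v x)"
  by (simp add: vec_eq_iff matrix_vector_mult_def sum_negf)

lemma lie_mult_vec: "lie A B *v x = A *v (B *v x) - B *v (A *v x)"
  by (simp add: lie_def matrix_vector_mult_diff_rdistrib matrix_vector_mul_assoc)

lemma cdot_matrix: "(A *v x) \<star> y = x \<star> (transpose A *v y)"
proof -
  have "(A *v x) \<star> y = (\<Sum>i\<in>UNIV. \<Sum>j\<in>UNIV. A $ i $ j * x $ j * y $ i)"
    by (simp add: cdot_def matrix_vector_mult_def sum_distrib_right)
  also have "\<dots> = (\<Sum>j\<in>UNIV. \<Sum>i\<in>UNIV. A $ i $ j * x $ j * y $ i)"
    by (rule sum.swap)
  also have "\<dots> = x \<star> (transpose A *v y)"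
    by (simp add: cdot_def matrix_vector_mult_def transpose_def sum_distrib_left algebra_simps)
  finally show ?thesis .
qed

lemma cdot_so: "y \<in> so \<Longrightarrow> (y *v a) \<star> b = - (a \<star> (y *v b))"
  by (simp add: cdot_matrix so_def)

lemma cdot_so_self: "y \<in> so \<Longrightarrow> a \<star> (y *v a) = 0"
  using cdot_so[of y a a] by (simp add: cdot_commute[of a])

lemma matrix_mult_axis [simp]: "((A :: 'm::finite cmat) *v axis j 1) $ i = A $ i $ j"
  by (simp add: matrix_vector_mult_def axis_def if_distrib[of "\<lambda>x. _ * x"] cong: if_cong)

lemmas mv_simps = matrix_vector_mult_add_rdistrib matrix_vector_mult_diff_rdistrib
  matrix_vector_right_distrib matrix_vector_mult_diff_distrib vec.scale vec.neg

lemma so_iff_cdot: "y \<in> so \<longleftrightarrow> (\<forall>a b. (y *v a) \<star> b = - (a \<star> (y *v b)))"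
proof
  assume *: "\<forall>a b. (y *v a) \<star> b = - (a \<star> (y *v b))"
  have "y $ i $ j = - y $ j $ i" for i j
    using *[rule_format, of "axis j 1" "axis i 1"] by simp
  then have "y $ j $ i = (- y) $ i $ j" for i j by (metis uminus_apply vector_uminus_component minus_minus)
  then show "y \<in> so" unfolding so_def transpose_def by (simp add: vec_eq_iff del: vector_uminus_component)
qed (simp add: cdot_so)

lemma subspace_so: "cmat.subspace so"
  by (rule cmat.subspaceI) (simp_all add: so_iff_cdot mv_simps)

lemma lie_in_so [simp]: "x \<in> so \<Longrightarrow> y \<in> so \<Longrightarrow> lie x y \<in> so"
  by (simp add: so_iff_cdot lie_mult_vec)

text \<open>Skewness for \<open>\<star>\<close> makes \<open>so\<close> act on bivectors by
  derivations; the explicit brackets below are computed this way.\<close>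

lemma lie_skew: "y \<in> so \<Longrightarrow> lie y (a \<bowtie> b) = (y *v a) \<bowtie> b + a \<bowtie> (y *v b)"
  unfolding matrix_eq
  by (auto simp: lie_mult_vec mv_simps cdot_so)


lemma lie_skew2: "y \<in> so \<Longrightarrow> lie y (lie y (a \<bowtie> b)) =
    (y *v (y *v a)) \<bowtie> b + mscale 2 ((y *v a) \<bowtie> (y *v b)) + a \<bowtie> (y *v (y *v b))"
  unfolding matrix_eq
  by (auto simp: lie_mult_vec mv_simps cdot_so vec_eq_iff algebra_simps)

lemma skew_simps:
  "(a + b) \<bowtie> c = a \<bowtie> c + b \<bowtie> c" "c \<bowtie> (a + b) = c \<bowtie> a + c \<bowtie> b"
  "(a - b) \<bowtie> c = a \<bowtie> c - b \<bowtie> c" "c \<bowtie> (a - b) = c \<bowtie> a - c \<bowtie> b"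
  "(k *s a) \<bowtie> c = mscale k (a \<bowtie> c)" "c \<bowtie> (k *s a) = mscale k (c \<bowtie> a)"
  "(- a) \<bowtie> c = - (a \<bowtie> c)" "c \<bowtie> (- a) = - (c \<bowtie> a)"
  "0 \<bowtie> a = 0" "a \<bowtie> 0 = 0" "a \<bowtie> a = 0"
  by (simp_all add: skew_def vec_eq_iff mscale_def algebra_simps)

lemma skew_swap: "a \<bowtie> b = - (b \<bowtie> a)"
  by (simp add: skew_def vec_eq_iff)

lemma skew_eq_0D:
  assumes "p \<bowtie> q = 0" "p \<noteq> 0"
  obtains k where "q = k *s p"
proof -
  obtain x where x: "p \<star> x \<noteq> 0"
    using \<open>p \<noteq> 0\<close> cdot_eq_0_imp by blast
  have "(q \<star> x) *s p - (p \<star> x) *s q = 0"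
    using arg_cong[OF assms(1), of "\<lambda>A. A *v x"] by simp
  then have "q = ((q \<star> x) / (p \<star> x)) *s p"
    using x by (auto simp: vec_eq_iff field_simps)
  then show ?thesis by (rule that)
qed

section \<open>Dimension counts in C^m\<close>

lemma exists_not_in_span:
  fixes S :: "(complex^'m::finite) set"
  assumes "finite S" "card S < CARD('m)"
  shows "\<exists>d. d \<notin> vec.span S"
proof (rule ccontr)
  assume "\<not> ?thesis"
  then have "vec.dim (UNIV :: (complex^'m) set) \<le> card S"
    by (intro vec.dim_le_card) (use assms in auto)
  then show False
    using assms vec.dimension_def vec_dim_card by (metis not_le)
qed

lemma exists_orthogonal:
  fixes S :: "(complex^'m::finite) set"
  assumes "finite S" "card S < CARD('m)"
  shows "\<exists>x. x \<noteq> 0 \<and> (\<forall>s\<in>S. s \<star> x = 0)"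
proof -
  \<comment> \<open>The vectors of \<open>S\<close> become rows of a square matrix, padded with zero
    rows. The rows do not span, so the matrix is singular, and a kernel vector is orthogonal to
    \<open>S\<close>.\<close>
  obtain f :: "complex^'m \<Rightarrow> 'm" where f: "inj_on f S"
    using card_le_inj[of S "UNIV :: 'm set"] assms by auto
  define g where "g i = (if i \<in> f ` S then inv_into S f i else 0)" for i
  have gf: "g (f s) = s" if "s \<in> S" for s
    using that f by (simp add: g_def)
  define A :: "'m cmat" where "A = (\<chi> i. g i)"
  have "\<not> (\<forall>x. A *v x = 0 \<longrightarrow> x = 0)"
  proof
    assume "\<forall>x. A *v x = 0 \<longrightarrow> x = 0"
    then have "vec.span (rows A) = UNIV"
      using matrix_left_invertible_ker matrix_left_invertible_span_rows_gen by blast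
    moreover have "rows A \<subseteq> vec.span S"
      by (auto simp: rows_def row_def A_def g_def vec_nth_inverse vec.span_zero vec.span_base inv_into_into)
    ultimately have "UNIV \<subseteq> vec.span S"
      by (metis vec.span_minimal vec.subspace_span)
    then show False
      using exists_not_in_span[OF assms] by blast
  qed
  then obtain x where x: "A *v x = 0" "x \<noteq> 0" by blast
  have "s \<star> x = 0" if "s \<in> S" for s
  proof -
    have "s \<star> x = (A *v x) $ f s"
      using gf[OF that] by (simp add: A_def matrix_vector_mult_def cdot_def)
    then show ?thesis using x by simp
  qed
  then show ?thesis using x by blast
qed

section \<open>Decomposable and extremal elements\<close>

definition extremal :: "'m::finite cmat \<Rightarrow> bool" where
  "extremal y \<longleftrightarrow> y \<in> so \<and> (\<forall>x\<in>so. \<exists>c. lie y (lie y x) = mscale c y)"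

text \<open>The equation y \<and> y = 0 contracted with a, b and x, where y is read as the bilinear
  form b \<star> y a. Being polynomial in the entries of y it defines a closed set, as the
  connectedness argument requires.\<close>

definition pluecker_rel :: "'m::finite cmat \<Rightarrow> bool" where
  "pluecker_rel y \<longleftrightarrow> (\<forall>a b x. (b \<star> (y *v a)) *s (y *v x) + ((y *v b) \<star> x) *s (y *v a)
      - ((y *v a) \<star> x) *s (y *v b) = 0)"

lemma pluecker_rel_skew: "pluecker_rel (p \<bowtie> q)"
  by (simp add: pluecker_rel_def vec_eq_iff cdot_commute algebra_simps)

lemma so_nonzeroE:
  assumes "y \<noteq> 0"
  obtains a b where "b \<star> (y *v a) \<noteq> 0"
proof -
  obtain a where "y *v a \<noteq> 0"
    using assms by (auto simp: matrix_eq)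
  then show ?thesis
    using cdot_eq_0_imp[of "y *v a"] that by (metis cdot_commute)
qed

text \<open>Pairing y x = \<alpha> y a + \<beta> y b with b and with a isolates \<alpha> and
  \<beta>, because c \<star> y c = 0 for skew y; skewness turns them into multiples of y b \<star> x
  and y a \<star> x.\<close>

lemma skew_of_range:
  assumes "y \<in> so" "b \<star> (y *v a) \<noteq> 0"
    and range: "\<And>x. \<exists>\<alpha> \<beta>. y *v x = \<alpha> *s (y *v a) + \<beta> *s (y *v b)"
  shows "y = mscale (- 1 / (b \<star> (y *v a))) ((y *v a) \<bowtie> (y *v b))"
proof -
  let ?c = "b \<star> (y *v a)"
  have "?c *s (y *v x) = - ((((y *v b) \<star> x)) *s (y *v a) - ((y *v a) \<star> x) *s (y *v b))" for x
  proof -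
    obtain \<alpha> \<beta> where x: "y *v x = \<alpha> *s (y *v a) + \<beta> *s (y *v b)"
      using range by blast
    have 1: "a \<star> (y *v b) = - ?c"
      using cdot_so[OF assms(1), of a b] by (simp add: cdot_commute)
    have "b \<star> (y *v x) = \<alpha> * ?c"
      unfolding x using cdot_so_self[OF assms(1)] by simp
    then have 2: "(y *v b) \<star> x = - \<alpha> * ?c"
      using cdot_so[OF assms(1), of b x] by simp
    have "a \<star> (y *v x) = - \<beta> * ?c"
      unfolding x using cdot_so_self[OF assms(1)] 1 by simp
    then have 3: "(y *v a) \<star> x = \<beta> * ?c"
      using cdot_so[OF assms(1), of a x] by simp
    show ?thesis unfolding 2 3 unfolding x by (simp add: vec_eq_iff algebra_simps)
  qed
  then have eq: "?c *s (y *v x) = - (((y *v b) \<star> x) *s (y *v a) - ((y *v a) \<star> x) *s (y *v b))" for x .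
  have "y *v x = (- 1 / ?c) *s (((y *v b) \<star> x) *s (y *v a) - ((y *v a) \<star> x) *s (y *v b))" for x
  proof -
    have "y *v x = (1 / ?c) *s (?c *s (y *v x))" using assms(2) by (simp add: vec_eq_iff)
    then show ?thesis unfolding eq by (simp add: vec_eq_iff)
  qed
  then show ?thesis
    unfolding matrix_eq mscale_mult_vec skew_mult_vec by blast
qed

lemma pluecker_rel_eq_skew:
  assumes "y \<in> so" "pluecker_rel y" "b \<star> (y *v a) \<noteq> 0"
  shows "y = mscale (- 1 / (b \<star> (y *v a))) ((y *v a) \<bowtie> (y *v b))"
proof (rule skew_of_range[OF assms(1,3)])
  fix x
  have "(b \<star> (y *v a)) *s (y *v x) + ((y *v b) \<star> x) *s (y *v a) - ((y *v a) \<star> x) *s (y *v b) = 0"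
    using assms(2) unfolding pluecker_rel_def by blast
  then have eq: "(b \<star> (y *v a)) *s (y *v x) = ((y *v a) \<star> x) *s (y *v b) - ((y *v b) \<star> x) *s (y *v a)"
    by (simp add: algebra_simps)
  have "y *v x = (1 / (b \<star> (y *v a))) *s ((b \<star> (y *v a)) *s (y *v x))"
    using assms(3) by (simp add: vec_eq_iff)
  then have "y *v x = (- ((y *v b) \<star> x) / (b \<star> (y *v a))) *s (y *v a)
      + (((y *v a) \<star> x) / (b \<star> (y *v a))) *s (y *v b)"
    unfolding eq by (simp add: vec_eq_iff algebra_simps diff_divide_distrib)
  then show "\<exists>\<alpha> \<beta>. y *v x = \<alpha> *s (y *v a) + \<beta> *s (y *v b)" by blast
qed

lemma pluecker_rel_decomposable:
  assumes "y \<in> so" "pluecker_rel y"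
  obtains p q where "y = p \<bowtie> q"
proof (cases "y = 0")
  case True
  then show ?thesis using that[of 0 0] by (simp add: skew_simps)
next
  case False
  then obtain a b where "b \<star> (y *v a) \<noteq> 0" by (rule so_nonzeroE)
  from pluecker_rel_eq_skew[OF assms this] show ?thesis
    using that[of "(- 1 / (b \<star> (y *v a))) *s (y *v a)" "y *v b"] by (simp only: skew_simps)
qed

text \<open>Contracting the second slot against the standard basis turns identities between
  bivectors into equations between matrices and traces, as \<open>double_ad_nonzero\<close>
  needs.\<close>

lemma contraction_skew:
  fixes P Q :: "'m::finite cmat"
  shows "(\<Sum>j\<in>UNIV. ((P *v a) \<bowtie> (Q *v axis j 1)) *v axis j 1) =
    (\<Sum>j\<in>UNIV. Q $ j $ j) *s (P *v a) - Q *v (P *v a)"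
proof -
  have 1: "Q *v axis j 1 = column j Q" for j
    by (simp add: vec_eq_iff column_def)
  show ?thesis
    unfolding matrix_mult_sum[of Q "P *v a"] 1
    by (simp add: sum_subtractf column_def vec.scale_sum_left)
qed

text \<open>Were (ad y)^2 zero on bivectors, contraction would give (N - 4) y^2 + tr(y^2) = 0 with N
  the matrix size. Taking the trace forces tr(y^2) = 0, so y^2 = 0, and what remains of (ad y)^2 (a
  \<and> b) is 2 (y a \<and> y b), which is nonzero when b \<star> y a is.\<close>

lemma double_ad_nonzero:
  fixes y :: "'m::finite cmat"
  assumes "y \<in> so" "y \<noteq> 0" "CARD('m) > 4"
  obtains a b where "lie y (lie y (a \<bowtie> b)) \<noteq> 0"
proof (rule ccontr)
  assume "\<not> thesis"
  with that have *: "lie y (lie y (a \<bowtie> b)) = 0" for a b by blast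
  let ?N = "of_nat CARD('m) :: complex"
  define t where "t = (\<Sum>j\<in>UNIV. (y ** y) $ j $ j)"
  have tr0: "(\<Sum>j\<in>UNIV. y $ j $ j) = 0"
  proof -
    have "y $ j $ j = 0" for j
      using cdot_so_self[OF assms(1), of "axis j 1"] by simp
    then show ?thesis by simp
  qed
  have eq: "(?N - 4) *s ((y ** y) *v a) + t *s a = 0" for a
  proof -
    have "0 = (\<Sum>j\<in>UNIV. lie y (lie y (a \<bowtie> axis j 1)) *v axis j 1)"
      by (simp add: * )
    also have "\<dots> = (\<Sum>j\<in>UNIV. (((y ** y) *v a) \<bowtie> (mat 1 *v axis j 1)) *v axis j 1)
      + 2 *s (\<Sum>j\<in>UNIV. ((y *v a) \<bowtie> (y *v axis j 1)) *v axis j 1)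
      + (\<Sum>j\<in>UNIV. ((mat 1 *v a) \<bowtie> ((y ** y) *v axis j 1)) *v axis j 1)"
      by (simp add: lie_skew2[OF assms(1)] matrix_vector_mult_add_rdistrib sum.distrib
          vec.scale_sum_right matrix_vector_mul_assoc)
    also have "\<dots> = (?N - 4) *s ((y ** y) *v a) + t *s a"
      unfolding contraction_skew tr0
      by (simp add: t_def trace_def[symmetric] trace_I matrix_vector_mul_assoc vec_eq_iff algebra_simps)
    finally show ?thesis by simp
  qed
  have "(?N - 4) * (y ** y) $ j $ j + t = 0" for j
    using arg_cong[OF eq[of "axis j 1"], of "\<lambda>v. v $ j"]
    by (simp add: algebra_simps)
  then have "(\<Sum>j\<in>UNIV. (?N - 4) * (y ** y) $ (j::'m) $ j + t) = 0" by simp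
  then have "(?N - 4) * t + ?N * t = 0"
    by (simp add: sum.distrib t_def sum_distrib_left)
  then have "(2 * ?N - 4) * t = 0" by (simp add: algebra_simps)
  moreover have ne: "2 * ?N - 4 \<noteq> 0" "?N - 4 \<noteq> 0"
    using assms(3) by (auto simp: complex_eq_iff)
  ultimately have "t = 0" by auto
  then have sq: "y *v (y *v a) = 0" for a
    using eq[of a] ne by (simp add: matrix_vector_mul_assoc)
  obtain a b where ab: "b \<star> (y *v a) \<noteq> 0" using so_nonzeroE[OF assms(2)] .
  have "mscale 2 ((y *v a) \<bowtie> (y *v b)) *v a = 0"
    using *[of a b] unfolding lie_skew2[OF assms(1)] sq by (simp add: skew_simps)
  moreover have "(y *v a) \<star> a = 0"
    using cdot_so_self[OF assms(1), of a] by (simp add: cdot_commute)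
  moreover have "(y *v b) \<star> a \<noteq> 0"
    using ab cdot_so[OF assms(1), of b a] by simp
  ultimately have "y *v a = 0" by simp
  then show False using ab by simp
qed

lemma skew_range_of_scale:
  assumes "y \<in> so" "mscale c y = p \<bowtie> q" "c \<noteq> 0"
  shows "y = ((1 / c) *s p) \<bowtie> q"
proof -
  have "y = mscale (1 / c) (mscale c y)" using assms(3) by (simp add: mscale_def vec_eq_iff)
  then show ?thesis unfolding assms(2) by (simp add: skew_simps)
qed

text \<open>If \<open>[y, [y, a \<and> b]]\<close> is a nonzero multiple of \<open>y\<close>, then the range of \<open>y\<close> lies in the span of the six
  vectors occurring in \<open>lie_skew2\<close>.\<close>

lemma extremal_singular:
  fixes y :: "'m::finite cmat"
  assumes "extremal y" "y \<noteq> 0" "CARD('m) > 6"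
  obtains w where "w \<noteq> 0" "y *v w = 0"
proof (rule ccontr)
  assume "\<not> thesis"
  with that have inj: "y *v w = 0 \<longrightarrow> w = 0" for w by blast
  have y: "y \<in> so" using assms(1) by (simp add: extremal_def)
  obtain B where "B ** y = mat 1"
    using matrix_left_invertible_ker[of y] inj by blast
  then have "y ** B = mat 1"
    using matrix_left_right_inverse by blast
  then have surj: "y *v (B *v d) = d" for d
    by (simp add: matrix_vector_mul_assoc)
  obtain a b where ab: "lie y (lie y (a \<bowtie> b)) \<noteq> 0"
    using double_ad_nonzero[OF y assms(2)] assms(3) by auto
  obtain c where c: "lie y (lie y (a \<bowtie> b)) = mscale c y"
    using assms(1) unfolding extremal_def by (meson skew_in_so)
  have "c \<noteq> 0"
    using ab c by (auto simp: mscale_def vec_eq_iff)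
  define S where "S = {y *v (y *v a), b, y *v a, y *v b, a, y *v (y *v b)}"
  have "y *v x \<in> vec.span S" for x
  proof -
    have "c *s (y *v x) = lie y (lie y (a \<bowtie> b)) *v x" by (simp add: c)
    also have "\<dots> \<in> vec.span S"
      unfolding lie_skew2[OF y] by (simp add: mv_simps)
        (intro vec.span_add vec.span_diff vec.span_scale; simp add: S_def vec.span_base)
    finally have "(1 / c) *s (c *s (y *v x)) \<in> vec.span S" by (rule vec.span_scale)
    then show ?thesis using \<open>c \<noteq> 0\<close> by simp
  qed
  then have "d \<in> vec.span S" for d by (metis surj)
  moreover have "card S \<le> 6"
    using card_length[of "[y *v (y *v a), b, y *v a, y *v b, a, y *v (y *v b)]"] by (simp add: S_def)
  ultimately show False
    using exists_not_in_span[of S] assms(3) by (auto simp: S_def)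
qed

text \<open>For indecomposable \<open>y\<close>, every decomposable value of (ad y)^2 must be zero.
  This gives y a \<and> y b = 0 on the kernel of y^2, and w \<and> y^2 b = 0 for w in the kernel of
  \<open>y\<close>. So y^2 has rank at most one, its kernel has codimension at most one, and
  \<open>y\<close> maps this kernel into a line. Then \<open>y\<close> has rank at most two, against
  \<open>skew_of_range\<close>.\<close>

lemma extremal_decomposable:
  fixes y :: "'m::finite cmat"
  assumes "extremal y" "CARD('m) > 6"
  obtains p q where "y = p \<bowtie> q"
proof (cases "y = 0")
  case True
  then show ?thesis using that[of 0 0] by (simp add: skew_simps)
next
  case False
  have y: "y \<in> so" using assms(1) by (simp add: extremal_def)
  have ext: "\<exists>c. lie y (lie y (a \<bowtie> b)) = mscale c y" for a b
    using assms(1) unfolding extremal_def by (meson skew_in_so)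
  show ?thesis
  proof (rule ccontr)
    assume "\<not> thesis"
    with that have nd: "y \<noteq> p \<bowtie> q" for p q by blast
    have key: "(y *v a) \<bowtie> (y *v b) = 0" if "y *v (y *v a) = 0" "y *v (y *v b) = 0" for a b
    proof -
      obtain c where "lie y (lie y (a \<bowtie> b)) = mscale c y" using ext by blast
      then have c: "mscale c y = (2 *s (y *v a)) \<bowtie> (y *v b)"
        unfolding lie_skew2[OF y] that by (simp add: skew_simps)
      then have "c = 0"
        using nd skew_range_of_scale[OF y c] by blast
      then have "mscale 2 ((y *v a) \<bowtie> (y *v b)) = 0"
        using c by (simp add: skew_simps mscale_def vec_eq_iff)
      then show ?thesis by (simp add: mscale_def vec_eq_iff)
    qed
    obtain w where w: "w \<noteq> 0" "y *v w = 0"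
      using extremal_singular[OF assms(1) False assms(2)] .
    have "\<exists>k. y *v (y *v b) = k *s w" for b
    proof -
      obtain c where "lie y (lie y (w \<bowtie> b)) = mscale c y" using ext by blast
      then have c: "mscale c y = w \<bowtie> (y *v (y *v b))"
        unfolding lie_skew2[OF y] using w by (simp add: skew_simps mscale_def vec_eq_iff)
      then have "c = 0"
        using nd skew_range_of_scale[OF y c] by blast
      then have "w \<bowtie> (y *v (y *v b)) = 0"
        using c by (simp add: mscale_def vec_eq_iff)
      then show ?thesis using w(1) by (metis skew_eq_0D)
    qed
    then obtain k where k: "\<And>b. y *v (y *v b) = k b *s w" by metis
    obtain a b where ab: "b \<star> (y *v a) \<noteq> 0" using so_nonzeroE[OF False] .
    have ba: "(y *v b) \<star> a \<noteq> 0" using ab cdot_so[OF y, of b a] by simp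
    have bb: "(y *v b) \<star> b = 0" "(y *v a) \<star> a = 0"
      using cdot_so_self[OF y] by (simp_all add: cdot_commute)
    obtain x where x: "\<And>\<alpha> \<beta>. y *v x \<noteq> \<alpha> *s (y *v a) + \<beta> *s (y *v b)"
    proof (rule ccontr)
      assume "\<not> thesis"
      with that have "\<exists>\<alpha> \<beta>. y *v x = \<alpha> *s (y *v a) + \<beta> *s (y *v b)" for x by blast
      from skew_of_range[OF y ab this] nd show False by (metis skew_simps(5))
    qed
    have indep: "(y *v b) \<noteq> \<mu> *s (y *v a)" "y *v a \<noteq> \<mu> *s (y *v b)" for \<mu>
      using ba ab bb by (metis cdot_simps(7) mult_zero_right, metis cdot_commute cdot_simps(7) mult_zero_right bb)
    have comb: "y *v (c *s u - d *s v) = c *s (y *v u) - d *s (y *v v)" for c d u v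
      by (simp add: mv_simps)
    \<comment> \<open>When y^2 u \<noteq> 0, multiples of \<open>u\<close> move \<open>v\<close> and
      \<open>x\<close> into the kernel of y^2, where \<open>key\<close> makes their images
      proportional.\<close>
    have step: False if "y *v u \<noteq> 0" "\<And>\<mu>. y *v v \<noteq> \<mu> *s (y *v u)"
        "\<And>\<alpha> \<beta>. y *v x \<noteq> \<alpha> *s (y *v u) + \<beta> *s (y *v v)" "k u \<noteq> 0" for u v
    proof -
      define v' where "v' = 1 *s v - (k v / k u) *s u"
      define x' where "x' = 1 *s x - (k x / k u) *s u"
      have "y *v (y *v v') = 0" "y *v (y *v x') = 0"
        unfolding v'_def x'_def comb k using that(4) by simp_all
      then have "(y *v v') \<bowtie> (y *v x') = 0" by (rule key)
      moreover have "y *v v' \<noteq> 0"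
        using that(2)[of "k v / k u"] unfolding v'_def comb by simp
      ultimately obtain c where "y *v x' = c *s (y *v v')" by (rule skew_eq_0D)
      then have "y *v x = ((k x / k u) - c * (k v / k u)) *s (y *v u) + c *s (y *v v)"
        unfolding v'_def x'_def comb by (simp add: vec_eq_iff algebra_simps)
      then show False using that(3) by blast
    qed
    have "k a = 0"
      using step[of a b] indep(1) x ab by force
    moreover have "k b = 0"
      using step[of b a] indep(2) x ba by (metis add.commute cdot_simps(9))
    ultimately have "(y *v a) \<bowtie> (y *v b) = 0" by (intro key) (simp_all add: k)
    moreover have "y *v a \<noteq> 0" using ab by auto
    ultimately show False using indep(1) by (metis skew_eq_0D)
  qed
qed

text \<open>Evaluated at a vector c orthogonal to p and q, hence killed by \<open>y\<close>,
  extremality says (b \<star> c) y^2 a = (a \<star> c) y^2 b. The vector \<open>c'\<close>,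
  orthogonal to \<open>g\<close> as well, gives y^2 g = 0; then \<open>c\<close>, with g \<star> c =
  1, carries this over to every a.\<close>

lemma extremal_square_zero:
  fixes y :: "'m::finite cmat"
  assumes "extremal y" "CARD('m) > 6"
  shows "y *v (y *v a) = 0"
proof -
  have y: "y \<in> so" using assms(1) by (simp add: extremal_def)
  obtain p q where pq: "y = p \<bowtie> q" using extremal_decomposable[OF assms] .
  have c2: "card {p, q} \<le> 2" "card {p, q, g} \<le> 3" for g
    using card_length[of "[p,q]"] card_length[of "[p,q,g]"] by auto
  obtain c where c: "c \<noteq> 0" "p \<star> c = 0" "q \<star> c = 0"
    using exists_orthogonal[of "{p, q}"] c2(1) assms(2) by auto
  obtain g0 where "c \<star> g0 \<noteq> 0" using c cdot_eq_0_imp by blast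
  then obtain g where g: "g \<star> c = 1"
    using that[of "(1 / (c \<star> g0)) *s g0"] by (simp add: cdot_commute[of _ c])
  obtain c' where c': "c' \<noteq> 0" "p \<star> c' = 0" "q \<star> c' = 0" "g \<star> c' = 0"
    using exists_orthogonal[of "{p, q, g}"] c2(2)[of g] assms(2) by auto
  obtain g0' where "c' \<star> g0' \<noteq> 0" using c' cdot_eq_0_imp by blast
  then obtain g' where g': "g' \<star> c' = 1"
    using that[of "(1 / (c' \<star> g0')) *s g0'"] by (simp add: cdot_commute[of _ c'])
  have main: "(b \<star> c) *s (y *v (y *v a)) = (a \<star> c) *s (y *v (y *v b))"
    if "p \<star> c = 0" "q \<star> c = 0" for a b c
  proof -
    have yc: "y *v c = 0" using that by (simp add: pq)
    obtain k where "lie y (lie y (a \<bowtie> b)) = mscale k y"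
      using assms(1) unfolding extremal_def by (meson skew_in_so)
    then have "lie y (lie y (a \<bowtie> b)) *v c = 0" by (simp add: yc)
    then show ?thesis
      unfolding lie_skew2[OF y] using yc by (simp add: mv_simps cdot_so[OF y])
  qed
  have "y *v (y *v g) = 0"
    using main[OF c'(2,3), of g' g] c'(4) g' by simp
  then show ?thesis
    using main[OF c(2,3), of g a] g by simp
qed

text \<open>When y^2 = 0, (ad y)^2 x = -2 y x y, and for a bivector y and skew x the product y x y
  is a multiple of y.\<close>

lemma double_ad_skew:
  assumes sq: "\<And>a. (p \<bowtie> q) *v ((p \<bowtie> q) *v a) = 0" and x: "x \<in> so"
  shows "lie (p \<bowtie> q) (lie (p \<bowtie> q) x) = mscale (- 2 * (q \<star> (x *v p))) (p \<bowtie> q)"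
proof -
  have pp: "p \<star> (x *v p) = 0" "q \<star> (x *v q) = 0" "p \<star> (x *v q) = - (q \<star> (x *v p))"
    using cdot_so_self[OF x] cdot_so[OF x, of q p] by (simp_all add: cdot_commute)
  have "lie (p \<bowtie> q) (lie (p \<bowtie> q) x) *v a = mscale (- 2 * (q \<star> (x *v p))) (p \<bowtie> q) *v a" for a
  proof -
    have "lie (p \<bowtie> q) (lie (p \<bowtie> q) x) *v a = (-2) *s ((p \<bowtie> q) *v (x *v ((p \<bowtie> q) *v a)))"
      unfolding lie_mult_vec using sq
      by (simp add: mv_simps del: skew_mult_vec) (simp add: vec_eq_iff del: skew_mult_vec)
    also have "\<dots> = mscale (- 2 * (q \<star> (x *v p))) (p \<bowtie> q) *v a"
      by (simp add: mv_simps pp vec_eq_iff algebra_simps)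
    finally show ?thesis .
  qed
  then show ?thesis unfolding matrix_eq by blast
qed

text \<open>The converse of \<open>extremal_decomposable\<close> and
  \<open>extremal_square_zero\<close>: in size above 6 the extremal elements are exactly the
  bivectors of square zero.\<close>

lemma skew_extremal:
  assumes sq: "\<And>a. (p \<bowtie> q) *v ((p \<bowtie> q) *v a) = 0"
  shows "extremal (p \<bowtie> q)"
  unfolding extremal_def using double_ad_skew[OF sq] skew_in_so by blast

lemma lie_simps:
  "lie (a + b) c = lie a c + lie b c" "lie a (b + c) = lie a b + lie a c"
  "lie (a - b) c = lie a c - lie b c" "lie a (b - c) = lie a b - lie a c"
  "lie (mscale k a) c = mscale k (lie a c)" "lie a (mscale k c) = mscale k (lie a c)"
  "lie (- a) c = - lie a c" "lie a (- c) = - lie a c" "lie 0 a = 0" "lie a 0 = 0" "lie a a = 0"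
  unfolding matrix_eq
  by (simp_all add: lie_mult_vec mv_simps vector_ssub_ldistrib algebra_simps)

lemma lie_swap: "lie a b = - lie b a"
  by (simp add: lie_def)

lemma lie_jacobi: "lie a (lie b c) = lie (lie a b) c + lie b (lie a c)"
  unfolding matrix_eq by (simp add: lie_mult_vec mv_simps)

lemma skew_nonzero_dual:
  assumes "p \<bowtie> q \<noteq> 0"
  obtains x y where "p \<star> x = 1" "q \<star> x = 0" "p \<star> y = 0" "q \<star> y = 1"
proof -
  obtain a b where "b \<star> ((p \<bowtie> q) *v a) \<noteq> 0" using so_nonzeroE[OF assms] .
  \<comment> \<open>\<open>d\<close> is the 2 by 2 determinant of the pairings of p, q with a, b;
    the witnesses below are Cramer's rule.\<close>
  then obtain d where d: "d = (q \<star> a) * (p \<star> b) - (p \<star> a) * (q \<star> b)" "d \<noteq> 0"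
    by (simp add: cdot_commute)
  show ?thesis
  proof (rule that)
    show "p \<star> ((1 / d) *s ((q \<star> a) *s b - (q \<star> b) *s a)) = 1"
      "q \<star> ((1 / d) *s ((q \<star> a) *s b - (q \<star> b) *s a)) = 0"
      "p \<star> ((1 / d) *s ((p \<star> b) *s a - (p \<star> a) *s b)) = 0"
      "q \<star> ((1 / d) *s ((p \<star> b) *s a - (p \<star> a) *s b)) = 1"
      using d by (simp_all add: field_simps)
  qed
qed

lemma skew_square_zero_isotropic:
  assumes "p \<bowtie> q \<noteq> 0" "\<And>a. (p \<bowtie> q) *v ((p \<bowtie> q) *v a) = 0"
  shows "p \<star> p = 0" "p \<star> q = 0" "q \<star> q = 0"
proof -
  obtain x y where xy: "p \<star> x = 1" "q \<star> x = 0" "p \<star> y = 0" "q \<star> y = 1"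
    using skew_nonzero_dual[OF assms(1)] .
  have "w \<star> ((p \<bowtie> q) *v ((p \<bowtie> q) *v a)) = 0" for w a using assms(2) by simp
  from this[of x x] this[of x y] this[of y y] this[of y x] show "p \<star> p = 0" "p \<star> q = 0" "q \<star> q = 0"
    by (simp_all add: xy mv_simps cdot_commute)
qed

section \<open>Hyperbolic frames\<close>

locale hyperbolic =
  fixes n :: nat and u v u' v' :: "complex^'m::finite"
  assumes card_eq: "CARD('m) = n + 4" and n_ge: "n \<ge> 4"
    and frame_dots: "u \<star> u = 0" "u \<star> v = 0" "v \<star> v = 0" "u' \<star> u' = 0" "u' \<star> v' = 0" "v' \<star> v' = 0"
      "u \<star> u' = 1" "u \<star> v' = 0" "v \<star> u' = 0" "v \<star> v' = 1"
begin

lemma frame_dots' [simp]: "u \<star> u = 0" "u \<star> v = 0" "v \<star> v = 0" "u' \<star> u' = 0" "u' \<star> v' = 0" "v' \<star> v' = 0"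
      "u \<star> u' = 1" "u \<star> v' = 0" "v \<star> u' = 0" "v \<star> v' = 1"
      "v \<star> u = 0" "v' \<star> u' = 0" "u' \<star> u = 1" "v' \<star> u = 0" "u' \<star> v = 0" "v' \<star> v = 1"
  using frame_dots by (simp_all add: cdot_commute)

definition U where "U = {a. u \<star> a = 0 \<and> v \<star> a = 0 \<and> u' \<star> a = 0 \<and> v' \<star> a = 0}"

lemma U_dots [simp]:
  assumes "a \<in> U"
  shows "u \<star> a = 0" "v \<star> a = 0" "u' \<star> a = 0" "v' \<star> a = 0"
    "a \<star> u = 0" "a \<star> v = 0" "a \<star> u' = 0" "a \<star> v' = 0"
  using assms by (simp_all add: U_def cdot_commute)

lemma U_closed: "a \<in> U \<Longrightarrow> b \<in> U \<Longrightarrow> a + b \<in> U" "a \<in> U \<Longrightarrow> k *s a \<in> U" "0 \<in> U"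
    "a \<in> U \<Longrightarrow> b \<in> U \<Longrightarrow> a - b \<in> U" "a \<in> U \<Longrightarrow> - a \<in> U"
  by (simp_all add: U_def del: U_dots)

text \<open>Gram-Schmidt for a bilinear form, where the next vector must also be kept from being
  isotropic. The optional \<open>w0\<close> prescribes the first vector, so that a given unit vector
  can be extended.\<close>

lemma orthonormal_in_U:
  assumes "k \<le> n" "w0 = None \<or> (\<exists>a. w0 = Some a \<and> a \<in> U \<and> a \<star> a = 1 \<and> k > 0)"
  shows "\<exists>e. (\<forall>i<k. e i \<in> U) \<and> (\<forall>i<k. \<forall>j<k. e i \<star> e j = (if i = j then 1 else 0))
    \<and> (\<forall>a. w0 = Some a \<longrightarrow> e 0 = a)"
  using assms
proof (induction k)
  case 0
  then show ?case by auto
next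
  case (Suc k)
  show ?case
  proof (cases "k = 0 \<and> w0 \<noteq> None")
    case True
    then obtain a where "w0 = Some a" "a \<in> U" "a \<star> a = 1" using Suc.prems by auto
    then show ?thesis using True by (intro exI[of _ "\<lambda>_. a"]) auto
  next
    case False
    then obtain e where e: "\<And>i. i < k \<Longrightarrow> e i \<in> U"
        "\<And>i j. i < k \<Longrightarrow> j < k \<Longrightarrow> e i \<star> e j = (if i = j then 1 else 0)"
        "\<And>a. w0 = Some a \<Longrightarrow> e 0 = a"
      using Suc by force
    define S where "S = {u, v, u', v'} \<union> e ` {..<k}"
    have "card {u, v, u', v'} \<le> 4"
      using card_length[of "[u, v, u', v']"] by simp
    moreover have "card (e ` {..<k}) \<le> k" using card_image_le[of "{..<k}" e] by simp
    ultimately have "card S < CARD('m)"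
      using card_Un_le[of "{u, v, u', v'}" "e ` {..<k}"] Suc.prems(1) unfolding S_def card_eq by linarith
    then obtain x where x: "x \<noteq> 0" "\<forall>s\<in>S. s \<star> x = 0"
      using exists_orthogonal[of S] by (auto simp: S_def)
    have x': "x \<in> U" "\<And>i. i < k \<Longrightarrow> e i \<star> x = 0" "\<And>i. i < k \<Longrightarrow> x \<star> e i = 0"
      using x(2) by (auto simp: S_def U_def cdot_commute simp del: U_dots)
    obtain y0 where y0: "x \<star> y0 \<noteq> 0" using cdot_eq_0_imp x(1) by blast
    \<comment> \<open>The projection of \<open>y0\<close> to the complement. Its pairing with
      \<open>x\<close> is that of \<open>y0\<close>, since \<open>x\<close> is orthogonal to all
      subtracted vectors; hence one of x, y, x + y is not isotropic.\<close>
    define y where "y = y0 - (u' \<star> y0) *s u - (u \<star> y0) *s u' - (v' \<star> y0) *s v - (v \<star> y0) *s v'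
      - (\<Sum>i<k. (e i \<star> y0) *s e i)"
    have s0: "(\<Sum>i<k. (e i \<star> y0) *s e i) \<star> w = (\<Sum>i<k. (e i \<star> y0) * (e i \<star> w))" for w
      by (simp add: cdot_sum_left)
    have s1: "w \<star> (\<Sum>i<k. (e i \<star> y0) *s e i) = (\<Sum>i<k. (e i \<star> y0) * (e i \<star> w))" for w
      using s0[of w] by (simp add: cdot_commute)
    have y: "y \<in> U" unfolding U_def using e(1) by (simp add: y_def s1)
    have ye: "e j \<star> y = 0" if "j < k" for j
    proof -
      have "(\<Sum>i<k. (e i \<star> y0) * (e i \<star> e j)) = (\<Sum>i<k. if i = j then e j \<star> y0 else 0)"
        using that e(2) by (intro sum.cong) auto
      then show ?thesis using that e(1) by (simp add: y_def s1)
    qed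
    have xy: "x \<star> y \<noteq> 0" using y0 x' by (simp add: y_def s1)
    have "\<exists>w. w \<in> U \<and> (\<forall>j<k. e j \<star> w = 0) \<and> w \<star> w \<noteq> 0"
    proof (cases "x \<star> x = 0 \<and> y \<star> y = 0")
      case True
      then have "(x + y) \<star> (x + y) \<noteq> 0" using xy by (simp add: cdot_commute[of y x])
      then show ?thesis using x' y ye by (intro exI[of _ "x + y"]) (simp add: U_closed)
    qed (use x' y ye in blast)
    then obtain w where w: "w \<in> U" "\<And>j. j < k \<Longrightarrow> e j \<star> w = 0" "w \<star> w \<noteq> 0" by blast
    define w1 where "w1 = (1 / csqrt (w \<star> w)) *s w"
    have w1: "w1 \<in> U" "\<And>j. j < k \<Longrightarrow> e j \<star> w1 = 0" "w1 \<star> w1 = 1"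
      using w by (simp_all add: w1_def U_closed power2_csqrt[unfolded power2_eq_square] flip: power2_eq_square)
    have w2: "\<And>j. j < k \<Longrightarrow> w1 \<star> e j = 0" using w1(2) by (simp add: cdot_commute)
    show ?thesis
      using e w1 w2 False by (intro exI[of _ "e(k := w1)"]) (auto simp: less_Suc_eq)
  qed
qed

end

locale frame = hyperbolic n u v u' v' for n and u v u' v' :: "complex^'m::finite" +
  fixes e :: "nat \<Rightarrow> complex^'m"
  assumes e_U [simp]: "i < n \<Longrightarrow> e i \<in> U"
    and e_dots [simp]: "i < n \<Longrightarrow> j < n \<Longrightarrow> e i \<star> e j = (if i = j then 1 else 0)"
begin

text \<open>The families e, u, v, u', v' and e, u', v', u, v are dual to each other, so the matrices
  with these rows and these columns are mutually inverse.\<close>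

lemma eq_0_frame:
  assumes "u \<star> x = 0" "v \<star> x = 0" "u' \<star> x = 0" "v' \<star> x = 0" "\<And>i. i < n \<Longrightarrow> e i \<star> x = 0"
  shows "x = 0"
proof -
  have "card {..<n + 4} = CARD('m)" by (simp add: card_eq)
  then obtain idx :: "'m \<Rightarrow> nat" where idx: "bij_betw idx UNIV {..<n + 4}"
    by (metis bij_betw_iff_card finite finite_lessThan)
  have lt: "idx i < n + 4" for i using idx by (auto simp: bij_betw_def)
  have inj: "idx i = idx j \<longleftrightarrow> i = j" for i j using idx by (auto simp: bij_betw_def inj_eq)
  define f where "f i = (if i < n then e i else [u, v, u', v'] ! (i - n))" for i
  define g where "g i = (if i < n then e i else [u', v', u, v] ! (i - n))" for i
  have four: "i = n \<or> i = Suc n \<or> i = Suc (Suc n) \<or> i = Suc (Suc (Suc n))" if "i < n + 4" "\<not> i < n" for i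
    using that by auto
  have fg: "f i \<star> g j = (if i = j then 1 else 0)" if "i < n + 4" "j < n + 4" for i j
    using four[OF that(1)] four[OF that(2)]
    by (cases "i < n"; cases "j < n") (auto simp: f_def g_def)
  define A B :: "'m cmat" where "A = (\<chi> i. f (idx i))" and "B = (\<chi> i j. g (idx j) $ i)"
  have "A ** B = mat 1"
    by (simp add: A_def B_def matrix_matrix_mult_def mat_def vec_eq_iff fg lt inj flip: cdot_def)
  then have BA: "B ** A = mat 1" by (rule matrix_left_right_inverse1)
  have "A *v x = 0"
  proof -
    have "f i \<star> x = 0" if "i < n + 4" for i
      using four[OF that] assms by (cases "i < n") (auto simp: f_def)
    then show ?thesis
      by (simp add: A_def matrix_vector_mult_def vec_eq_iff lt flip: cdot_def)
  qed
  then have "(B ** A) *v x = 0" by (simp flip: matrix_vector_mul_assoc)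
  then show ?thesis by (simp add: BA)
qed

lemma frame_expand:
  "x = (u' \<star> x) *s u + (v' \<star> x) *s v + (u \<star> x) *s u' + (v \<star> x) *s v' + (\<Sum>i<n. (e i \<star> x) *s e i)"
proof -
  have s: "w \<star> (\<Sum>i<n. (e i \<star> x) *s e i) = (\<Sum>i<n. (e i \<star> x) * (e i \<star> w))" for w
    by (simp add: cdot_commute[of w] cdot_sum_left)
  have "(\<Sum>i<n. (e i \<star> x) * (e i \<star> e j)) = (\<Sum>i<n. if i = j then e j \<star> x else 0)" if "j < n" for j
    using that by (intro sum.cong) auto
  then have "x - ((u' \<star> x) *s u + (v' \<star> x) *s v + (u \<star> x) *s u' + (v \<star> x) *s v' + (\<Sum>i<n. (e i \<star> x) *s e i)) = 0"
    by (intro eq_0_frame) (simp_all add: s)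
  then show ?thesis by simp
qed

lemma U_expand: "a \<in> U \<Longrightarrow> a = (\<Sum>i<n. (e i \<star> a) *s e i)"
  using frame_expand[of a] by simp

lemma matrix_eq_frame:
  assumes "A *v u = B *v u" "A *v v = B *v v" "A *v u' = B *v u'" "A *v v' = B *v v'"
    "\<And>a. a \<in> U \<Longrightarrow> A *v a = B *v a"
  shows "A = B"
proof -
  have "A *v x = B *v x" for x
  proof -
    have "(\<Sum>i<n. (e i \<star> x) *s e i) \<in> U"
      unfolding U_def by (simp add: cdot_commute[of _ "sum _ _"] cdot_sum_left)
    then show ?thesis
      by (subst (1 2) frame_expand[of x]) (simp add: mv_simps assms)
  qed
  then show ?thesis by (simp add: matrix_eq)
qed

section \<open>The element h and its weights on so\<close>

definition h where "h = u \<bowtie> u' + v \<bowtie> v'"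

definition W where "W = {u \<bowtie> a + v \<bowtie> b |a b. a \<in> U \<and> b \<in> U}"

lemma h_mult_vec: "h *v y = (u' \<star> y) *s u + (v' \<star> y) *s v - (u \<star> y) *s u' - (v \<star> y) *s v'"
  by (simp add: h_def mv_simps)

lemma h_frame [simp]: "h *v u = u" "h *v v = v" "h *v u' = - u'" "h *v v' = - v'" "a \<in> U \<Longrightarrow> h *v a = 0"
  by (simp_all add: h_mult_vec)

lemma h_in_so [simp]: "h \<in> so"
  unfolding h_def by (intro cmat.subspace_add[OF subspace_so]) simp_all

lemma h_cube: "h *v (h *v (h *v y)) = h *v y"
  by (simp add: h_mult_vec)

lemma h_eq_self:
  assumes "h *v y = y"
  shows "y = (u' \<star> y) *s u + (v' \<star> y) *s v"
proof -
  have "u \<star> (h *v y) = - (u \<star> y)" "v \<star> (h *v y) = - (v \<star> y)"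
    by (simp_all add: h_mult_vec)
  moreover have "c = - c \<Longrightarrow> c = 0" for c :: complex
    by (simp add: complex_eq_iff)
  ultimately have "u \<star> y = 0" "v \<star> y = 0"
    unfolding assms by blast+
  then have "h *v y = (u' \<star> y) *s u + (v' \<star> y) *s v"
    unfolding h_mult_vec by simp
  then show ?thesis unfolding assms .
qed

lemma h_eq_0:
  assumes "h *v y = 0"
  shows "y \<in> U"
proof -
  have "w \<star> (h *v y) = 0" for w by (simp add: assms)
  from this[of u] this[of v] this[of u'] this[of v'] show ?thesis
    unfolding U_def by (simp add: h_mult_vec)
qed

text \<open>h^3 = h leaves only the eigenvalues 0, 1 and -1.\<close>

lemma h_eq_other:
  assumes "h *v y = k *s y" "k \<noteq> 0" "k \<noteq> 1" "k \<noteq> -1"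
  shows "y = 0"
proof -
  have "k *s y = (k * k * k) *s y"
    using h_cube[of y] by (simp add: assms(1) mv_simps mult.assoc)
  then have "k * y $ i = k * k * k * y $ i" for i
    using arg_cong[of _ _ "\<lambda>x. x $ i"] by fastforce
  then have "(k * (k - 1) * (k + 1)) * y $ i = 0" for i
    by (simp only: algebra_simps) simp
  moreover have "k + 1 \<noteq> 0" using assms(4) by (metis add_eq_0_iff2)
  ultimately show ?thesis using assms(2-4) by (simp add: vec_eq_iff)
qed

lemma cdot_so_swap: "x \<in> so \<Longrightarrow> a \<star> (x *v b) = - (b \<star> (x *v a))"
  using cdot_so[of x a b] by (simp add: cdot_commute)

text \<open>By skewness the range of t is orthogonal to u, v and U, hence lies in the plane of u and
  v; the single free entry is u' \<star> t v'.\<close>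

lemma so_eq_scale_z:
  assumes t: "t \<in> so" and "t *v u = 0" "t *v v = 0" and U: "\<And>a. a \<in> U \<Longrightarrow> t *v a = 0"
  shows "\<exists>c. t = mscale c (u \<bowtie> v)"
proof -
  define c where "c = u' \<star> (t *v v')"
  have d: "u \<star> (t *v x) = 0" "v \<star> (t *v x) = 0" "\<And>i. i < n \<Longrightarrow> e i \<star> (t *v x) = 0" for x
    using cdot_so_swap[OF t, of _ x] assms by simp_all
  have "t = mscale c (u \<bowtie> v)"
  proof (rule matrix_eq_frame)
    have c': "v' \<star> (t *v u') = - c" unfolding c_def by (rule cdot_so_swap[OF t])
    show "t *v u' = mscale c (u \<bowtie> v) *v u'"
      using frame_expand[of "t *v u'"] by (simp add: d cdot_so_self[OF t] c')
    show "t *v v' = mscale c (u \<bowtie> v) *v v'"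
      using frame_expand[of "t *v v'"] by (simp add: d cdot_so_self[OF t] c_def)
  qed (use assms in simp_all)
  then show ?thesis by blast
qed

text \<open>An element of weight k under ad h shifts the eigenvalues of h by k. As these are -1, 0
  and 1, weight 2 leaves just the passage from u', v' to u, v.\<close>

lemma weight_2:
  assumes t: "t \<in> so" and w: "lie h t = mscale 2 t"
  shows "\<exists>c. t = mscale c (u \<bowtie> v)"
proof (rule so_eq_scale_z[OF t])
  have eq: "h *v (t *v y) = 2 *s (t *v y) + t *v (h *v y)" for y
    using arg_cong[OF w, of "\<lambda>A. A *v y"] by (simp add: lie_mult_vec algebra_simps)
  show "t *v u = 0"
    using eq[of u] by (intro h_eq_other[of _ 3]) (simp_all add: vec_eq_iff)
  show "t *v v = 0"
    using eq[of v] by (intro h_eq_other[of _ 3]) (simp_all add: vec_eq_iff)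
  show "t *v a = 0" if "a \<in> U" for a
    using eq[of a] that by (intro h_eq_other[of _ 2]) (simp_all add: vec_eq_iff)
qed

text \<open>Here u', v' go into U, and U goes into the plane of u and v. By skewness the first map
  determines the second, so t u' and t v' determine t.\<close>

lemma weight_1:
  assumes t: "t \<in> so" and w: "lie h t = t"
  shows "t \<in> W"
proof -
  have eq: "h *v (t *v y) = t *v y + t *v (h *v y)" for y
    using arg_cong[OF w, of "\<lambda>A. A *v y"] by (simp add: lie_mult_vec algebra_simps)
  have 1: "t *v u = 0"
    using eq[of u] by (intro h_eq_other[of _ 2]) (simp_all add: vec_eq_iff)
  have 2: "t *v v = 0"
    using eq[of v] by (intro h_eq_other[of _ 2]) (simp_all add: vec_eq_iff)
  have 3: "- (t *v u') \<in> U" "- (t *v v') \<in> U"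
    using eq[of u'] eq[of v'] by (simp_all add: h_eq_0 mv_simps U_closed(5))
  have 4: "t *v a = (u' \<star> (t *v a)) *s u + (v' \<star> (t *v a)) *s v" if "a \<in> U" for a
    using eq[of a] that by (intro h_eq_self) simp
  have "t = u \<bowtie> (- (t *v u')) + v \<bowtie> (- (t *v v'))"
  proof (rule matrix_eq_frame)
    show "t *v u = (u \<bowtie> (- (t *v u')) + v \<bowtie> (- (t *v v'))) *v u"
      using 3 by (simp add: mv_simps 1 cdot_so[OF t])
    show "t *v v = (u \<bowtie> (- (t *v u')) + v \<bowtie> (- (t *v v'))) *v v"
      using 3 by (simp add: mv_simps 2 cdot_so[OF t])
    show "t *v u' = (u \<bowtie> (- (t *v u')) + v \<bowtie> (- (t *v v'))) *v u'"
      using U_dots[OF 3(1)] U_dots[OF 3(2)] by (simp add: mv_simps)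
    show "t *v v' = (u \<bowtie> (- (t *v u')) + v \<bowtie> (- (t *v v'))) *v v'"
      using U_dots[OF 3(1)] U_dots[OF 3(2)] by (simp add: mv_simps)
    show "t *v a = (u \<bowtie> (- (t *v u')) + v \<bowtie> (- (t *v v'))) *v a" if "a \<in> U" for a
      using that by (subst 4) (simp_all add: mv_simps cdot_so[OF t])
  qed
  then show ?thesis using 3 unfolding W_def by blast
qed

text \<open>For w = u or v, the equation t w \<and> a + w \<and> t a = 0 at a = \<open>e i\<close>
  puts t w on the line of \<open>e i\<close>; two different indices give t w = 0. Then t a lies on
  the lines of both u and v.\<close>

lemma centralizer_W_z:
  assumes t: "t \<in> so" and tu: "\<And>a. a \<in> U \<Longrightarrow> lie t (u \<bowtie> a) = 0" and tv: "\<And>a. a \<in> U \<Longrightarrow> lie t (v \<bowtie> a) = 0"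
  shows "\<exists>c. t = mscale c (u \<bowtie> v)"
proof -
  have 01: "0 < n" "1 < n" using n_ge by auto
  have *: "(a \<star> c) *s (t *v w) - ((t *v w) \<star> c) *s a + ((t *v a) \<star> c) *s w - (w \<star> c) *s (t *v a) = 0"
    if "lie t (w \<bowtie> a) = 0" for w a c
  proof -
    have "lie t (w \<bowtie> a) *v c = 0" by (simp add: that)
    then show ?thesis unfolding lie_skew[OF t] by (simp only: mv_simps skew_mult_vec) (simp add: vec_eq_iff algebra_simps)
  qed
  have kill: "t *v w = 0" if "\<And>a. a \<in> U \<Longrightarrow> lie t (w \<bowtie> a) = 0" "\<And>a. a \<in> U \<Longrightarrow> w \<star> a = 0" for w
  proof -
    have "t *v w = ((t *v w) \<star> e i) *s e i" if "i < n" for i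
      using *[OF \<open>\<And>a. a \<in> U \<Longrightarrow> lie t (w \<bowtie> a) = 0\<close>, of "e i" "e i"] that \<open>\<And>a. a \<in> U \<Longrightarrow> w \<star> a = 0\<close>[of "e i"]
        cdot_so_self[OF t, of "e i"] by (simp add: cdot_commute)
    then have 2: "t *v w = ((t *v w) \<star> e 0) *s e 0" "t *v w = ((t *v w) \<star> e 1) *s e 1"
      using 01 by blast+
    have "(t *v w) \<star> e 1 = 0" using 01 by (subst 2(1)) simp
    then show ?thesis using 2(2) by simp
  qed
  have 1: "t *v u = 0" "t *v v = 0" by (rule kill; simp add: tu tv)+
  have "t *v a = 0" if "a \<in> U" for a
  proof -
    have "t *v a = ((t *v a) \<star> u') *s u"
      using *[OF tu[OF that], of u'] that 1 by simp
    moreover have "t *v a = ((t *v a) \<star> v') *s v"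
      using *[OF tv[OF that], of v'] that 1 by simp
    ultimately have "(t *v a) \<star> u' = 0"
      by (metis cdot_simps(7) frame_dots'(9) mult_zero_right)
    then show ?thesis using \<open>t *v a = ((t *v a) \<star> u') *s u\<close> by simp
  qed
  then show ?thesis using so_eq_scale_z[OF t] 1 by blast
qed

text \<open>On the centraliser of \<open>u \<and> v\<close> the weights of \<open>h\<close> are \<open>0\<close>, \<open>1\<close> and \<open>2\<close>.\<close>

lemma centralizer_z_weights:
  assumes t: "t \<in> so" and z: "lie t (u \<bowtie> v) = 0"
  shows "lie h (lie h (lie h t)) - mscale 3 (lie h (lie h t)) + mscale 2 (lie h t) = 0" (is "?p = 0")
proof -
  have *: "(v \<star> c) *s (t *v u) - ((t *v u) \<star> c) *s v + ((t *v v) \<star> c) *s u - (u \<star> c) *s (t *v v) = 0" for c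
  proof -
    have "lie t (u \<bowtie> v) *v c = 0" by (simp add: z)
    then show ?thesis unfolding lie_skew[OF t] by (simp only: mv_simps skew_mult_vec) (simp add: vec_eq_iff algebra_simps)
  qed
  have eq: "t *v u = ((t *v u) \<star> v') *s v - ((t *v v) \<star> v') *s u"
     "t *v v = ((t *v v) \<star> u') *s u - ((t *v u) \<star> u') *s v"
    using *[of v'] *[of u'] by (simp_all add: algebra_simps)
  have "h *v (c *s v - d *s u) = c *s v - d *s u" "h *v (c *s u - d *s v) = c *s u - d *s v" for c d
    by (simp_all add: mv_simps)
  then have F: "h *v (t *v u) = t *v u" "h *v (t *v v) = t *v v"
    using eq by metis+
  \<comment> \<open>\<open>lie h\<close> is left minus right multiplication by \<open>h\<close>, and
    these commute, so its powers expand binomially.\<close>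
  have expand: "?p *v y = h *v (h *v (h *v (t *v y))) - 3 *s (h *v (h *v (t *v (h *v y))))
     + 3 *s (h *v (t *v (h *v (h *v y)))) - t *v (h *v (h *v (h *v y)))
     - 3 *s (h *v (h *v (t *v y)) - 2 *s (h *v (t *v (h *v y))) + t *v (h *v (h *v y)))
     + 2 *s (h *v (t *v y) - t *v (h *v y))" for y
    by (simp only: mv_simps lie_mult_vec mscale_mult_vec) (simp add: vec_eq_iff algebra_simps)
  have U: "h *v (h *v (t *v a)) = h *v (t *v a)" if "a \<in> U" for a
  proof -
    have "a \<star> (t *v u) = 0" "a \<star> (t *v v) = 0"
      by (subst eq, use that in simp)+
    then have "u \<star> (t *v a) = 0" "v \<star> (t *v a) = 0"
      using cdot_so_swap[OF t, of u a] cdot_so_swap[OF t, of v a] by simp_all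
    then show ?thesis by (simp add: h_mult_vec)
  qed
  show ?thesis
    by (rule matrix_eq_frame; simp only: expand; simp add: F U h_cube mv_simps) (simp_all add: vec_eq_iff h_cube)
qed

end

section \<open>Contact gradings\<close>

locale contact =
  fixes n :: nat and P G0 Pp :: "('m::finite cmat \<Rightarrow> 'm cmat) set" and gr :: "int \<Rightarrow> 'm cmat set"
  assumes n_ge_4: "n \<ge> 4" and card_m: "CARD('m) = n + 4"
    and contact: "contact_grading n P G0 Pp gr"
begin

lemma gr_subspace: "cmat.subspace (gr i)" and gr_so: "x \<in> gr i \<Longrightarrow> x \<in> so"
  and gr_outside: "\<bar>i\<bar> > 2 \<Longrightarrow> gr i = {0}"
  and gr_lie: "x \<in> gr i \<Longrightarrow> y \<in> gr j \<Longrightarrow> lie x y \<in> gr (i + j)"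
  and gr_Pp: "lie_algebra Pp = {y + z |y z. y \<in> gr 1 \<and> z \<in> gr 2}"
  and gr_G0: "lie_algebra G0 = gr 0"
  and gr_dim: "cmat.dim (gr (-2)) = 1" "cmat.dim (gr (-1)) = 2 * n"
  and gr_nondeg: "x \<in> gr (-1) \<Longrightarrow> (\<And>y. y \<in> gr (-1) \<Longrightarrow> lie x y = 0) \<Longrightarrow> x = 0"
  and gr_ex1: "x \<in> so \<Longrightarrow> \<exists>!f. (\<forall>i. f i \<in> gr i) \<and> x = (\<Sum>i = -2..2. f i)"
  using contact unfolding contact_grading_def by auto

lemmas gr_closed = cmat.subspace_add[OF gr_subspace] cmat.subspace_diff[OF gr_subspace]
  cmat.subspace_scale[OF gr_subspace] cmat.subspace_neg[OF gr_subspace] cmat.subspace_0[OF gr_subspace]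

lemma sum_grades: "(\<Sum>i = -2..2. f i) = f (-2) + f (-1) + f 0 + f 1 + f (2::int)"
  for f :: "int \<Rightarrow> 'a::ab_group_add"
proof -
  have "{-2..2::int} = {-2, -1, 0, 1, 2}" by auto
  then show ?thesis by simp
qed

lemma gr_decompose:
  assumes "x \<in> so"
  obtains f where "\<And>i. f i \<in> gr i" "x = f (-2) + f (-1) + f 0 + f 1 + f 2"
  using gr_ex1[OF assms] unfolding sum_grades by auto

lemma gr_unique:
  assumes "\<And>i. f i \<in> gr i" "\<And>i. g i \<in> gr i"
    "f (-2) + f (-1) + f 0 + f 1 + f 2 = g (-2) + g (-1) + g 0 + g 1 + g 2"
  shows "f i = g i"
proof -
  let ?x = "f (-2) + f (-1) + f 0 + f 1 + f 2"
  have "?x \<in> so"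
    using assms(1) gr_so by (intro cmat.subspace_add[OF subspace_so]) auto
  from gr_ex1[OF this] show ?thesis
    using assms unfolding sum_grades by metis
qed

lemma gr_disjoint:
  assumes "x \<in> gr i" "x \<in> gr j" "i \<noteq> j"
  shows "x = 0"
proof (cases "\<bar>i\<bar> > 2 \<or> \<bar>j\<bar> > 2")
  case True
  then show ?thesis using assms gr_outside by auto
next
  case False
  then have bounds: "- 2 \<le> i" "i \<le> 2" "- 2 \<le> j" "j \<le> 2" by linarith+
  define f g where "f k = (if k = i then x else 0)" and "g k = (if k = j then x else 0)" for k
  have "(\<Sum>k = -2..2. f k) = x" "(\<Sum>k = -2..2. g k) = x"
    unfolding f_def g_def using bounds by simp_all
  then have sums: "f (-2) + f (-1) + f 0 + f 1 + f 2 = x" "g (-2) + g (-1) + g 0 + g 1 + g 2 = x"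
    unfolding sum_grades .
  have mem: "f k \<in> gr k" "g k \<in> gr k" for k
    using assms gr_closed(5) by (simp_all add: f_def g_def)
  have "f i = g i" by (rule gr_unique[OF mem]) (simp only: sums)
  then show ?thesis using assms(3) by (simp add: f_def g_def)
qed

lemma dim_1_scale:
  assumes "cmat.dim V = 1" "cmat.subspace V" "x \<in> V" "x \<noteq> 0" "y \<in> V"
  obtains c where "y = mscale c x"
proof -
  obtain B where B: "B \<subseteq> V" "V \<subseteq> cmat.span B" "card B = 1"
    using cmat.basis_exists[of V] assms(1) by metis
  then obtain b where b: "B = {b}" by (metis card_1_singletonE)
  obtain s t where "x = mscale s b" "y = mscale t b"
    using B(2) assms(3,5) unfolding b cmat.span_singleton by blast
  moreover from this have "s \<noteq> 0" using assms(4) by auto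
  ultimately have "y = mscale (t / s) x" by simp
  then show ?thesis by (rule that)
qed

text \<open>(ad z)^2 lowers degrees by 4, so only the component of degree 2 survives, and it lands
  on the line \<open>gr (-2)\<close>.\<close>

lemma gr_m2_extremal:
  assumes "z \<in> gr (-2)" "z \<noteq> 0"
  shows "extremal z"
  unfolding extremal_def
proof (intro conjI ballI)
  show "z \<in> so" using gr_so assms(1) .
  fix x :: "'m cmat" assume "x \<in> so"
  then obtain f where f: "\<And>i. f i \<in> gr i" "x = f (-2) + f (-1) + f 0 + f 1 + f 2"
    using gr_decompose by blast
  have mem: "lie z (lie z (f i)) \<in> gr (i - 4)" for i
    using gr_lie[OF assms(1) gr_lie[OF assms(1) f(1)[of i]]] by (simp add: algebra_simps)
  have "lie z (lie z (f i)) = 0" if "i < 2" for i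
    using mem[of i] gr_outside[of "i - 4"] that by auto
  then have "lie z (lie z x) = lie z (lie z (f 2))"
    unfolding f(2) lie_simps by simp
  moreover obtain c where "lie z (lie z (f 2)) = mscale c z"
    using dim_1_scale[OF gr_dim(1) gr_subspace assms(1,2), of "lie z (lie z (f 2))"] mem[of 2] by auto
  ultimately show "\<exists>c. lie z (lie z x) = mscale c z" by auto
qed

text \<open>Supplies the opposite element of an sl2-triple through \<open>z\<close>, by the same
  degree count.\<close>

lemma gr_2_opposite:
  assumes "z \<in> gr (-2)" "x \<in> so" "lie z (lie z x) \<noteq> 0"
  obtains e where "e \<in> gr 2" "lie z (lie z e) = lie z (lie z x)"
proof -
  obtain f where f: "\<And>i. f i \<in> gr i" "x = f (-2) + f (-1) + f 0 + f 1 + f 2"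
    using gr_decompose assms(2) by blast
  have mem: "lie z (lie z (f i)) \<in> gr (i - 4)" for i
    using gr_lie[OF assms(1) gr_lie[OF assms(1) f(1)[of i]]] by (simp add: algebra_simps)
  have "lie z (lie z (f i)) = 0" if "i < 2" for i
    using mem[of i] gr_outside[of "i - 4"] that by auto
  then have "lie z (lie z x) = lie z (lie z (f 2))"
    unfolding f(2) lie_simps by simp
  then show ?thesis using that f(1) by metis
qed

text \<open>The vectors dual to \<open>p, q\<close> read off from an opposite element \<open>e\<close> need not be isotropic. Making them isotropic
  adds to \<open>u \<and> u' + v \<and> v'\<close> a symmetric combination of \<open>p \<and> p\<close>, \<open>p \<and> q\<close>, \<open>q \<and> p\<close>, \<open>q \<and> q\<close>, that is, \<open>0\<close>.\<close>

lemma exists_hyperbolic: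
  obtains u v u' v' where "hyperbolic n u v u' v'" "u \<bowtie> v \<in> gr (-2)" "u \<bowtie> u' + v \<bowtie> v' \<in> gr 0"
proof -
  have "cmat.dim ({0} :: 'm cmat set) \<le> card ({} :: 'm cmat set)"
    by (rule cmat.dim_le_card) (simp_all add: cmat.span_zero)
  then have "gr (-2) \<noteq> {0}" using gr_dim(1) by (metis card.empty not_one_le_zero)
  then obtain z where z: "z \<in> gr (-2)" "z \<noteq> 0" using gr_closed(5) by blast
  have ext: "extremal z" using gr_m2_extremal[OF z] .
  have card6: "CARD('m) > 6" using card_m n_ge_4 by simp
  obtain p q where pq: "z = p \<bowtie> q" using extremal_decomposable[OF ext card6] .
  have sq: "(p \<bowtie> q) *v ((p \<bowtie> q) *v a) = 0" for a
    using extremal_square_zero[OF ext card6] unfolding pq .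
  have ne: "p \<bowtie> q \<noteq> 0" using z(2) pq by simp
  note iso = skew_square_zero_isotropic[OF ne sq]
  obtain x y where xy: "p \<star> x = 1" "q \<star> x = 0" "p \<star> y = 0" "q \<star> y = 1"
    using skew_nonzero_dual[OF ne] .
  have "lie z (lie z (y \<bowtie> x)) = mscale (-2) z"
    unfolding pq by (subst double_ad_skew[OF sq]) (simp_all add: xy cdot_commute[of x p] cdot_commute[of y p])
  moreover have "mscale (-2) z \<noteq> 0" using z(2) by simp
  ultimately obtain e0 where e0: "e0 \<in> gr 2" "lie z (lie z e0) = mscale (-2) z"
    using gr_2_opposite[OF z(1), of "y \<bowtie> x"] by auto
  \<comment> \<open>The sign makes \<open>q \<star> (e *v p)\<close> equal to -1, so that e q and -e
    p are dual to p and q.\<close>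
  define e where "e = mscale (-1) e0"
  have e: "e \<in> gr 2" unfolding e_def using gr_closed(3)[OF e0(1)] .
  have eso: "e \<in> so" using gr_so e by blast
  have "mscale (-2 * (q \<star> (e0 *v p))) (p \<bowtie> q) = mscale (-2) (p \<bowtie> q)"
    using double_ad_skew[OF sq gr_so[OF e0(1)]] e0(2) pq by simp
  then have "q \<star> (e0 *v p) = 1" using ne by (simp del: mult_minus_left)
  then have qep: "q \<star> (e *v p) = -1" by (simp add: e_def)
  have peq: "p \<star> (e *v q) = 1" using cdot_so_self[OF eso] cdot_so[OF eso, of p q] qep by (simp add: cdot_commute)
  have pep: "p \<star> (e *v p) = 0" "q \<star> (e *v q) = 0" using cdot_so_self[OF eso] by simp_all
  define x' y' where "x' = e *v q" and "y' = - (e *v p)"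
  define u' where "u' = x' - ((x' \<star> x') / 2) *s p - ((x' \<star> y') / 2) *s q"
  define v' where "v' = y' - ((x' \<star> y') / 2) *s p - ((y' \<star> y') / 2) *s q"
  have d: "p \<star> x' = 1" "q \<star> x' = 0" "p \<star> y' = 0" "q \<star> y' = 1" 
     "x' \<star> p = 1" "x' \<star> q = 0" "y' \<star> p = 0" "y' \<star> q = 1"
    by (simp_all add: x'_def y'_def qep peq pep cdot_commute[of "e *v _"])
  have hyp: "hyperbolic n p q u' v'"
  proof
    show "u' \<star> u' = 0" "u' \<star> v' = 0" "v' \<star> v' = 0" "p \<star> u' = 1" "p \<star> v' = 0" "q \<star> u' = 0" "q \<star> v' = 1"
      using iso by (simp_all add: u'_def v'_def d cdot_commute[of q p] cdot_commute[of y' x'])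
  qed (use iso card_m n_ge_4 in simp_all)
  \<comment> \<open>Being a bracket of degrees 2 and -2, this element lies in
    \<open>gr 0\<close>.\<close>
  have "p \<bowtie> u' + q \<bowtie> v' = lie e z"
    unfolding pq lie_skew[OF eso] u'_def v'_def
    by (simp add: skew_simps skew_swap[of q p] x'_def y'_def skew_swap[of q "e *v p"])
  moreover have "lie e z \<in> gr 0" using gr_lie[OF e z(1)] by simp
  ultimately show ?thesis using that[OF hyp] z(1) pq by simp
qed

end

section \<open>Automorphisms of so\<close>

lemma Aut_so_D:
  assumes "\<phi> \<in> Aut_so"
  shows "x \<in> so \<Longrightarrow> \<phi> x \<in> so" "x \<in> so \<Longrightarrow> y \<in> so \<Longrightarrow> \<phi> (x + y) = \<phi> x + \<phi> y"
    "x \<in> so \<Longrightarrow> \<phi> (mscale c x) = mscale c (\<phi> x)"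
    "x \<in> so \<Longrightarrow> y \<in> so \<Longrightarrow> \<phi> (lie x y) = lie (\<phi> x) (\<phi> y)"
    "x \<in> so \<Longrightarrow> y \<in> so \<Longrightarrow> \<phi> x = \<phi> y \<Longrightarrow> x = y"
    "y \<in> so \<Longrightarrow> \<exists>x\<in>so. \<phi> x = y"
  using assms unfolding Aut_so_def Bij_def bij_betw_def linear_on_def inj_on_def
  by (auto, metis (no_types, lifting) imageE)

lemma Aut_so_0:
  assumes "\<phi> \<in> Aut_so"
  shows "\<phi> 0 = 0"
  using Aut_so_D(2)[OF assms, of 0 0] subspace_so cmat.subspace_0 by fastforce

lemma Aut_so_minus:
  assumes "\<phi> \<in> Aut_so" "x \<in> so"
  shows "\<phi> (- x) = - \<phi> x"
  using Aut_so_D(3)[OF assms, of "-1"] by simp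

section \<open>The grading as the weights of h\<close>

locale contact_frame = contact n P G0 Pp gr + frame n u v u' v' e
  for n and P G0 Pp :: "('m::finite cmat \<Rightarrow> 'm cmat) set" and gr :: "int \<Rightarrow> 'm cmat set"
    and u v u' v' :: "complex^'m" and e :: "nat \<Rightarrow> complex^'m" +
  assumes uv: "u \<bowtie> v \<in> gr (-2)" and h_gr0: "h \<in> gr 0"
begin

lemma uv_nonzero: "u \<bowtie> v \<noteq> 0"
proof
  assume "u \<bowtie> v = 0"
  then have "(u \<bowtie> v) *v v' = 0" by simp
  then have "u = 0" by simp
  then show False using frame_dots'(7) by simp
qed

lemma gr_m2: "gr (-2) = {mscale c (u \<bowtie> v) |c. True}"
  using dim_1_scale[OF gr_dim(1) gr_subspace uv uv_nonzero] gr_closed(3)[OF uv] by blast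

lemma lie_h_uv: "lie h (u \<bowtie> v) = mscale 2 (u \<bowtie> v)"
  by (simp add: lie_skew) (simp add: mscale_def vec_eq_iff)

lemma lie_h_W: "x \<in> W \<Longrightarrow> lie h x = x"
  by (auto simp: W_def lie_skew lie_simps skew_simps)

text \<open>Elements of \<open>gr (-1)\<close> commute with u \<and> v, so T = ad h satisfies T (T -
  1) (T - 2) = 0 there. The weight 2 part lies in \<open>gr (-2)\<close>, hence is zero. For w of
  weight 0 and y in \<open>gr (-1)\<close>, the bracket [w, y] has weight 2, while y contributes
  only weights 0 and 1; so [w, y] = 0, and non-degeneracy gives w = 0.\<close>

lemma gr_m1_subset: "gr (-1) \<subseteq> W"
proof -
  let ?T = "lie h"
  have T: "?T x \<in> gr (-1)" if "x \<in> gr (-1)" for x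
    using gr_lie[OF h_gr0 that] by simp
  have T2: "?T (?T x) = ?T x" if x: "x \<in> gr (-1)" for x
  proof -
    have "lie x (u \<bowtie> v) = 0" using gr_lie[OF x uv] gr_outside[of "-3"] by simp
    then have eq: "?T (?T (?T x)) - mscale 3 (?T (?T x)) + mscale 2 (?T x) = 0"
      by (rule centralizer_z_weights[OF gr_so[OF x]])
    let ?y = "?T (?T x) - ?T x"
    have y: "?y \<in> gr (-1)" using T x gr_closed(2) by blast
    have "?T ?y = mscale 2 ?y"
      using eq by (simp add: lie_simps) (simp add: mscale_def vec_eq_iff algebra_simps)
    then obtain c where "?y = mscale c (u \<bowtie> v)" using weight_2[OF gr_so[OF y]] by blast
    then have "?y \<in> gr (-2)" using gr_closed(3)[OF uv] by simp
    then have "?y = 0" using gr_disjoint[OF y] by simp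
    then show ?thesis by simp
  qed
  have "?T x = x" if x: "x \<in> gr (-1)" for x
  proof -
    let ?w = "x - ?T x"
    have w: "?w \<in> gr (-1)" using T x gr_closed(2) by blast
    have Tw: "?T ?w = 0" by (simp add: lie_simps T2[OF x])
    have 1: "lie ?w (?T y) = mscale 2 (lie ?w y)" if y: "y \<in> gr (-1)" for y
    proof -
      have "lie ?w y \<in> gr (-2)" using gr_lie[OF w y] by simp
      then obtain c where "lie ?w y = mscale c (u \<bowtie> v)" using gr_m2 by blast
      then have "?T (lie ?w y) = mscale 2 (lie ?w y)" by (simp add: lie_simps lie_h_uv mult.commute)
      then show ?thesis using lie_jacobi[of h ?w y] Tw by (simp add: lie_simps(9))
    qed
    have "lie ?w y = 0" if y: "y \<in> gr (-1)" for y
    proof -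
      have "lie ?w (?T y) = mscale 2 (lie ?w (?T y))"
        using 1[OF T[OF y]] T2[OF y] by simp
      then have "lie ?w (?T y) = 0"
        by (simp add: mscale_def vec_eq_iff)
      then show ?thesis using 1[OF y] by simp
    qed
    then have "?w = 0" by (rule gr_nondeg[OF w])
    then show ?thesis by simp
  qed
  then show ?thesis using weight_1 gr_so by blast
qed

lemma W_span: "W \<subseteq> cmat.span ((\<lambda>i. u \<bowtie> e i) ` {..<n} \<union> (\<lambda>i. v \<bowtie> e i) ` {..<n})" (is "_ \<subseteq> ?S")
proof
  fix x assume "x \<in> W"
  then obtain a b where ab: "a \<in> U" "b \<in> U" and x: "x = u \<bowtie> a + v \<bowtie> b" unfolding W_def by blast
  have sum: "w \<bowtie> (\<Sum>i\<in>I. f i *s e i) = (\<Sum>i\<in>I. mscale (f i) (w \<bowtie> e i))" for w f and I :: "nat set"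
    by (induction I rule: infinite_finite_induct) (simp_all add: skew_simps)
  have "u \<bowtie> a = (\<Sum>i<n. mscale (e i \<star> a) (u \<bowtie> e i))"
    by (subst U_expand[OF ab(1)]) (rule sum)
  moreover have "v \<bowtie> b = (\<Sum>i<n. mscale (e i \<star> b) (v \<bowtie> e i))"
    by (subst U_expand[OF ab(2)]) (rule sum)
  ultimately show "x \<in> ?S"
    unfolding x by (auto intro!: cmat.span_add cmat.span_sum cmat.span_scale intro: cmat.span_base)
qed

text \<open>A comparison of dimensions: \<open>W\<close> is spanned by 2 n elements and contains
  \<open>gr (-1)\<close>, of dimension 2 n.\<close>

lemma gr_m1: "gr (-1) = W"
proof
  let ?B = "(\<lambda>i. u \<bowtie> e i) ` {..<n} \<union> (\<lambda>i. v \<bowtie> e i) ` {..<n}"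
  have cardB: "card ?B \<le> 2 * n"
    using card_Un_le[of "(\<lambda>i. u \<bowtie> e i) ` {..<n}" "(\<lambda>i. v \<bowtie> e i) ` {..<n}"]
      card_image_le[of "{..<n}" "\<lambda>i. u \<bowtie> e i"] card_image_le[of "{..<n}" "\<lambda>i. v \<bowtie> e i"] by simp
  obtain C where C: "C \<subseteq> gr (-1)" "cmat.independent C" "gr (-1) \<subseteq> cmat.span C" "card C = 2 * n"
    using cmat.basis_exists[of "gr (-1)"] gr_dim(2) by metis
  have "W \<subseteq> cmat.span C"
  proof
    fix x assume x: "x \<in> W"
    show "x \<in> cmat.span C"
    proof (rule ccontr)
      assume nx: "x \<notin> cmat.span C"
      then have ind: "cmat.independent (insert x C)"
        using C(2) cmat.independent_insertI by blast
      have "insert x C \<subseteq> cmat.span ?B" using C(1) gr_m1_subset W_span x by blast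
      from cmat.independent_span_bound[OF _ ind this] have "card (insert x C) \<le> 2 * n" "finite (insert x C)"
        using cardB by auto
      moreover have "x \<notin> C" using nx cmat.span_base by blast
      ultimately show False using C(4) by simp
    qed
  qed
  also have "\<dots> \<subseteq> gr (-1)" by (rule cmat.span_minimal[OF C(1) gr_subspace])
  finally show "W \<subseteq> gr (-1)" .
qed (rule gr_m1_subset)

lemma centralizer_negative:
  assumes "i \<ge> 0" "t \<in> gr i" "\<And>y. y \<in> gr (-1) \<Longrightarrow> lie t y = 0"
  shows "t = 0"
proof -
  have "u \<bowtie> a \<in> gr (-1)" "v \<bowtie> a \<in> gr (-1)" if "a \<in> U" for a
    unfolding gr_m1 W_def using that U_closed(3) skew_simps(10) by (metis (mono_tags, lifting) add.right_neutral mem_Collect_eq, metis (mono_tags, lifting) add.left_neutral mem_Collect_eq)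
  then obtain c where "t = mscale c (u \<bowtie> v)"
    using centralizer_W_z[OF gr_so[OF assms(2)]] assms(3) by blast
  then have "t \<in> gr (-2)" using gr_m2 by blast
  then show ?thesis using gr_disjoint[OF assms(2)] assms(1) by simp
qed

text \<open>The inductive step of \<open>gr_weight\<close>. By Jacobi and the weights on
  \<open>gr (i - 1)\<close> and \<open>gr (-1)\<close>, the element [h, x] + i x commutes with
  \<open>gr (-1)\<close>, hence is zero. The sign is such that h has weight 2 on
  \<open>gr (-2)\<close>.\<close>

lemma gr_weight_nonneg:
  assumes "i \<ge> 0" and below: "\<And>y. y \<in> gr (i - 1) \<Longrightarrow> lie h y = mscale (of_int (1 - i)) y" and x: "x \<in> gr i"
  shows "lie h x = mscale (of_int (- i)) x"
proof -
  let ?t = "lie h x + mscale (of_int i) x"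
  have "?t \<in> gr i"
    using gr_lie[OF h_gr0 x] gr_closed(1) gr_closed(3)[OF x] by simp
  moreover have "lie ?t y = 0" if "y \<in> gr (-1)" for y
  proof -
    have xy: "lie h (lie x y) = mscale (of_int (1 - i)) (lie x y)"
      using below gr_lie[OF x that] by simp
    have "lie h y = y" using lie_h_W that gr_m1 by blast
    have "lie (lie h x) y = lie h (lie x y) - lie x (lie h y)"
      by (subst lie_jacobi) simp
    then have "lie (lie h x) y = mscale (of_int (1 - i)) (lie x y) - lie x y"
      unfolding xy \<open>lie h y = y\<close> .
    then show ?thesis
      by (simp add: lie_simps) (simp add: mscale_def vec_eq_iff algebra_simps)
  qed
  ultimately have "?t = 0" using centralizer_negative assms(1) by blast
  then show ?thesis by (simp add: eq_neg_iff_add_eq_0)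
qed

lemma gr_weight:
  assumes "x \<in> gr i"
  shows "lie h x = mscale (of_int (- i)) x"
proof -
  have m1: "lie h y = mscale (of_int (1 - 0)) y" if "y \<in> gr (0 - 1)" for y
    using lie_h_W that gr_m1 by simp
  note 0 = gr_weight_nonneg[of 0, OF _ m1, simplified]
  note 1 = gr_weight_nonneg[of 1, simplified, OF 0, simplified]
  note 2 = gr_weight_nonneg[of 2, simplified, OF 1, simplified]
  consider "\<bar>i\<bar> > 2" | "i = -2" | "i = -1" | "i = 0" | "i = 1" | "i = 2" by linarith
  then show ?thesis
  proof cases
    case 1
    then show ?thesis using assms gr_outside[of i] by (simp add: lie_simps)
  next
    case 2
    then show ?thesis using assms gr_m2 lie_h_uv by (auto simp: lie_simps mult.commute)
  next
    case 3
    then show ?thesis using assms lie_h_W gr_m1 by simp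
  qed (use assms 0 1 2 in simp_all)
qed

lemma weight_gr:
  assumes x: "x \<in> so" and w: "lie h x = mscale (of_int (- k)) x"
  shows "x \<in> gr k"
proof -
  obtain f where f: "\<And>i. f i \<in> gr i" "x = f (-2) + f (-1) + f 0 + f 1 + f 2"
    using gr_decompose[OF x] by blast
  have eq: "mscale (of_int (- i)) (f i) = mscale (of_int (- k)) (f i)" for i
  proof (rule gr_unique[of "\<lambda>i. mscale (of_int (- i)) (f i)" "\<lambda>i. mscale (of_int (- k)) (f i)"])
    show "mscale (of_int (- (-2))) (f (-2)) + mscale (of_int (- (-1))) (f (-1)) + mscale (of_int (- 0)) (f 0)
         + mscale (of_int (- 1)) (f 1) + mscale (of_int (- 2)) (f 2) =
       mscale (of_int (- k)) (f (-2)) + mscale (of_int (- k)) (f (-1)) + mscale (of_int (- k)) (f 0)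
         + mscale (of_int (- k)) (f 1) + mscale (of_int (- k)) (f 2)"
      using w unfolding f(2) lie_simps gr_weight[OF f(1)] cmat.scale_right_distrib .
  qed (rule gr_closed(3)[OF f(1)])+
  have fz: "f i = 0" if "i \<noteq> k" for i
    using eq[of i] that by simp
  consider "\<bar>k\<bar> > 2" | "k = -2" | "k = -1" | "k = 0" | "k = 1" | "k = 2" by linarith
  then have "x = f k"
  proof cases
    case 1
    then have "f i = 0" for i using fz[of i] f(1)[of i] gr_outside[of k] by (cases "i = k") auto
    then show ?thesis using f(2) by simp
  qed (simp_all add: f(2) fz)
  then show ?thesis using f(1) by simp
qed

text \<open>The difference \<open>\<phi> h - h\<close> has degree 0 and acts trivially on the positive part, which forces it to vanish.\<close>

lemma automorphism_preserves_grading: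
  assumes \<phi>: "\<phi> \<in> Aut_so" and 0: "\<And>x. x \<in> gr 0 \<Longrightarrow> \<phi> x \<in> gr 0"
    and pos: "\<And>y z. y \<in> gr 1 \<Longrightarrow> z \<in> gr 2 \<Longrightarrow> \<exists>y'\<in>gr 1. \<exists>z'\<in>gr 2. \<phi> (y + z) = y' + z'"
    and surj: "\<And>y. y \<in> gr 1 \<Longrightarrow> \<exists>y'\<in>gr 1. \<exists>z'\<in>gr 2. \<phi> (y' + z') = y"
    and x: "x \<in> gr k"
  shows "\<phi> x \<in> gr k"
proof -
  note hom = Aut_so_D[OF \<phi>]
  \<comment> \<open>Exchanging u, v with u', v' replaces h by -h, so that \<open>weight_2\<close>
    and \<open>centralizer_W_z\<close> apply to the positive part of the grading.\<close>
  interpret op: hyperbolic n u' v' u v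
    by unfold_locales (simp_all add: card_eq n_ge)
  interpret opp: frame n u' v' u v e
  proof
    show "i < n \<Longrightarrow> e i \<in> op.U" for i
      unfolding op.U_def by simp
  qed simp
  have oU: "op.U = U" by (auto simp: op.U_def U_def simp del: U_dots op.U_dots)
  have oh: "opp.h = - h" by (simp add: opp.h_def h_def skew_swap[of u'] skew_swap[of v'])
  have sub: "v' \<bowtie> a \<in> gr 1" "u' \<bowtie> a \<in> gr 1" if "a \<in> U" for a
    using that by (auto intro!: weight_gr simp: lie_skew skew_simps)
  define e' where "e' = u' \<bowtie> v'"
  have e': "e' \<in> gr 2"
    unfolding e'_def by (rule weight_gr) (simp_all add: lie_skew skew_simps, simp add: mscale_def vec_eq_iff)
  have gr2: "\<exists>c. y = mscale c e'" if "y \<in> gr 2" for y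
    unfolding e'_def
  proof (rule opp.weight_2)
    show "y \<in> so" using gr_so that .
    show "lie opp.h y = mscale 2 y" using gr_weight[OF that] by (simp add: oh lie_simps)
  qed
  \<comment> \<open>\<open>e'\<close> is a bracket of two elements of degree 1, whose images lie in
    degrees 1 and 2; only the bracket of their degree 1 parts survives.\<close>
  have phi_e': "\<phi> e' \<in> gr 2"
  proof -
    have "e 0 \<in> U" "e 0 \<star> e 0 = 1" using n_ge by simp_all
    have "lie (u' \<bowtie> e 0) (v' \<bowtie> e 0) = - e'"
      unfolding e'_def
      using \<open>e 0 \<in> U\<close> \<open>e 0 \<star> e 0 = 1\<close> by (simp add: lie_skew skew_simps skew_swap[of v' u'])
    then have "e' = lie (v' \<bowtie> e 0) (u' \<bowtie> e 0)" using lie_swap by (metis minus_minus)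
    moreover obtain y1 z1 where 1: "y1 \<in> gr 1" "z1 \<in> gr 2" "\<phi> (v' \<bowtie> e 0) = y1 + z1"
      using pos[OF sub(1)[OF \<open>e 0 \<in> U\<close>] gr_closed(5)] by auto
    moreover obtain y2 z2 where 2: "y2 \<in> gr 1" "z2 \<in> gr 2" "\<phi> (u' \<bowtie> e 0) = y2 + z2"
      using pos[OF sub(2)[OF \<open>e 0 \<in> U\<close>] gr_closed(5)] by auto
    ultimately have "\<phi> e' = lie (y1 + z1) (y2 + z2)" by (simp add: hom)
    moreover have "lie y1 z2 = 0" "lie z1 y2 = 0" "lie z1 z2 = 0"
      using gr_lie[OF 1(1) 2(2)] gr_lie[OF 1(2) 2(1)] gr_lie[OF 1(2) 2(2)] gr_outside by auto
    moreover have "lie y1 y2 \<in> gr 2" using gr_lie[OF 1(1) 2(1)] by simp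
    ultimately show ?thesis by (simp add: lie_simps)
  qed
  have h: "h \<in> so" by simp
  let ?D = "\<phi> h - h"
  have D: "?D \<in> gr 0" using 0 h_gr0 gr_closed(2) by blast
  have e'so: "e' \<in> so" using gr_so e' by blast
  have e'0: "e' \<noteq> 0"
  proof
    assume "e' = 0"
    then have "e' *v v = 0" by simp
    then have "u' = 0" unfolding e'_def by simp
    then show False using frame_dots'(7) by simp
  qed
  have lhe: "lie h e' = mscale (-2) e'" using gr_weight[OF e'] by simp
  have De: "lie ?D e' = 0"
  proof -
    obtain c where c: "\<phi> e' = mscale c e'" using gr2[OF phi_e'] by blast
    have "c \<noteq> 0"
    proof
      assume "c = 0"
      then have "\<phi> e' = \<phi> 0" using c Aut_so_0[OF \<phi>] by simp
      then show False using hom(5)[OF e'so cmat.subspace_0[OF subspace_so]] e'0 by simp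
    qed
    have "lie (\<phi> h) (\<phi> e') = mscale (-2) (\<phi> e')"
      using hom(4)[OF h e'so] hom(3)[OF e'so, of "-2"] unfolding lhe by simp
    then have "mscale c (lie (\<phi> h) e') = mscale c (mscale (-2) e')"
      unfolding c lie_simps by (simp add: mult.commute)
    then have "lie (\<phi> h) e' = mscale (-2) e'" using \<open>c \<noteq> 0\<close> by (simp only: cmat.scale_cancel_left) simp
    then show ?thesis by (simp add: lie_simps lhe)
  qed
  \<comment> \<open>Applying \<phi> to [h, y' + z'] = -(y' + z') - z' gives [\<phi> h - h, y] =
    -\<phi> z'. The left side is in \<open>gr 1\<close> and the right side in
    \<open>gr 2\<close>.\<close>
  have D1: "lie ?D y = 0" if y: "y \<in> gr 1" for y
  proof -
    obtain y' z' where yz: "y' \<in> gr 1" "z' \<in> gr 2" "\<phi> (y' + z') = y" using surj[OF y] by blast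
    note so = gr_so[OF yz(1)] gr_so[OF yz(2)]
    obtain c where "z' = mscale c e'" using gr2[OF yz(2)] by blast
    then have z2: "\<phi> z' \<in> gr 2" using hom(3)[OF e'so] gr_closed(3)[OF phi_e'] by simp
    have "lie (\<phi> h) y = \<phi> (lie h (y' + z'))"
      using hom(4)[OF h] so cmat.subspace_add[OF subspace_so] yz(3) by metis
    also have "lie h (y' + z') = - (y' + z') + - z'"
      unfolding lie_simps gr_weight[OF yz(1)] gr_weight[OF yz(2)]
      by (simp add: mscale_def vec_eq_iff)
    also have "\<phi> \<dots> = \<phi> (- (y' + z')) + \<phi> (- z')"
      using so by (intro hom(2) cmat.subspace_add[OF subspace_so] cmat.subspace_neg[OF subspace_so])
    also have "\<dots> = - y - \<phi> z'"
      using so yz(3) Aut_so_minus[OF \<phi> so(2)]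
        Aut_so_minus[OF \<phi> cmat.subspace_add[OF subspace_so so]] by simp
    finally have eq: "lie ?D y = - \<phi> z'"
      using gr_weight[OF y] by (simp add: lie_simps)
    have "lie ?D y \<in> gr 1" using gr_lie[OF D y] by simp
    moreover have "lie ?D y \<in> gr 2" unfolding eq by (rule gr_closed(4)[OF z2])
    ultimately show ?thesis using gr_disjoint by (metis one_neq_neg_numeral num.distinct(1) numeral_One numeral_eq_iff)
  qed
  have "\<exists>c. ?D = mscale c (u' \<bowtie> v')"
  proof (rule opp.centralizer_W_z)
    show "?D \<in> so" using gr_so D .
  qed (use D1 sub oU in auto)
  then have "?D \<in> gr 2" using gr_closed(3)[OF e'] unfolding e'_def by auto
  then have "?D = 0" using gr_disjoint[OF D] by simp
  then have ph: "\<phi> h = h" by simp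
  show ?thesis
  proof (rule weight_gr)
    show "\<phi> x \<in> so" using hom(1) gr_so x by blast
    show "lie h (\<phi> x) = mscale (of_int (- k)) (\<phi> x)"
      using hom(4)[OF h gr_so[OF x]] hom(3)[OF gr_so[OF x]] unfolding gr_weight[OF x] ph by metis
  qed
qed

end

section \<open>Automorphisms and the identity component\<close>

lemma Bij_soD: "\<phi> \<in> Bij so \<Longrightarrow> x \<in> so \<Longrightarrow> \<phi> x \<in> so"
  by (auto simp: Bij_def bij_betw_def)

lemma scaleR_eq_mscale: "t *\<^sub>R x = mscale (of_real t) x"
  by (simp add: mscale_def vec_eq_iff scaleR_conv_of_real[where 'a = complex])

lemma linear_lie: "linear (lie x)"
  by (rule linearI) (simp_all add: lie_simps scaleR_eq_mscale)

lemma summable_exp_ad: "summable (\<lambda>k. (lie x ^^ k) y /\<^sub>R fact k)"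
proof -
  obtain K where K: "K > 0" "\<And>y. norm (lie x y) \<le> norm y * K"
    using bounded_linear.pos_bounded linear_lie linear_conv_bounded_linear by metis
  have "norm ((lie x ^^ k) y) \<le> norm y * K ^ k" for k
  proof (induction k)
    case (Suc k)
    then have "norm ((lie x ^^ k) y) * K \<le> norm y * K ^ k * K" using K(1) by simp
    then show ?case using K(2)[of "(lie x ^^ k) y"] by (simp add: algebra_simps)
  qed simp
  then have "norm ((lie x ^^ k) y /\<^sub>R fact k) \<le> norm y * (K ^ k /\<^sub>R fact k)" for k
    by (simp add: field_simps)
  then show ?thesis
    by (rule summable_comparison_test'[OF summable_mult[OF summable_exp_generic], of 0])
qed

lemma Aut_so_exp_ad:
  assumes \<psi>: "\<psi> \<in> Aut_so" and x: "x \<in> so" and y: "y \<in> so" and E: "exp_ad x y \<in> so"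
  shows "exp_ad (\<psi> x) (\<psi> y) = \<psi> (exp_ad x y)"
proof -
  note hom = Aut_so_D[OF \<psi>]
  have pow_so: "(lie x ^^ k) y \<in> so" for k
    by (induction k) (use x y in auto)
  have pow: "(lie (\<psi> x) ^^ k) (\<psi> y) = \<psi> ((lie x ^^ k) y)" for k
    by (induction k) (use x pow_so hom(4) in auto)
  \<comment> \<open>Exchanging \<psi> with the infinite sum takes a bounded linear map on all
    matrices. As \<psi> is controlled on \<open>so\<close> only, it is composed with the projection
    onto skew matrices.\<close>
  define g where "g M = \<psi> (mscale (1/2) (M - transpose M))" for M
  have asym: "mscale (1/2) (M - transpose M) \<in> so" for M :: "'a cmat"
    by (simp add: so_def mscale_def transpose_def vec_eq_iff diff_divide_distrib)
  have g: "g M = \<psi> M" if "M \<in> so" for M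
  proof -
    have "mscale (1/2) (M - transpose M) = M"
      using that by (simp add: so_def mscale_def vec_eq_iff)
    then show ?thesis by (simp add: g_def)
  qed
  have "linear g"
  proof (rule linearI)
    fix M N :: "'a cmat" and r :: real
    have "mscale (1/2) ((M + N) - transpose (M + N)) = mscale (1/2) (M - transpose M) + mscale (1/2) (N - transpose N)"
      by (simp add: mscale_def vec_eq_iff transpose_def algebra_simps)
    then show "g (M + N) = g M + g N" unfolding g_def by (simp only: hom(2)[OF asym asym])
    have "mscale (1/2) (r *\<^sub>R M - transpose (r *\<^sub>R M)) = mscale (of_real r) (mscale (1/2) (M - transpose M))"
      by (simp add: mscale_def vec_eq_iff transpose_def scaleR_conv_of_real[where 'a = complex] algebra_simps)
    then show "g (r *\<^sub>R M) = r *\<^sub>R g M" unfolding g_def scaleR_eq_mscale by (simp only: hom(3)[OF asym])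
  qed
  then have bl: "bounded_linear g" by (simp add: linear_conv_bounded_linear)
  have so': "(lie x ^^ k) y /\<^sub>R fact k \<in> so" for k
    unfolding scaleR_eq_mscale by (rule cmat.subspace_scale[OF subspace_so pow_so])
  have "exp_ad (\<psi> x) (\<psi> y) = (\<Sum>k. \<psi> ((lie x ^^ k) y) /\<^sub>R fact k)"
    using hom(1)[OF y] by (simp add: exp_ad_def pow)
  also have "\<dots> = (\<Sum>k. g ((lie x ^^ k) y /\<^sub>R fact k))"
    unfolding g[OF so'] unfolding scaleR_eq_mscale hom(3)[OF pow_so] ..
  also have "\<dots> = g (\<Sum>k. (lie x ^^ k) y /\<^sub>R fact k)"
    by (rule bounded_linear.suminf[OF bl summable_exp_ad, symmetric])
  also have "\<dots> = \<psi> (exp_ad x y)"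
    using E y g by (simp add: exp_ad_def)
  finally show ?thesis .
qed

lemma Perm_so_simps:
  assumes "f \<in> Bij so" "g \<in> Bij so"
  shows "f \<otimes>\<^bsub>Perm_so\<^esub> g = compose so f g"
  using assms by (simp add: BijGroup_def)

lemma Perm_so_carrier: "carrier Perm_so = Bij so"
  by (simp add: BijGroup_def)

lemma Perm_so_inv:
  assumes "f \<in> Bij so" "x \<in> so"
  shows "(inv\<^bsub>Perm_so\<^esub> f) (f x) = x" "f ((inv\<^bsub>Perm_so\<^esub> f) x) = x" "inv\<^bsub>Perm_so\<^esub> f \<in> Bij so"
proof -
  interpret group Perm_so by (rule group_BijGroup)
  have f: "f \<in> carrier Perm_so" using assms by (simp add: Perm_so_carrier)
  show fi: "inv\<^bsub>Perm_so\<^esub> f \<in> Bij so" using inv_closed[OF f] by (simp add: Perm_so_carrier)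
  have "(inv\<^bsub>Perm_so\<^esub> f \<otimes>\<^bsub>Perm_so\<^esub> f) x = x" "(f \<otimes>\<^bsub>Perm_so\<^esub> inv\<^bsub>Perm_so\<^esub> f) x = x"
    using assms(2) unfolding l_inv[OF f] r_inv[OF f] by (simp_all add: BijGroup_def)
  then show "(inv\<^bsub>Perm_so\<^esub> f) (f x) = x" "f ((inv\<^bsub>Perm_so\<^esub> f) x) = x"
    unfolding Perm_so_simps[OF assms(1) fi] Perm_so_simps[OF fi assms(1)]
    using assms(2) by (simp_all add: compose_eq)
qed

text \<open>Conjugating exp(ad t x) by \<psi> gives exp(ad t \<psi> x), by
  \<open>Aut_so_exp_ad\<close>.\<close>

lemma lie_algebra_conj:
  assumes \<psi>: "\<psi> \<in> Aut_so" and H: "H \<subseteq> Bij so"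
    and conj: "\<And>g. g \<in> H \<Longrightarrow> \<psi> \<otimes>\<^bsub>Perm_so\<^esub> g \<otimes>\<^bsub>Perm_so\<^esub> inv\<^bsub>Perm_so\<^esub> \<psi> \<in> H"
    and x: "x \<in> lie_algebra H"
  shows "\<psi> x \<in> lie_algebra H"
proof -
  note hom = Aut_so_D[OF \<psi>]
  have \<psi>B: "\<psi> \<in> Bij so" using \<psi> by (simp add: Aut_so_def)
  have xso: "x \<in> so" and xH: "\<And>t. exp_ad (t *\<^sub>R x) \<in> H" using x by (auto simp: lie_algebra_def)
  interpret group Perm_so by (rule group_BijGroup)
  have "exp_ad (t *\<^sub>R \<psi> x) \<in> H" for t
  proof -
    let ?g = "exp_ad (t *\<^sub>R x)"
    have g: "?g \<in> Bij so" using xH H by blast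
    have tx: "t *\<^sub>R x \<in> so" unfolding scaleR_eq_mscale by (rule cmat.subspace_scale[OF subspace_so xso])
    have t\<psi>: "t *\<^sub>R \<psi> x = \<psi> (t *\<^sub>R x)" unfolding scaleR_eq_mscale hom(3)[OF xso] ..
    let ?c = "\<psi> \<otimes>\<^bsub>Perm_so\<^esub> ?g \<otimes>\<^bsub>Perm_so\<^esub> inv\<^bsub>Perm_so\<^esub> \<psi>"
    have c: "?c \<in> Bij so" using conj[OF xH] H by blast
    have "exp_ad (t *\<^sub>R \<psi> x) y = ?c y" for y
    proof (cases "y \<in> so")
      case True
      let ?y = "(inv\<^bsub>Perm_so\<^esub> \<psi>) y"
      note inv = Perm_so_inv[OF \<psi>B True]
      have y': "?y \<in> so" using Bij_soD inv(3) True by blast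
      have "exp_ad (\<psi> (t *\<^sub>R x)) (\<psi> ?y) = \<psi> (?g ?y)"
        by (rule Aut_so_exp_ad[OF \<psi> tx y' Bij_soD[OF g y']])
      also have "\<psi> (?g ?y) = ?c y"
      proof -
        have "\<psi> \<otimes>\<^bsub>Perm_so\<^esub> ?g \<in> Bij so"
          using m_closed[of \<psi> ?g] \<psi>B g by (simp add: Perm_so_carrier)
        then show ?thesis
          using True y' by (simp add: Perm_so_simps \<psi>B g inv(3) compose_eq)
      qed
      finally show ?thesis unfolding inv(2) t\<psi> .
    next
      case False
      \<comment> \<open>Off \<open>so\<close> both sides are \<open>undefined\<close>.\<close>
      then show ?thesis using c by (simp add: exp_ad_def Bij_def extensional_def)
    qed
    then have "exp_ad (t *\<^sub>R \<psi> x) = ?c" by (rule ext)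
    then show ?thesis using conj[OF xH] by simp
  qed
  then show ?thesis using hom(1)[OF xso] by (simp add: lie_algebra_def)
qed

lemma adjoint_group_Aut: "adjoint_group \<subseteq> Aut_so"
  unfolding adjoint_group_def by (rule connected_component_subset)

lemma Aut_so_Bij: "Aut_so \<subseteq> Bij so"
  by (auto simp: Aut_so_def)

lemma Aut_so_extremal:
  assumes \<psi>: "\<psi> \<in> Aut_so" and x: "x \<in> so"
  shows "extremal (\<psi> x) \<longleftrightarrow> extremal x"
proof -
  note hom = Aut_so_D[OF \<psi>]
  have eq: "lie (\<psi> x) (lie (\<psi> x) (\<psi> w)) = \<psi> (lie x (lie x w))" if "w \<in> so" for w
    using x that by (simp add: hom)
  show ?thesis
  proof
    assume "extremal x"
    then show "extremal (\<psi> x)"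
      unfolding extremal_def using hom(1,3,6) eq x by metis
  next
    assume e: "extremal (\<psi> x)"
    have "\<exists>c. lie x (lie x w) = mscale c x" if w: "w \<in> so" for w
    proof -
      obtain c where "lie (\<psi> x) (lie (\<psi> x) (\<psi> w)) = mscale c (\<psi> x)"
        using e hom(1)[OF w] unfolding extremal_def by blast
      then have "\<psi> (lie x (lie x w)) = \<psi> (mscale c x)" using eq[OF w] hom(3)[OF x] by simp
      then show ?thesis
        using hom(5) x w cmat.subspace_scale[OF subspace_so x] by (metis lie_in_so)
    qed
    then show "extremal x" unfolding extremal_def using x by blast
  qed
qed

text \<open>Any nonzero vector of the range can serve as first factor, so a vector common to two
  ranges exhibits a common factor.\<close>

lemma pluecker_rel_factor:
  assumes "y \<in> so" "pluecker_rel y" "y *v d \<noteq> 0"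
  obtains r where "y = (y *v d) \<bowtie> r"
proof -
  obtain b where "b \<star> (y *v d) \<noteq> 0" using cdot_eq_0_imp[of "y *v d"] assms(3) by (metis cdot_commute)
  from pluecker_rel_eq_skew[OF assms(1,2) this] that show ?thesis by (metis skew_simps(6))
qed

lemma one_in_Aut_so: "\<one>\<^bsub>Perm_so\<^esub> \<in> Aut_so"
  using id_Bij[of so] cmat.subspace_scale[OF subspace_so] cmat.subspace_add[OF subspace_so]
  by (auto simp: Aut_so_def BijGroup_def linear_on_def)

text \<open>Only here is it used that the adjoint group is connected. The statement fails for the triality
  automorphisms of type \<open>D\<^sub>4\<close>. The images of the two commuting extremal elements either share a line or
  have product zero, and these two closed conditions exclude each other on \<open>Aut_so\<close>.\<close>

lemma adjoint_group_pluecker_sum: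
  fixes f a1 a2 :: "complex^'m::finite"
  assumes card: "CARD('m) > 6" and \<phi>: "\<phi> \<in> adjoint_group"
    and f: "f \<star> f = 0" "f \<star> a1 = 0" "f \<star> a2 = 0" "f \<noteq> 0"
    and a: "a1 \<star> a1 = 0" "a2 \<star> a2 = 0" "a1 \<star> a2 \<noteq> 0"
  shows "pluecker_rel (\<phi> (f \<bowtie> a1) + \<phi> (f \<bowtie> a2))"
proof -
  let ?x1 = "f \<bowtie> a1" and ?x2 = "f \<bowtie> a2"
  define A where "A = {\<phi> :: 'm cmat \<Rightarrow> 'm cmat. pluecker_rel (\<phi> ?x1 + \<phi> ?x2)}"
  define B where "B = {\<phi> :: 'm cmat \<Rightarrow> 'm cmat. \<forall>c. \<phi> ?x1 *v (\<phi> ?x2 *v c) = 0}"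
  have cont: "continuous_on UNIV (\<lambda>\<phi> :: 'm cmat \<Rightarrow> 'm cmat. \<phi> x $ i $ j)" for x i j
    by (intro continuous_intros continuous_on_product_coordinates)
  have cont_sum: "continuous_on UNIV (\<lambda>\<phi> :: 'm cmat \<Rightarrow> 'm cmat. ((\<phi> ?x1 + \<phi> ?x2) *v c) $ i)" for c i
    unfolding matrix_vector_mult_def by (simp add: algebra_simps) (intro continuous_intros cont)
  have cont_dot: "continuous_on UNIV (\<lambda>\<phi> :: 'm cmat \<Rightarrow> 'm cmat. ((\<phi> ?x1 + \<phi> ?x2) *v c) \<star> b)" for c b
    unfolding cdot_def by (intro continuous_intros cont_sum)
  have "closed A"
    unfolding A_def pluecker_rel_def vec_eq_iff vector_add_component vector_minus_component
      vector_smult_component zero_index cdot_commute[of b "_ *v _" for b]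
    by (intro closed_Collect_all closed_Collect_eq continuous_intros cont_sum cont_dot)
  moreover have "closed B"
    unfolding B_def vec_eq_iff
    by (intro closed_Collect_all closed_Collect_eq)
       (simp_all add: matrix_vector_mult_def, (intro continuous_intros cont)+)
  moreover have f': "a1 \<star> f = 0" "a2 \<star> f = 0" "a2 \<star> a1 = a1 \<star> a2" using f by (simp_all add: cdot_commute)
  have ext: "extremal ?x1" "extremal ?x2"
    by (rule skew_extremal; simp add: mv_simps f a f')+
  have comm: "lie ?x1 ?x2 = 0" by (simp add: lie_skew f f' a skew_simps)
  have Aut: "pluecker_rel (\<psi> ?x1 + \<psi> ?x2) \<or> (\<forall>c. \<psi> ?x1 *v (\<psi> ?x2 *v c) = 0)"
     "\<not> (pluecker_rel (\<psi> ?x1 + \<psi> ?x2) \<and> (\<forall>c. \<psi> ?x1 *v (\<psi> ?x2 *v c) = 0))" if \<psi>: "\<psi> \<in> Aut_so" for \<psi>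
  proof -
    note hom = Aut_so_D[OF \<psi>]
    let ?y1 = "\<psi> ?x1" and ?y2 = "\<psi> ?x2"
    have yext: "extremal ?y1" "extremal ?y2" using ext Aut_so_extremal[OF \<psi>] by simp_all
    have yso: "?y1 \<in> so" "?y2 \<in> so" using hom(1) by simp_all
    have pl: "pluecker_rel ?y1" "pluecker_rel ?y2"
      using extremal_decomposable[OF yext(1) card] extremal_decomposable[OF yext(2) card] pluecker_rel_skew by metis+
    have "lie ?y1 ?y2 = 0" using hom(4)[of ?x1 ?x2] comm Aut_so_0[OF \<psi>] by simp
    then have yc: "?y1 *v (?y2 *v c) = ?y2 *v (?y1 *v c)" for c
      using lie_mult_vec[of ?y1 ?y2 c] by simp
    show "pluecker_rel (?y1 + ?y2) \<or> (\<forall>c. ?y1 *v (?y2 *v c) = 0)"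
    proof (rule disjCI)
      assume "\<not> (\<forall>c. ?y1 *v (?y2 *v c) = 0)"
      \<comment> \<open>As the two images commute, this nonzero vector lies in both ranges and is a
        common first factor.\<close>
      then obtain c where c: "?y1 *v (?y2 *v c) \<noteq> 0" by blast
      obtain r1 where "?y1 = (?y1 *v (?y2 *v c)) \<bowtie> r1"
        using pluecker_rel_factor[OF yso(1) pl(1) c] .
      moreover obtain r2 where "?y2 = (?y2 *v (?y1 *v c)) \<bowtie> r2"
        using pluecker_rel_factor[OF yso(2) pl(2), of "?y1 *v c"] c yc by auto
      ultimately have "?y1 + ?y2 = (?y1 *v (?y2 *v c)) \<bowtie> (r1 + r2)"
        unfolding yc by (simp add: skew_simps)
      then show "pluecker_rel (?y1 + ?y2)" using pluecker_rel_skew by metis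
    qed
    show "\<not> (pluecker_rel (?y1 + ?y2) \<and> (\<forall>c. ?y1 *v (?y2 *v c) = 0))"
    proof
      assume asm: "pluecker_rel (?y1 + ?y2) \<and> (\<forall>c. ?y1 *v (?y2 *v c) = 0)"
      \<comment> \<open>The sum would be a bivector of square zero, hence extremal, and so would be
        its preimage f \<and> (a1 + a2). But a1 + a2 is not isotropic, so the square of that
        bivector is nonzero.\<close>
      obtain p q where pq: "?y1 + ?y2 = p \<bowtie> q"
        using pluecker_rel_decomposable[of "?y1 + ?y2"] asm cmat.subspace_add[OF subspace_so yso] by metis
      have "(?y1 + ?y2) *v ((?y1 + ?y2) *v c) = 0" for c
        using asm yc extremal_square_zero[OF yext(1) card] extremal_square_zero[OF yext(2) card]
        by (simp add: mv_simps)
      then have "extremal (?y1 + ?y2)" unfolding pq by (rule skew_extremal)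
      moreover have "?y1 + ?y2 = \<psi> (f \<bowtie> (a1 + a2))" by (simp add: skew_simps hom)
      ultimately have "extremal (f \<bowtie> (a1 + a2))" using Aut_so_extremal[OF \<psi>] by simp
      then have sq: "(f \<bowtie> (a1 + a2)) *v ((f \<bowtie> (a1 + a2)) *v c) = 0" for c
        using extremal_square_zero card by blast
      obtain c where c: "f \<star> c \<noteq> 0" using f(4) cdot_eq_0_imp by blast
      have "(f \<bowtie> (a1 + a2)) *v ((f \<bowtie> (a1 + a2)) *v c) = (- 2 * (f \<star> c) * (a1 \<star> a2)) *s f"
        by (simp add: mv_simps f f' a vec_eq_iff algebra_simps)
      then have "(- 2 * (f \<star> c) * (a1 \<star> a2)) *s f = 0"
        unfolding sq by (rule sym)
      then have "- 2 * (f \<star> c) * (a1 \<star> a2) = 0 \<or> f = 0" by (simp only: vec.scale_eq_0_iff)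
      then show False using c a(3) f(4) by simp
    qed
  qed
  have "connected (adjoint_group :: ('m cmat \<Rightarrow> 'm cmat) set)"
    unfolding adjoint_group_def by (rule connected_connected_component)
  moreover have "A \<inter> B \<inter> adjoint_group = {}" "adjoint_group \<subseteq> A \<union> B"
    using Aut adjoint_group_Aut unfolding A_def B_def by blast+
  ultimately have "A \<inter> adjoint_group = {} \<or> B \<inter> adjoint_group = {}"
    using \<open>closed A\<close> \<open>closed B\<close> connected_closedD by blast
  moreover have "\<one>\<^bsub>Perm_so\<^esub> \<in> adjoint_group"
    unfolding adjoint_group_def using one_in_Aut_so by (simp add: connected_component_refl)
  moreover have "\<one>\<^bsub>Perm_so\<^esub> \<in> A"
    using pluecker_rel_skew[of f "a1 + a2"] by (simp add: A_def BijGroup_def skew_simps)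
  ultimately have "\<phi> \<in> A" using \<phi> \<open>adjoint_group \<subseteq> A \<union> B\<close> by blast
  then show ?thesis by (simp add: A_def)
qed

context frame
begin

text \<open>For isotropic a the tensor is extremal, and so is its image. Any other a is a sum of two
  isotropic vectors that are not orthogonal to each other, the situation of
  \<open>adjoint_group_pluecker_sum\<close>.\<close>

lemma adjoint_group_pure:
  assumes \<phi>: "\<phi> \<in> adjoint_group" and a: "a \<in> U" and st: "s \<noteq> 0 \<or> t \<noteq> 0"
  shows "pluecker_rel (\<phi> ((s *s u + t *s v) \<bowtie> a))"
proof -
  let ?f = "s *s u + t *s v"
  have card: "CARD('m) > 6" using card_eq n_ge by simp
  have Aut: "\<phi> \<in> Aut_so" using \<phi> adjoint_group_Aut by blast
  note hom = Aut_so_D[OF Aut]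
  have "?f \<star> u' = s" "?f \<star> v' = t" by simp_all
  then have f0: "?f \<noteq> 0" using st by (metis cdot_simps(9))
  have ff: "?f \<star> ?f = 0" by simp
  have fa: "?f \<star> c = 0" if "c \<in> U" for c using that by simp
  show ?thesis
  proof (cases "a \<star> a = 0")
    case True
    then have "extremal (?f \<bowtie> a)"
      using a by (intro skew_extremal) (simp add: mv_simps)
    then have "extremal (\<phi> (?f \<bowtie> a))" using Aut_so_extremal[OF Aut] by simp
    then show ?thesis using extremal_decomposable card pluecker_rel_skew by metis
  next
    case False
    define r where "r = csqrt (a \<star> a)"
    have r: "r * r = a \<star> a" "r \<noteq> 0" using False by (simp_all add: r_def flip: power2_eq_square)
    define a' where "a' = (1 / r) *s a"
    have a': "a' \<in> U" "a' \<star> a' = 1" using a r(2) by (simp_all add: a'_def U_closed(2) r(1)[symmetric])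
    obtain b' where b': "b' \<in> U" "b' \<star> b' = 1" "a' \<star> b' = 0"
      using orthonormal_in_U[of 2 "Some a'"] n_ge a' by (auto simp: less_2_cases_iff)
    \<comment> \<open>\<open>b\<close> is orthogonal to \<open>a\<close> with b \<star> b = - (a
      \<star> a), which makes (a + b) / 2 and (a - b) / 2 isotropic.\<close>
    define b where "b = (\<i> * r) *s b'"
    have b: "b \<in> U" "b \<star> b = - (a \<star> a)" "a \<star> b = 0" "b \<star> a = 0"
    proof -
      show "b \<in> U" using b' by (simp add: b_def U_closed(2))
      have "b \<star> b = (\<i> * \<i>) * (r * r)" using b' by (simp add: b_def algebra_simps)
      then show "b \<star> b = - (a \<star> a)" unfolding r by simp
      have "a = r *s a'" using r by (simp add: a'_def)
      then show "a \<star> b = 0" using b'(3) by (simp add: b_def)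
      then show "b \<star> a = 0" by (simp add: cdot_commute)
    qed
    define a1 a2 where "a1 = (1/2) *s (a + b)" and "a2 = (1/2) *s (a - b)"
    have "a1 \<in> U" "a2 \<in> U" unfolding a1_def a2_def using a b(1) U_closed by blast+
    moreover have "a1 \<star> a1 = 0" "a2 \<star> a2 = 0" "a1 \<star> a2 \<noteq> 0"
      using b False by (simp_all add: a1_def a2_def)
    ultimately have "pluecker_rel (\<phi> (?f \<bowtie> a1) + \<phi> (?f \<bowtie> a2))"
      using adjoint_group_pluecker_sum[OF card \<phi> ff fa fa f0] by blast
    moreover have "\<phi> (?f \<bowtie> a1) + \<phi> (?f \<bowtie> a2) = \<phi> (?f \<bowtie> a)"
    proof -
      have "?f \<bowtie> a = ?f \<bowtie> a1 + ?f \<bowtie> a2"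
        unfolding a1_def a2_def skew_simps by (simp add: vec_eq_iff mscale_def field_simps)
      then show ?thesis by (simp add: hom)
    qed
    ultimately show ?thesis by simp
  qed
qed

end

section \<open>The action on the tensor product\<close>

locale levi_frame = contact_frame n P G0 Pp gr u v u' v' e
  for n and P G0 Pp :: "('m::finite cmat \<Rightarrow> 'm cmat) set" and gr :: "int \<Rightarrow> 'm cmat set"
    and u v u' v' :: "complex^'m" and e :: "nat \<Rightarrow> complex^'m" +
  assumes P_adjoint: "P \<subseteq> adjoint_group" and levi: "levi_decomposition P G0 Pp"
begin

lemma P_Aut: "P \<subseteq> Aut_so"
  using P_adjoint adjoint_group_Aut by blast

lemma Pp_normal: "Pp \<lhd> Perm_so\<lparr>carrier := P\<rparr>"
  using levi by (simp add: levi_decomposition_def unipotent_radical_def normal_unipotent_def)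

lemma P_subgroup: "subgroup P Perm_so"
proof -
  interpret normal Pp "Perm_so\<lparr>carrier := P\<rparr>" by (rule Pp_normal)
  have "group (Perm_so\<lparr>carrier := P\<rparr>)" ..
  then show ?thesis
    using group.group_incl_imp_subgroup[OF group_BijGroup, of P so] P_Aut Aut_so_Bij
    by (simp add: Perm_so_carrier) blast
qed

lemma G0_subgroup: "subgroup G0 Perm_so"
  using group.incl_subgroup[OF group_BijGroup P_subgroup] levi
  by (simp add: levi_decomposition_def)

lemma G0_P: "G0 \<subseteq> P"
  using levi subgroup.subset unfolding levi_decomposition_def by fastforce

lemma G0_Aut: "\<phi> \<in> G0 \<Longrightarrow> \<phi> \<in> Aut_so"
  using G0_P P_Aut by blast

lemma G0_inv: "\<phi> \<in> G0 \<Longrightarrow> inv\<^bsub>Perm_so\<^esub> \<phi> \<in> G0"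
  using subgroup.m_inv_closed[OF G0_subgroup] .

lemma G0_lie_algebra_G0:
  assumes "\<phi> \<in> G0" "x \<in> gr 0"
  shows "\<phi> x \<in> gr 0"
  unfolding gr_G0[symmetric]
proof (rule lie_algebra_conj[OF G0_Aut[OF assms(1)]])
  show "G0 \<subseteq> Bij so" using subgroup.subset[OF G0_subgroup] by (simp add: Perm_so_carrier)
  show "x \<in> lie_algebra G0" using assms gr_G0 by simp
  show "\<phi> \<otimes>\<^bsub>Perm_so\<^esub> g \<otimes>\<^bsub>Perm_so\<^esub> inv\<^bsub>Perm_so\<^esub> \<phi> \<in> G0" if "g \<in> G0" for g
    using that assms(1) G0_inv subgroup.m_closed[OF G0_subgroup] by blast
qed

lemma G0_lie_algebra_Pp:
  assumes "\<phi> \<in> G0" "x \<in> lie_algebra Pp"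
  shows "\<phi> x \<in> lie_algebra Pp"
proof (rule lie_algebra_conj[OF G0_Aut[OF assms(1)] _ _ assms(2)])
  interpret normal Pp "Perm_so\<lparr>carrier := P\<rparr>" by (rule Pp_normal)
  have PB: "P \<subseteq> Bij so" using P_Aut Aut_so_Bij by blast
  then show "Pp \<subseteq> Bij so" using subset by auto
  have \<phi>: "\<phi> \<in> P" using assms G0_P by blast
  have inv: "inv\<^bsub>Perm_so\<lparr>carrier := P\<rparr>\<^esub> \<phi> = inv\<^bsub>Perm_so\<^esub> \<phi>"
    by (rule group.m_inv_consistent[OF group_BijGroup P_subgroup \<phi>])
  show "\<phi> \<otimes>\<^bsub>Perm_so\<^esub> g \<otimes>\<^bsub>Perm_so\<^esub> inv\<^bsub>Perm_so\<^esub> \<phi> \<in> Pp" if "g \<in> Pp" for g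
    using inv_op_closed2[of \<phi> g] \<phi> that inv by simp
qed

text \<open>Conjugation by an element of \<open>G0\<close> maps \<open>G0\<close> and the normal
  subgroup \<open>Pp\<close> to themselves, so both Lie algebras are preserved; the inverse element
  provides the preimages.\<close>

lemma G0_grading:
  assumes \<phi>: "\<phi> \<in> G0" and x: "x \<in> gr k"
  shows "\<phi> x \<in> gr k"
proof (rule automorphism_preserves_grading[OF G0_Aut[OF \<phi>] G0_lie_algebra_G0[OF \<phi>] _ _ x])
  fix y assume y: "y \<in> gr 1"
  let ?\<psi> = "inv\<^bsub>Perm_so\<^esub> \<phi>"
  have "y \<in> lie_algebra Pp" unfolding gr_Pp using y gr_closed(5)[of 2] by force
  from G0_lie_algebra_Pp[OF G0_inv[OF \<phi>] this] obtain y' z' where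
    "y' \<in> gr 1" "z' \<in> gr 2" "?\<psi> y = y' + z'" unfolding gr_Pp by blast
  moreover have "\<phi> (?\<psi> y) = y"
    using Perm_so_inv(2)[of \<phi> y] G0_Aut[OF \<phi>] Aut_so_Bij gr_so[OF y] by blast
  ultimately show "\<exists>y'\<in>gr 1. \<exists>z'\<in>gr 2. \<phi> (y' + z') = y" by metis
next
  fix y z assume "y \<in> gr 1" "z \<in> gr 2"
  then have "y + z \<in> lie_algebra Pp" unfolding gr_Pp by blast
  from G0_lie_algebra_Pp[OF \<phi> this] show "\<exists>y'\<in>gr 1. \<exists>z'\<in>gr 2. \<phi> (y + z) = y' + z'"
    unfolding gr_Pp by blast
qed

end

section \<open>Pairs of linear maps on U with dependent values\<close>

context frame
begin

definition linear_on_U :: "(complex^'m \<Rightarrow> complex^'m) \<Rightarrow> bool" where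
  "linear_on_U p \<longleftrightarrow> (\<forall>a\<in>U. p a \<in> U) \<and> (\<forall>a\<in>U. \<forall>b\<in>U. p (a + b) = p a + p b) \<and> (\<forall>c. \<forall>a\<in>U. p (c *s a) = c *s p a)"

lemma linear_on_UD:
  assumes "linear_on_U p"
  shows "a \<in> U \<Longrightarrow> p a \<in> U" "a \<in> U \<Longrightarrow> b \<in> U \<Longrightarrow> p (a + b) = p a + p b" "a \<in> U \<Longrightarrow> p (c *s a) = c *s p a"
  using assms by (simp_all add: linear_on_U_def)

lemma sum_in_U: "(\<And>i. i \<in> I \<Longrightarrow> f i \<in> U) \<Longrightarrow> (\<Sum>i\<in>I. f i) \<in> U"
  by (induction I rule: infinite_finite_induct) (simp_all add: U_closed)

lemma linear_on_U_expand:
  assumes p: "linear_on_U p" and a: "a \<in> U"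
  shows "p a = (\<Sum>i<n. (e i \<star> a) *s p (e i))"
proof -
  have "p (\<Sum>i\<in>I. (e i \<star> a) *s e i) = (\<Sum>i\<in>I. (e i \<star> a) *s p (e i))" if "finite I" "I \<subseteq> {..<n}" for I
    using that
  proof (induction I rule: finite_induct)
    case empty
    then show ?case using linear_on_UD(3)[OF p U_closed(3), of 0] by simp
  next
    case (insert i I)
    then show ?case
      using linear_on_UD[OF p] by (auto simp: U_closed sum_in_U subset_iff)
  qed
  from this[of "{..<n}"] show ?thesis using U_expand[OF a] by simp
qed

lemma linear_on_U_dot:
  assumes p: "linear_on_U p"
  obtains r where "\<And>a. a \<in> U \<Longrightarrow> p a \<star> x = r \<star> a"
proof
  fix a assume "a \<in> U"
  then show "p a \<star> x = (\<Sum>i<n. (p (e i) \<star> x) *s e i) \<star> a"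
    by (subst linear_on_U_expand[OF p]) (simp_all add: cdot_sum_left mult.commute)
qed

lemma dependent_scale:
  assumes dep: "\<And>x. (q \<star> x) *s p = (p \<star> x) *s q" and "p \<noteq> 0"
  obtains k where "q = k *s p"
proof -
  obtain x where x: "p \<star> x \<noteq> 0" using cdot_eq_0_imp assms(2) by blast
  have "q = (1 / (p \<star> x)) *s ((p \<star> x) *s q)" using x by (simp add: vec_eq_iff)
  also have "\<dots> = ((q \<star> x) / (p \<star> x)) *s p" unfolding dep[symmetric] by (simp add: vec_eq_iff)
  finally show ?thesis by (rule that)
qed

text \<open>Where p a \<noteq> 0, q a is a multiple of p a. If p a and p a0 are independent,
  comparing the multiples at a, a0 and a + a0 shows them equal. If they are dependent, this applies
  to a + b0 and b0 instead.\<close>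

lemma locally_dependent_proportional:
  assumes p: "linear_on_U p" and q: "linear_on_U q"
    and dep: "\<And>a x. a \<in> U \<Longrightarrow> (q a \<star> x) *s p a = (p a \<star> x) *s q a"
    and a0: "a0 \<in> U" "p a0 \<noteq> 0" and b0: "b0 \<in> U" "\<And>k. p b0 \<noteq> k *s p a0"
  shows "\<exists>k. \<forall>a\<in>U. q a = k *s p a"
proof -
  obtain l where l: "q a0 = l *s p a0" using dependent_scale[OF dep[OF a0(1)] a0(2)] .
  have indep: "q a = l *s p a" if a: "a \<in> U" and ni: "\<And>k. p a \<noteq> k *s p a0" for a
  proof -
    have "p a \<noteq> 0" using ni[of 0] by simp
    then obtain m where m: "q a = m *s p a" using dependent_scale[OF dep[OF a]] by metis
    have "p (a + a0) \<noteq> 0"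
      using ni[of "-1"] linear_on_UD(2)[OF p a a0(1)] by (metis add_eq_0_iff2 vector_sneg_minus1)
    then obtain k where k: "q (a + a0) = k *s p (a + a0)"
      using dependent_scale[OF dep[OF U_closed(1)[OF a a0(1)]]] by metis
    have eq: "(m - k) *s p a = (k - l) *s p a0"
      using k unfolding linear_on_UD(2)[OF p a a0(1)] linear_on_UD(2)[OF q a a0(1)] m l
      by (simp add: vec_eq_iff algebra_simps)
    have "m = k"
    proof (rule ccontr)
      assume "m \<noteq> k"
      then have "p a = (1 / (m - k)) *s ((m - k) *s p a)"
        by (simp only: vec.scale_scale) simp
      also have "\<dots> = ((k - l) / (m - k)) *s p a0" unfolding eq
        by (simp only: vec.scale_scale) simp
      finally show False using ni by blast
    qed
    then have "k = l" using eq a0(2) by simp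
    then show ?thesis using m \<open>m = k\<close> by simp
  qed
  have "q a = l *s p a" if a: "a \<in> U" for a
  proof (cases "\<exists>k. p a = k *s p a0")
    case True
    then obtain k where k: "p a = k *s p a0" by blast
    have "p (a + b0) \<noteq> j *s p a0" for j
    proof
      assume "p (a + b0) = j *s p a0"
      then have "p b0 = (j - k) *s p a0"
        unfolding linear_on_UD(2)[OF p a b0(1)] k by (simp add: vec_eq_iff algebra_simps)
      then show False using b0(2) by blast
    qed
    then have "q (a + b0) = l *s p (a + b0)" using indep U_closed(1)[OF a b0(1)] by blast
    moreover have "q b0 = l *s p b0" using indep b0 by blast
    ultimately show ?thesis
      unfolding linear_on_UD(2)[OF p a b0(1)] linear_on_UD(2)[OF q a b0(1)]
      by (simp add: vec_eq_iff algebra_simps)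
  qed (use indep a in blast)
  then show ?thesis by blast
qed

lemma rank_le_1_functional:
  assumes p: "linear_on_U p"
    and *: "\<And>a0 b0. a0 \<in> U \<Longrightarrow> p a0 \<noteq> 0 \<Longrightarrow> b0 \<in> U \<Longrightarrow> \<exists>k. p b0 = k *s p a0"
  obtains r where "\<And>a. a \<in> U \<Longrightarrow> r \<star> a = 0 \<Longrightarrow> p a = 0"
proof (cases "\<forall>a\<in>U. p a = 0")
  case True
  then show ?thesis using that by blast
next
  case False
  then obtain a0 where a0: "a0 \<in> U" "p a0 \<noteq> 0" by blast
  obtain x where x: "p a0 \<star> x \<noteq> 0" using cdot_eq_0_imp a0(2) by blast
  obtain r where r: "\<And>a. a \<in> U \<Longrightarrow> p a \<star> x = r \<star> a" using linear_on_U_dot[OF p] by blast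
  show ?thesis
  proof (rule that)
    fix a assume a: "a \<in> U" "r \<star> a = 0"
    obtain k where k: "p a = k *s p a0" using *[OF a0 a(1)] by blast
    then have "k * (p a0 \<star> x) = 0" using r[OF a(1)] a(2) by simp
    then show "p a = 0" using x k by simp
  qed
qed

text \<open>A linear space of pure tensors in \<open>\<complex>\<^sup>2 \<otimes> U\<close> of dimension greater than 2 consists of
  tensors with a common first factor.\<close>

lemma locally_dependent:
  assumes p: "linear_on_U p" and q: "linear_on_U q"
    and dep: "\<And>a x. a \<in> U \<Longrightarrow> (q a \<star> x) *s p a = (p a \<star> x) *s q a"
    and inj: "\<And>a. a \<in> U \<Longrightarrow> p a = 0 \<Longrightarrow> q a = 0 \<Longrightarrow> a = 0"
  obtains s t k where "s \<noteq> 0 \<or> t \<noteq> 0" "linear_on_U k" "\<And>a. a \<in> U \<Longrightarrow> p a = s *s k a" "\<And>a. a \<in> U \<Longrightarrow> q a = t *s k a"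
proof (cases "\<exists>a0 b0. a0 \<in> U \<and> p a0 \<noteq> 0 \<and> b0 \<in> U \<and> (\<forall>k. p b0 \<noteq> k *s p a0)")
  case True
  then obtain k where "\<forall>a\<in>U. q a = k *s p a"
    using locally_dependent_proportional[OF p q dep] by metis
  then show ?thesis using that[of 1 k p] p by simp
next
  case p1: False
  show ?thesis
  proof (cases "\<exists>a0 b0. a0 \<in> U \<and> q a0 \<noteq> 0 \<and> b0 \<in> U \<and> (\<forall>k. q b0 \<noteq> k *s q a0)")
    case True
    then obtain k where "\<forall>a\<in>U. p a = k *s q a"
      using locally_dependent_proportional[OF q p dep[symmetric]] by metis
    then show ?thesis using that[of k 1 q] q by simp
  next
    case q1: False
    \<comment> \<open>Both maps have rank at most one, so one linear condition kills each. With the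
      four conditions defining \<open>U\<close> these are six conditions in dimension at least 8,
      against \<open>inj\<close>.\<close>
    obtain r1 where r1: "\<And>a. a \<in> U \<Longrightarrow> r1 \<star> a = 0 \<Longrightarrow> p a = 0"
      using rank_le_1_functional[OF p] p1 by metis
    obtain r2 where r2: "\<And>a. a \<in> U \<Longrightarrow> r2 \<star> a = 0 \<Longrightarrow> q a = 0"
      using rank_le_1_functional[OF q] q1 by metis
    have "card {u, v, u', v', r1, r2} \<le> 6"
      using card_length[of "[u, v, u', v', r1, r2]"] by simp
    then obtain a where a: "a \<noteq> 0" "\<forall>s\<in>{u, v, u', v', r1, r2}. s \<star> a = 0"
      using exists_orthogonal[of "{u, v, u', v', r1, r2}"] card_eq n_ge by auto
    then have "a \<in> U" by (simp add: U_def del: U_dots)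
    then show ?thesis using inj[of a] r1 r2 a by auto
  qed
qed

text \<open>At u' and v' the matrix takes the values -p and -q, so the relation for these two
  vectors reduces to p \<and> q = 0.\<close>

lemma pluecker_rel_dependent:
  assumes "p \<in> U" "q \<in> U" "pluecker_rel (u \<bowtie> p + v \<bowtie> q)"
  shows "(q \<star> x) *s p = (p \<star> x) *s q"
proof -
  let ?y = "u \<bowtie> p + v \<bowtie> q"
  have "?y *v u' = - p" "?y *v v' = - q" using assms(1,2) by (simp_all add: mv_simps)
  then have "(v' \<star> (- p)) *s (?y *v x) + ((- q) \<star> x) *s (- p) - ((- p) \<star> x) *s (- q) = 0"
    using assms(3) unfolding pluecker_rel_def by metis
  then show ?thesis using assms(1) by (simp add: vec_eq_iff)
qed

end

section \<open>The action of G0 on gr (-1)\<close>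

context levi_frame
begin

lemma W_coords:
  assumes "w \<in> W"
  shows "- (w *v u') \<in> U" "- (w *v v') \<in> U" "w = u \<bowtie> (- (w *v u')) + v \<bowtie> (- (w *v v'))"
  using assms by (auto simp: W_def mv_simps)

lemma skew_U_in_W: "a \<in> U \<Longrightarrow> (s *s u + t *s v) \<bowtie> a \<in> W"
  unfolding W_def by (rule CollectI, rule exI[of _ "s *s a"], rule exI[of _ "t *s a"])
    (simp add: skew_simps U_closed)

text \<open>For fixed f the tensors f \<and> a form a linear space of pure tensors. By
  \<open>adjoint_group_pure\<close> its image is again one, to which
  \<open>locally_dependent\<close> applies.\<close>

lemma G0_pure_factor:
  assumes \<phi>: "\<phi> \<in> G0" and f: "s0 \<noteq> 0 \<or> t0 \<noteq> 0"
  shows "\<exists>s t k. linear_on_U k \<and> (\<forall>a\<in>U. \<phi> ((s0 *s u + t0 *s v) \<bowtie> a) = (s *s u + t *s v) \<bowtie> k a)"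
proof -
  note hom = Aut_so_D[OF G0_Aut[OF \<phi>]]
  let ?f = "s0 *s u + t0 *s v"
  define p q where "p a = - (\<phi> (?f \<bowtie> a) *v u')" and "q a = - (\<phi> (?f \<bowtie> a) *v v')" for a
  have W: "\<phi> (?f \<bowtie> a) \<in> W" if "a \<in> U" for a
    using G0_grading[OF \<phi>] skew_U_in_W[OF that] gr_m1 by blast
  have eq: "\<phi> (?f \<bowtie> a) = u \<bowtie> p a + v \<bowtie> q a" and pq: "p a \<in> U" "q a \<in> U" if "a \<in> U" for a
    using W_coords[OF W[OF that]] by (simp_all add: p_def q_def)
  have lin: "linear_on_U p" "linear_on_U q"
    using pq by (auto simp: linear_on_U_def p_def q_def skew_simps(2,6) hom(2,3) mv_simps)
  have dep: "(q a \<star> x) *s p a = (p a \<star> x) *s q a" if "a \<in> U" for a x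
    using pluecker_rel_dependent[OF pq[OF that]] adjoint_group_pure[OF _ that f, of \<phi>] \<phi> G0_P P_adjoint eq[OF that]
    by auto
  have inj: "a = 0" if "a \<in> U" "p a = 0" "q a = 0" for a
  proof -
    have "\<phi> (?f \<bowtie> a) = \<phi> 0" using eq[OF that(1)] that Aut_so_0[OF G0_Aut[OF \<phi>]] by (simp add: skew_simps)
    then have "?f \<bowtie> a = 0" using hom(5) cmat.subspace_0[OF subspace_so] skew_in_so by blast
    then have "(?f \<bowtie> a) *v u' = 0" "(?f \<bowtie> a) *v v' = 0" by simp_all
    then show ?thesis using that(1) f by auto
  qed
  obtain s t k where "linear_on_U k" "\<And>a. a \<in> U \<Longrightarrow> p a = s *s k a" "\<And>a. a \<in> U \<Longrightarrow> q a = t *s k a"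
    by (rule locally_dependent[of p q, OF lin]) (use dep inj in blast)+
  then show ?thesis using eq
    by (intro exI[of _ s] exI[of _ t] exI[of _ k]) (simp add: skew_simps)
qed

text \<open>The images of u \<otimes> U, v \<otimes> U and (u + v) \<otimes> U have first factors
  f1, f2, f3 and second factors k1, k2, k3, with f3 \<otimes> k3 = f1 \<otimes> k1 + f2 \<otimes>
  k2. As f1 and f2 are independent, this can be solved for k1 and k2, which are therefore multiples
  of the common map k3.\<close>

lemma G0_tensor:
  assumes \<phi>: "\<phi> \<in> G0"
  obtains K g11 g12 g21 g22 where "linear_on_U K"
    "\<And>a b. a \<in> U \<Longrightarrow> b \<in> U \<Longrightarrow> \<phi> (u \<bowtie> a + v \<bowtie> b) =
        u \<bowtie> (g11 *s K a + g12 *s K b) + v \<bowtie> (g21 *s K a + g22 *s K b)"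
proof -
  note hom = Aut_so_D[OF G0_Aut[OF \<phi>]]
  obtain s1 t1 k1 where 1: "linear_on_U k1" "\<And>a. a \<in> U \<Longrightarrow> \<phi> (u \<bowtie> a) = (s1 *s u + t1 *s v) \<bowtie> k1 a"
    using G0_pure_factor[OF \<phi>, of 1 0] by auto
  obtain s2 t2 k2 where 2: "linear_on_U k2" "\<And>a. a \<in> U \<Longrightarrow> \<phi> (v \<bowtie> a) = (s2 *s u + t2 *s v) \<bowtie> k2 a"
    using G0_pure_factor[OF \<phi>, of 0 1] by auto
  obtain s3 t3 k3 where 3: "linear_on_U k3" "\<And>a. a \<in> U \<Longrightarrow> \<phi> ((u + v) \<bowtie> a) = (s3 *s u + t3 *s v) \<bowtie> k3 a"
    using G0_pure_factor[OF \<phi>, of 1 1] by auto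
  define d where "d = s1 * t2 - s2 * t1"
  have sum: "s3 *s k3 a = s1 *s k1 a + s2 *s k2 a" "t3 *s k3 a = t1 *s k1 a + t2 *s k2 a" if a: "a \<in> U" for a
  proof -
    have "(s3 *s u + t3 *s v) \<bowtie> k3 a = (s1 *s u + t1 *s v) \<bowtie> k1 a + (s2 *s u + t2 *s v) \<bowtie> k2 a"
      unfolding 3(2)[OF a, symmetric] 1(2)[OF a, symmetric] 2(2)[OF a, symmetric] by (simp add: skew_simps hom)
    from arg_cong[OF this, of "\<lambda>A. - (A *v u')"] arg_cong[OF this, of "\<lambda>A. - (A *v v')"]
    show "s3 *s k3 a = s1 *s k1 a + s2 *s k2 a" "t3 *s k3 a = t1 *s k1 a + t2 *s k2 a"
      using linear_on_UD(1)[OF 1(1) a] linear_on_UD(1)[OF 2(1) a] linear_on_UD(1)[OF 3(1) a]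
      by (simp_all add: mv_simps)
  qed
  \<comment> \<open>\<phi> maps v \<and> u, the bracket of u \<and> \<open>e 0\<close> and v \<and>
    \<open>e 0\<close>, to a multiple of d (v \<and> u); being injective, it needs d \<noteq>
    0.\<close>
  have "d \<noteq> 0"
  proof
    assume d0: "d = 0"
    have e: "e 0 \<in> U" "e 0 \<star> e 0 = 1" using n_ge by simp_all
    note kU = linear_on_UD(1)[OF 1(1) e(1)] linear_on_UD(1)[OF 2(1) e(1)]
    have "lie (u \<bowtie> e 0) (v \<bowtie> e 0) = v \<bowtie> u"
      using e by (simp add: lie_skew skew_simps)
    then have "\<phi> (v \<bowtie> u) = lie ((s1 *s u + t1 *s v) \<bowtie> k1 (e 0)) ((s2 *s u + t2 *s v) \<bowtie> k2 (e 0))"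
      using hom(4)[of "u \<bowtie> e 0" "v \<bowtie> e 0"] 1(2)[OF e(1)] 2(2)[OF e(1)] by simp
    also have "\<dots> = mscale ((k1 (e 0) \<star> k2 (e 0)) * d) (v \<bowtie> u)"
    proof -
      have "lie (f1 \<bowtie> c1) (f2 \<bowtie> c2) = mscale (c1 \<star> c2) (f2 \<bowtie> f1)"
        if "f1 \<star> f2 = 0" "f1 \<star> c2 = 0" "c1 \<star> f2 = 0" for f1 f2 c1 c2 :: "complex^'m"
        using that by (simp add: lie_skew skew_simps)
      moreover have "(s2 *s u + t2 *s v) \<bowtie> (s1 *s u + t1 *s v) = mscale d (v \<bowtie> u)"
        by (simp add: skew_simps d_def skew_swap[of u v]) (simp add: mscale_def vec_eq_iff algebra_simps)
      ultimately show ?thesis using kU by simp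
    qed
    finally have "\<phi> (v \<bowtie> u) = \<phi> 0" using d0 Aut_so_0[OF G0_Aut[OF \<phi>]] by simp
    then have "v \<bowtie> u = 0" using hom(5) cmat.subspace_0[OF subspace_so] skew_in_so by blast
    then show False using uv_nonzero skew_swap[of u v] by simp
  qed
  define A B where "A = (s3 * t2 - t3 * s2) / d" and "B = (s1 * t3 - t1 * s3) / d"
  have k1: "k1 a = A *s k3 a" and k2: "k2 a = B *s k3 a" if a: "a \<in> U" for a
  proof -
    have "d *s k1 a = t2 *s (s3 *s k3 a) - s2 *s (t3 *s k3 a)" "d *s k2 a = s1 *s (t3 *s k3 a) - t1 *s (s3 *s k3 a)"
      unfolding sum[OF a] d_def by (simp_all add: vec_eq_iff algebra_simps)
    moreover have "k1 a = (1 / d) *s (d *s k1 a)" "k2 a = (1 / d) *s (d *s k2 a)"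
      using \<open>d \<noteq> 0\<close> by (simp_all add: vec_eq_iff)
    ultimately have "k1 a = (1 / d) *s (t2 *s (s3 *s k3 a) - s2 *s (t3 *s k3 a))"
      "k2 a = (1 / d) *s (s1 *s (t3 *s k3 a) - t1 *s (s3 *s k3 a))" by simp_all
    then show "k1 a = A *s k3 a" "k2 a = B *s k3 a"
      by (simp_all add: A_def B_def vec_eq_iff algebra_simps diff_divide_distrib)
  qed
  show ?thesis
  proof (rule that[OF 3(1)])
    fix a b assume ab: "a \<in> U" "b \<in> U"
    show "\<phi> (u \<bowtie> a + v \<bowtie> b) = u \<bowtie> ((s1 * A) *s k3 a + (s2 * B) *s k3 b) + v \<bowtie> ((t1 * A) *s k3 a + (t2 * B) *s k3 b)"
      using ab by (simp add: hom 1(2) 2(2) k1 k2 skew_simps) (simp add: mscale_def vec_eq_iff algebra_simps)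
  qed
qed

end

section \<open>Binary forms\<close>

lemma smult_sum_right: "smult c (\<Sum>i\<in>I. f i) = (\<Sum>i\<in>I. smult c (f i))"
  by (induction I rule: infinite_finite_induct) (simp_all add: smult_add_right)

text \<open>A binary form of degree n in (s, t) is stored as its polynomial in t at s = 1. Here s is
  restored from the degree n, and S, T are put for s, t.\<close>

definition homogenize :: "nat \<Rightarrow> complex poly \<Rightarrow> complex poly \<Rightarrow> complex poly \<Rightarrow> complex poly" where
  "homogenize n p S T = (\<Sum>k\<le>n. smult (coeff p k) (S ^ (n - k) * T ^ k))"

lemma homogenize_add: "homogenize n (p + q) S T = homogenize n p S T + homogenize n q S T"
  by (simp add: homogenize_def smult_add_left sum.distrib)

lemma homogenize_sum: "homogenize n (\<Sum>i\<in>I. f i) S T = (\<Sum>i\<in>I. homogenize n (f i) S T)"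
  by (induction I rule: infinite_finite_induct) (simp_all add: homogenize_add, simp_all add: homogenize_def)

lemma homogenize_smult: "homogenize n (smult c p) S T = smult c (homogenize n p S T)"
  by (simp add: homogenize_def smult_sum_right)

lemma homogenize_mult_linear:
  assumes "degree p \<le> n"
  shows "homogenize (Suc n) (p * [:x, y:]) S T = homogenize n p S T * (smult x S + smult y T)"
proof -
  have c: "coeff (p * [:x, y:]) k = x * coeff p k + y * (if k = 0 then 0 else coeff p (k - 1))" for k
    by (simp add: mult.commute[of p] coeff_pCons split: nat.split)
  have top: "coeff p (Suc n) = 0" using assms by (simp add: coeff_eq_0)
  have "homogenize (Suc n) (p * [:x, y:]) S T =
     (\<Sum>k\<le>Suc n. smult (x * coeff p k) (S ^ (Suc n - k) * T ^ k)) +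
     (\<Sum>k\<le>Suc n. smult (y * (if k = 0 then 0 else coeff p (k - 1))) (S ^ (Suc n - k) * T ^ k))"
    unfolding homogenize_def c by (simp add: smult_add_left sum.distrib)
  also have "(\<Sum>k\<le>Suc n. smult (x * coeff p k) (S ^ (Suc n - k) * T ^ k)) =
     (\<Sum>k\<le>n. smult (coeff p k) (S ^ (n - k) * T ^ k) * smult x S)"
    by (simp add: top) (intro sum.cong, auto simp: Suc_diff_le mult_ac)
  finally have 1: "homogenize (Suc n) (p * [:x, y:]) S T = (\<Sum>k\<le>n. smult (coeff p k) (S ^ (n - k) * T ^ k) * smult x S) +
     (\<Sum>k\<le>Suc n. smult (y * (if k = 0 then 0 else coeff p (k - 1))) (S ^ (Suc n - k) * T ^ k))" .
  have 2: "(\<Sum>k\<le>Suc n. smult (y * (if k = 0 then 0 else coeff p (k - 1))) (S ^ (Suc n - k) * T ^ k)) =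
     (\<Sum>k\<le>n. smult (coeff p k) (S ^ (n - k) * T ^ k) * smult y T)"
    by (subst sum.atMost_Suc_shift) (simp add: mult_ac)
  show ?thesis
    unfolding 1 2 by (simp only: homogenize_def distrib_left sum_distrib_right)
qed

text \<open>The degree bound is carried through the induction for the sake of
  \<open>homogenize_mult_linear\<close>.\<close>

lemma homogenize_prod:
  "homogenize n (\<Prod>i<n. [:x i, y i:]) S T = (\<Prod>i<n. smult (x i) S + smult (y i) T)
    \<and> degree (\<Prod>i<n. [:x i, y i:]) \<le> n"
proof (induction n)
  case 0
  then show ?case by (simp add: homogenize_def)
next
  case (Suc n)
  have "degree ((\<Prod>i<n. [:x i, y i:]) * [:x n, y n:]) \<le> degree (\<Prod>i<n. [:x i, y i:]) + degree [:x n, y n:]"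
    by (rule degree_mult_le)
  also have "\<dots> \<le> Suc n" using Suc by simp
  finally show ?case using Suc homogenize_mult_linear[of "\<Prod>i<n. [:x i, y i:]" n "x n" "y n" S T] by simp
qed

lemma homogenize_power_mult:
  assumes "j \<le> n"
  shows "homogenize n ([:a, b:] ^ (n - j) * [:c, d:] ^ j) S T =
    (smult a S + smult b T) ^ (n - j) * (smult c S + smult d T) ^ j"
proof -
  have eq: "(\<Prod>i<n. if i < n - j then A else B) = A ^ (n - j) * B ^ j" for A B :: "complex poly"
  proof -
    have "{..<n} \<inter> {i. i < n - j} = {..<n - j}" "{..<n} \<inter> - {i. i < n - j} = {n - j..<n}" by auto
    then show ?thesis using assms by (simp add: prod.If_cases)
  qed
  have "(\<Prod>i<n. [:if i < n - j then a else c, if i < n - j then b else d:]) = (\<Prod>i<n. if i < n - j then [:a, b:] else [:c, d:])"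
    by (intro prod.cong) auto
  moreover have "(\<Prod>i<n. smult (if i < n - j then a else c) S + smult (if i < n - j then b else d) T)
     = (\<Prod>i<n. if i < n - j then smult a S + smult b T else smult c S + smult d T)"
    by (intro prod.cong) auto
  ultimately show ?thesis
    using homogenize_prod[of n "\<lambda>i. if i < n - j then a else c" "\<lambda>i. if i < n - j then b else d" S T]
    by (simp add: eq)
qed

text \<open>Each Leibniz term is a signed product of n linear forms, where
  \<open>homogenize_prod\<close> describes the substitution; \<open>homogenize\<close> is
  linear.\<close>

lemma homogenize_det:
  "Determinant.det (Matrix.mat n n (\<lambda>(i, j). smult (x i j) S + smult (y i j) T)) =
     homogenize n (Determinant.det (Matrix.mat n n (\<lambda>(i, j). [:x i j, y i j:]))) S T"
proof -
  have D: "Determinant.det (Matrix.mat n n f) = (\<Sum>p \<in> {p. p permutes {0..<n}}. of_int (sign p) * (\<Prod>i<n. f (i, p i)))" for f :: "nat \<times> nat \<Rightarrow> complex poly"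
  proof -
    have "p i < n" if "p permutes {0..<n}" "i < n" for p i
      using permutes_in_image[OF that(1), of i] that(2) by simp
    then show ?thesis
      by (subst det_def'[of _ n]) (auto intro!: sum.cong prod.cong simp: lessThan_atLeast0)
  qed
  have s: "of_int k * q = smult (of_int k) (q :: complex poly)" for k q
    by (simp add: of_int_poly)
  show ?thesis
    unfolding D homogenize_sum s homogenize_smult
    by (simp add: homogenize_prod)
qed

text \<open>Up to the factor n!, the classical invariant pairing of binary forms, the sum of (-1)^k
  p_(n-k) q_k / (n choose k).\<close>

definition apolar :: "nat \<Rightarrow> (nat \<Rightarrow> complex) \<Rightarrow> (nat \<Rightarrow> complex) \<Rightarrow> complex" where
  "apolar n p q = (\<Sum>k\<le>n. (-1) ^ k * fact k * fact (n - k) * p (n - k) * q k)"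

definition substitute :: "nat \<Rightarrow> complex poly \<Rightarrow> complex poly \<Rightarrow> (nat \<Rightarrow> complex) \<Rightarrow> nat \<Rightarrow> complex" where
  "substitute n S T p k = (\<Sum>j\<le>n. coeff (S ^ (n - j) * T ^ j) k * p j)"

lemma coeff_linear_power: "coeff ([:c, d:] ^ n) k = of_nat (n choose k) * d ^ k * (c::complex) ^ (n - k)"
proof (cases "k \<le> n")
  case True
  then show ?thesis by (simp add: coeff_linear_poly_power)
next
  case False
  moreover have "degree ([:c, d:] ^ n) \<le> n"
    using degree_power_le[of "[:c, d:]" n] by (simp split: if_splits)
  ultimately show ?thesis by (simp add: coeff_eq_0 binomial_eq_0)
qed

text \<open>The apolar pairing with the power \<open>(a t - b s)\<^sup>n\<close> is evaluation at \<open>(a, b)\<close>, up to a constant.\<close>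

lemma apolar_power:
  "apolar n p (\<lambda>k. of_nat (n choose k) * a ^ k * (- b) ^ (n - k)) =
    (-1) ^ n * fact n * (\<Sum>j\<le>n. p j * (a ^ (n - j) * b ^ j))"
proof -
  have "(-1) ^ k * fact k * fact (n - k) * p (n - k) * (of_nat (n choose k) * a ^ k * (- b) ^ (n - k)) =
    (-1) ^ n * fact n * (p (n - k) * (a ^ k * b ^ (n - k)))" if "k \<le> n" for k
  proof -
    have "fact k * fact (n - k) * (of_nat (n choose k) :: complex) = fact n"
      using that by (metis binomial_fact_lemma of_nat_fact of_nat_mult)
    moreover have "(-1) ^ k * (- b) ^ (n - k) = (-1) ^ n * b ^ (n - k)"
      using that by (simp add: power_minus[of b "n - k"] flip: mult.assoc power_add)
    moreover have "(-1) ^ k * fact k * fact (n - k) * p (n - k) * (of_nat (n choose k) * a ^ k * (- b) ^ (n - k)) =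
      (fact k * fact (n - k) * of_nat (n choose k)) * ((-1) ^ k * (- b) ^ (n - k)) * (p (n - k) * a ^ k)"
      by (simp only: mult_ac)
    ultimately show ?thesis by (simp only: mult_ac)
  qed
  then have "apolar n p (\<lambda>k. of_nat (n choose k) * a ^ k * (- b) ^ (n - k)) =
     (\<Sum>k\<le>n. (-1) ^ n * fact n * (p (n - k) * (a ^ k * b ^ (n - k))))"
    unfolding apolar_def by (intro sum.cong) auto
  also have "\<dots> = (-1) ^ n * fact n * (\<Sum>j\<le>n. p (n - j) * (a ^ j * b ^ (n - j)))"
    by (simp add: sum_distrib_left)
  also have "(\<Sum>j\<le>n. p (n - j) * (a ^ j * b ^ (n - j))) = (\<Sum>j\<le>n. p j * (a ^ (n - j) * b ^ j))"
    by (rule sum.reindex_bij_witness[of _ "\<lambda>j. n - j" "\<lambda>j. n - j"]) auto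
  finally show ?thesis .
qed

text \<open>Against an n-th power the pairing is evaluation. The substitution turns the power into
  another one, whose point is moved by the adjugate matrix; evaluating the substituted p there
  yields the factor det^n. Powers of linear forms span all forms.\<close>

lemma apolar_substitute:
  "apolar n (substitute n [:g11, g21:] [:g12, g22:] p) (substitute n [:g11, g21:] [:g12, g22:] q) =
    (g11 * g22 - g12 * g21) ^ n * apolar n p q"
proof -
  let ?S = "[:g11, g21:]" and ?T = "[:g12, g22:]"
  let ?d = "g11 * g22 - g12 * g21"
  let ?sub = "substitute n ?S ?T"
  define pw where "pw a b k = of_nat (n choose k) * a ^ k * (- b) ^ (n - k)" for a b :: complex and k
  have sub_pw: "?sub (pw a b) = pw (a * g22 - b * g21) (b * g11 - a * g12)" for a b
  proof
    fix k
    have "?sub (pw a b) k = coeff (\<Sum>j\<le>n. smult (pw a b j) (?S ^ (n - j) * ?T ^ j)) k"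
      by (simp add: substitute_def coeff_sum mult.commute)
    also have "(\<Sum>j\<le>n. smult (pw a b j) (?S ^ (n - j) * ?T ^ j)) = (smult a ?T + smult (- b) ?S) ^ n"
      by (subst binomial_ring, intro sum.cong refl)
        (simp only: smult_power, simp add: pw_def of_nat_poly mult_ac)
    also have "smult a ?T + smult (- b) ?S = [:- (b * g11 - a * g12), a * g22 - b * g21:]"
      by (simp add: algebra_simps)
    finally show "?sub (pw a b) k = pw (a * g22 - b * g21) (b * g11 - a * g12) k"
      unfolding coeff_linear_power pw_def .
  qed
  have eval: "(\<Sum>k\<le>n. ?sub p k * (a ^ (n - k) * b ^ k)) =
      (\<Sum>j\<le>n. p j * ((g11 * a + g21 * b) ^ (n - j) * (g12 * a + g22 * b) ^ j))" for a b
  proof -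
    have "(\<Sum>k\<le>n. coeff (?S ^ (n - j) * ?T ^ j) k * (a ^ (n - k) * b ^ k)) =
       (g11 * a + g21 * b) ^ (n - j) * (g12 * a + g22 * b) ^ j" if "j \<le> n" for j
      using arg_cong[OF homogenize_power_mult[OF that, of g11 g21 g12 g22 "[:a:]" "[:b:]"], of "\<lambda>r. poly r 0"]
      by (simp add: homogenize_def poly_sum)
    then have "(\<Sum>j\<le>n. p j * ((g11 * a + g21 * b) ^ (n - j) * (g12 * a + g22 * b) ^ j)) =
      (\<Sum>j\<le>n. \<Sum>k\<le>n. p j * (coeff (?S ^ (n - j) * ?T ^ j) k * (a ^ (n - k) * b ^ k)))"
      by (intro sum.cong refl) (simp only: sum_distrib_left[symmetric] atMost_iff)
    also have "\<dots> = (\<Sum>k\<le>n. \<Sum>j\<le>n. p j * (coeff (?S ^ (n - j) * ?T ^ j) k * (a ^ (n - k) * b ^ k)))"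
      by (rule sum.swap)
    also have "\<dots> = (\<Sum>k\<le>n. ?sub p k * (a ^ (n - k) * b ^ k))"
      by (simp add: substitute_def sum_distrib_left sum_distrib_right mult_ac)
    finally show ?thesis by simp
  qed
  have powers: "apolar n (?sub p) (?sub (pw a b)) = ?d ^ n * apolar n p (pw a b)" for a b
  proof -
    have 1: "g11 * (a * g22 - b * g21) + g21 * (b * g11 - a * g12) = ?d * a"
      "g12 * (a * g22 - b * g21) + g22 * (b * g11 - a * g12) = ?d * b" by (simp_all add: algebra_simps)
    have "(?d * a) ^ (n - j) * (?d * b) ^ j = ?d ^ n * (a ^ (n - j) * b ^ j)" if "j \<le> n" for j
    proof -
      have "?d ^ n = ?d ^ (n - j) * ?d ^ j" using that by (simp flip: power_add)
      then show ?thesis by (simp only: power_mult_distrib mult_ac)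
    qed
    then show ?thesis
      unfolding sub_pw unfolding pw_def apolar_power eval 1
      by (simp add: sum_distrib_left mult_ac)
  qed
  define w where "w p k = (-1) ^ k * fact k * fact (n - k) * p (n - k)" for p :: "nat \<Rightarrow> complex" and k
  have ap: "apolar n p q = (\<Sum>k\<le>n. w p k * q k)" for p q by (simp add: apolar_def w_def)
  define D where "D l = (\<Sum>k\<le>n. w (?sub p) k * coeff (?S ^ (n - l) * ?T ^ l) k) - ?d ^ n * w p l" for l
  have diff: "apolar n (?sub p) (?sub q) - ?d ^ n * apolar n p q = (\<Sum>l\<le>n. D l * q l)" for q
  proof -
    have "apolar n (?sub p) (?sub q) = (\<Sum>k\<le>n. \<Sum>l\<le>n. w (?sub p) k * coeff (?S ^ (n - l) * ?T ^ l) k * q l)"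
      unfolding ap substitute_def[of n ?S ?T q] by (simp add: sum_distrib_left mult_ac)
    also have "\<dots> = (\<Sum>l\<le>n. \<Sum>k\<le>n. w (?sub p) k * coeff (?S ^ (n - l) * ?T ^ l) k * q l)"
      by (rule sum.swap)
    finally show ?thesis
      unfolding ap D_def left_diff_distrib sum_subtractf sum_distrib_left sum_distrib_right mult.assoc
      by (simp only:)
  qed
  \<comment> \<open>The difference of the two sides vanishes at all (s + a t)^n. As a polynomial in
    a it has the coefficients D l (n choose l), so D l = 0 for l \<le> n.\<close>
  have "poly (\<Sum>l\<le>n. monom (D l * of_nat (n choose l)) l) a = 0" for a
    using diff[of "pw a (-1)"] powers[of a "-1"] by (simp add: poly_sum poly_monom pw_def mult_ac)
  then have "(\<Sum>l\<le>n. monom (D l * of_nat (n choose l)) l) = 0"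
    using poly_all_0_iff_0 by blast
  then have coeff0: "coeff (\<Sum>l\<le>n. monom (D l * of_nat (n choose l)) l) l = 0" for l by simp
  have "D l = 0" if "l \<le> n" for l
  proof -
    have "D l * of_nat (n choose l) = 0" using coeff0[of l] that by (simp only: coeff_sum coeff_monom) simp
    then show ?thesis using that by simp
  qed
  then show ?thesis using diff[of q] by simp
qed

section \<open>The binary form of n vectors\<close>

context frame
begin

definition coord_u :: "nat \<Rightarrow> 'm cmat \<Rightarrow> complex" where "coord_u i w = - (e i \<star> (w *v u'))"
definition coord_v :: "nat \<Rightarrow> 'm cmat \<Rightarrow> complex" where "coord_v i w = - (e i \<star> (w *v v'))"

lemma coords [simp]:
  assumes "i < n" "a \<in> U" "b \<in> U"
  shows "coord_u i (u \<bowtie> a + v \<bowtie> b) = e i \<star> a" "coord_v i (u \<bowtie> a + v \<bowtie> b) = e i \<star> b"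
  using assms by (simp_all add: coord_u_def coord_v_def mv_simps)

lemma coords_linear:
  "coord_u i (x + y) = coord_u i x + coord_u i y" "coord_v i (x + y) = coord_v i x + coord_v i y"
  "coord_u i (mscale c x) = c * coord_u i x" "coord_v i (mscale c x) = c * coord_v i x"
  by (simp_all add: coord_u_def coord_v_def mv_simps)

definition coord_mat :: "'m cmat list \<Rightarrow> complex poly Matrix.mat" where
  "coord_mat ws = Matrix.mat n n (\<lambda>(i, j). [:coord_u i (ws ! j), coord_v i (ws ! j):])"

text \<open>The coefficient of \<open>s\<^bsup>n-k\<^esup> t\<^sup>k\<close> in \<open>(s x\<^sub>1 + t y\<^sub>1) \<and> \<dots> \<and> (s x\<^sub>n + t y\<^sub>n)\<close>, read off at \<open>s = 1\<close>.\<close>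

definition binary_form :: "nat \<Rightarrow> 'm cmat list \<Rightarrow> complex" where
  "binary_form k ws = coeff (Determinant.det (coord_mat ws)) k"

lemma coord_mat_carrier: "coord_mat ws \<in> carrier_mat n n"
  by (simp add: coord_mat_def)

lemma cofactor_update:
  assumes "length ws = n" "i < n" "j < n"
  shows "cofactor (coord_mat (ws[j := x])) i j = cofactor (coord_mat ws) i j"
proof -
  have "mat_delete (coord_mat (ws[j := x])) i j = mat_delete (coord_mat ws) i j"
    using assms by (intro eq_matI) (auto simp: mat_delete_def coord_mat_def)
  then show ?thesis by (simp add: cofactor_def)
qed

text \<open>Laplace expansion along column j, whose cofactors do not involve the replaced vector,
  makes the linear dependence on that vector visible.\<close>

lemma binary_form_update:
  assumes "length ws = n" "j < n"
  shows "binary_form k (ws[j := x]) =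
    (\<Sum>i<n. coeff ([:coord_u i x, coord_v i x:] * cofactor (coord_mat ws) i j) k)"
proof -
  have "Determinant.det (coord_mat (ws[j := x])) =
      (\<Sum>i<n. coord_mat (ws[j := x]) $$ (i, j) * cofactor (coord_mat (ws[j := x])) i j)"
    by (rule laplace_expansion_column[OF coord_mat_carrier assms(2)])
  also have "\<dots> = (\<Sum>i<n. [:coord_u i x, coord_v i x:] * cofactor (coord_mat ws) i j)"
  proof (intro sum.cong refl)
    fix i assume "i \<in> {..<n}"
    then have i: "i < n" by simp
    show "coord_mat (ws[j := x]) $$ (i, j) * cofactor (coord_mat (ws[j := x])) i j =
        [:coord_u i x, coord_v i x:] * cofactor (coord_mat ws) i j"
      unfolding cofactor_update[OF assms(1) i assms(2)] using assms i by (simp add: coord_mat_def)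
  qed
  finally show ?thesis by (simp add: binary_form_def coeff_sum)
qed

lemma binary_form_alt: "binary_form k \<in> alt_forms n V"
  unfolding alt_forms_def
proof (intro CollectI allI impI conjI)
  fix vs :: "'m cmat list" and i j
  assume vs: "length vs = n \<and> set vs \<subseteq> V"
  {
    assume i: "i < n"
    have p: "[:coord_u l (x + y), coord_v l (x + y):] = [:coord_u l x, coord_v l x:] + [:coord_u l y, coord_v l y:]"
      "[:coord_u l (mscale c x), coord_v l (mscale c x):] = smult c [:coord_u l x, coord_v l x:]" for l x y c
      by (simp_all add: coords_linear)
    show "linear_on mscale (*) V (\<lambda>x. binary_form k (vs[i := x]))"
      using vs i by (simp only: linear_on_def binary_form_update p distrib_right mult_smult_left coeff_add coeff_smult
          sum.distrib sum_distrib_left) simp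
  next
    assume i: "i < n" and j: "j < n" and ij: "i \<noteq> j \<and> vs ! i = vs ! j"
    have "Determinant.det (coord_mat vs) = 0"
      by (rule Determinant.det_identical_columns[OF coord_mat_carrier, of i j])
         (use i j ij in \<open>auto simp: coord_mat_def intro!: eq_vecI\<close>)
    then show "binary_form k vs = 0" by (simp add: binary_form_def)
  }
qed

end

context levi_frame
begin

text \<open>For g \<otimes> K the coordinate matrix is the constant matrix of K times the old one
  with s and t replaced by \<open>[:g11, g21:]\<close> and \<open>[:g12, g22:]\<close>. The
  determinant of the first is the scalar \<kappa>; the second is covered by
  \<open>homogenize_det\<close>.\<close>

lemma G0_binary_form:
  assumes \<phi>: "\<phi> \<in> G0"
  obtains \<kappa> g11 g12 g21 g22 where
    "\<And>k ws. length ws = n \<Longrightarrow> set ws \<subseteq> W \<Longrightarrow> binary_form k (map \<phi> ws) =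
        \<kappa> * (\<Sum>j\<le>n. coeff ([:g11, g21:] ^ (n - j) * [:g12, g22:] ^ j) k * binary_form j ws)"
proof -
  obtain K g11 g12 g21 g22 where K: "linear_on_U K" and
    eq: "\<And>a b. a \<in> U \<Longrightarrow> b \<in> U \<Longrightarrow> \<phi> (u \<bowtie> a + v \<bowtie> b) =
        u \<bowtie> (g11 *s K a + g12 *s K b) + v \<bowtie> (g21 *s K a + g22 *s K b)"
    by (rule G0_tensor[OF \<phi>]) (rule that)
  define KM where "KM = Matrix.mat n n (\<lambda>(i, l). [:e i \<star> K (e l):])"
  have "degree (Determinant.det KM) \<le> 0 * n"
    by (rule degree_det_le) (auto simp: KM_def)
  then have "degree (Determinant.det KM) = 0" by simp
  then obtain \<kappa> where \<kappa>: "Determinant.det KM = [:\<kappa>:]" by (rule degree_eq_zeroE)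
  have Ka: "e i \<star> K a = (\<Sum>l<n. (e i \<star> K (e l)) * (e l \<star> a))" if "a \<in> U" for i a
    unfolding cdot_commute[of "e i" "K x" for x]
    by (subst linear_on_U_expand[OF K that]) (simp add: cdot_sum_left mult.commute)
  have "binary_form k (map \<phi> ws) = \<kappa> * (\<Sum>j\<le>n. coeff ([:g11, g21:] ^ (n - j) * [:g12, g22:] ^ j) k * binary_form j ws)"
    if len: "length ws = n" and ws: "set ws \<subseteq> W" for k ws
  proof -
    define N where "N = Matrix.mat n n (\<lambda>(l, j). smult (coord_u l (ws ! j)) [:g11, g21:] + smult (coord_v l (ws ! j)) [:g12, g22:])"
    have "coord_mat (map \<phi> ws) = KM * N"
    proof (rule eq_matI)
      show "dim_row (coord_mat (map \<phi> ws)) = dim_row (KM * N)" "dim_col (coord_mat (map \<phi> ws)) = dim_col (KM * N)"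
        by (simp_all add: coord_mat_def KM_def N_def)
      fix i j assume "i < dim_row (KM * N)" "j < dim_col (KM * N)"
      then have ij: "i < n" "j < n" by (simp_all add: KM_def N_def)
      have "ws ! j \<in> W" using ws len ij by auto
      then obtain a b where ab: "a \<in> U" "b \<in> U" "ws ! j = u \<bowtie> a + v \<bowtie> b" unfolding W_def by blast
      have KU: "K a \<in> U" "K b \<in> U" using linear_on_UD(1)[OF K] ab by blast+
      have "coord_mat (map \<phi> ws) $$ (i, j) =
          [:g11 * (e i \<star> K a) + g12 * (e i \<star> K b), g21 * (e i \<star> K a) + g22 * (e i \<star> K b):]"
        using ij len ab KU by (simp add: coord_mat_def eq U_closed)
      also have "\<dots> = (\<Sum>l<n. [:e i \<star> K (e l):] * (smult (e l \<star> a) [:g11, g21:] + smult (e l \<star> b) [:g12, g22:]))"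
        unfolding Ka[OF ab(1)] Ka[OF ab(2)]
        by (intro poly_eqI) (simp add: coeff_sum coeff_pCons sum_distrib_left sum.distrib algebra_simps split: nat.split)
      also have "\<dots> = (KM * N) $$ (i, j)"
        using ij ab by (simp add: KM_def N_def scalar_prod_def lessThan_atLeast0)
      finally show "coord_mat (map \<phi> ws) $$ (i, j) = (KM * N) $$ (i, j)" .
    qed
    then have "Determinant.det (coord_mat (map \<phi> ws)) = [:\<kappa>:] * Determinant.det N"
      using det_mult[of KM n N] \<kappa> by (simp add: KM_def N_def)
    also have "Determinant.det N = homogenize n (Determinant.det (coord_mat ws)) [:g11, g21:] [:g12, g22:]"
      unfolding N_def coord_mat_def by (rule homogenize_det)
    finally show ?thesis
      by (simp add: binary_form_def homogenize_def coeff_sum mult.commute)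
  qed
  then show ?thesis using that by blast
qed

end

section \<open>The invariant quadratic form\<close>

lemma alt_formsD:
  assumes "\<alpha> \<in> alt_forms k V" "length vs = k" "set vs \<subseteq> V"
  shows "i < k \<Longrightarrow> x \<in> V \<Longrightarrow> y \<in> V \<Longrightarrow> \<alpha> (vs[i := x + y]) = \<alpha> (vs[i := x]) + \<alpha> (vs[i := y])"
    "i < k \<Longrightarrow> x \<in> V \<Longrightarrow> \<alpha> (vs[i := mscale c x]) = c * \<alpha> (vs[i := x])"
    "i < k \<Longrightarrow> j < k \<Longrightarrow> i \<noteq> j \<Longrightarrow> vs ! i = vs ! j \<Longrightarrow> \<alpha> vs = 0"
  using assms unfolding alt_forms_def linear_on_def by blast+

lemma alt_formsI:
  assumes "\<And>vs i x y. length vs = k \<Longrightarrow> set vs \<subseteq> V \<Longrightarrow> i < k \<Longrightarrow> x \<in> V \<Longrightarrow> y \<in> V \<Longrightarrow>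
      \<alpha> (vs[i := x + y]) = \<alpha> (vs[i := x]) + \<alpha> (vs[i := y])"
    "\<And>vs i x c. length vs = k \<Longrightarrow> set vs \<subseteq> V \<Longrightarrow> i < k \<Longrightarrow> x \<in> V \<Longrightarrow> \<alpha> (vs[i := mscale c x]) = c * \<alpha> (vs[i := x])"
    "\<And>vs i j. length vs = k \<Longrightarrow> set vs \<subseteq> V \<Longrightarrow> i < k \<Longrightarrow> j < k \<Longrightarrow> i \<noteq> j \<Longrightarrow> vs ! i = vs ! j \<Longrightarrow> \<alpha> vs = 0"
  shows "\<alpha> \<in> alt_forms k V"
  using assms unfolding alt_forms_def linear_on_def by blast

lemma set_update_subset: "set vs \<subseteq> V \<Longrightarrow> x \<in> V \<Longrightarrow> set (vs[i := x]) \<subseteq> V"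
  using set_update_subset_insert by fastforce

text \<open>\<open>alt_forms\<close> leaves the values on all other lists free; this lets a form be
  replaced by one that agrees with it on the lists that count.\<close>

lemma alt_forms_cong:
  assumes V: "cmat.subspace V" and eq: "\<And>vs. length vs = k \<Longrightarrow> set vs \<subseteq> V \<Longrightarrow> \<alpha> vs = \<beta> vs"
    and \<alpha>: "\<alpha> \<in> alt_forms k V"
  shows "\<beta> \<in> alt_forms k V"
proof (rule alt_formsI)
  fix vs i x y c assume vs: "length vs = k" "set vs \<subseteq> V" "i < k" "x \<in> V"
  have eq': "\<beta> (vs[i := z]) = \<alpha> (vs[i := z])" if "z \<in> V" for z
    using eq[of "vs[i := z]"] vs(1) set_update_subset[OF vs(2) that] by simp
  show "y \<in> V \<Longrightarrow> \<beta> (vs[i := x + y]) = \<beta> (vs[i := x]) + \<beta> (vs[i := y])"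
    using alt_formsD(1)[OF \<alpha> vs, of y] vs(4) cmat.subspace_add[OF V vs(4), of y] by (simp add: eq')
  show "\<beta> (vs[i := mscale c x]) = c * \<beta> (vs[i := x])"
    using alt_formsD(2)[OF \<alpha> vs, of c] vs(4) cmat.subspace_scale[OF V vs(4), of c] by (simp add: eq')
next
  fix vs i j assume "length vs = k" "set vs \<subseteq> V" "i < k" "j < k" "i \<noteq> j" "vs ! i = vs ! j"
  then show "\<beta> vs = 0" using alt_formsD(3)[OF \<alpha>, of vs i j] eq by simp
qed

lemma alt_forms_lincomb:
  assumes "\<And>j. j \<in> J \<Longrightarrow> \<alpha> j \<in> alt_forms k V"
  shows "(\<lambda>vs. \<Sum>j\<in>J. c j * \<alpha> j vs) \<in> alt_forms k V"
proof (rule alt_formsI)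
  fix vs i x y d assume vs: "length vs = k" "set vs \<subseteq> V" "i < k" "x \<in> V"
  show "(\<Sum>j\<in>J. c j * \<alpha> j (vs[i := x + y])) = (\<Sum>j\<in>J. c j * \<alpha> j (vs[i := x])) + (\<Sum>j\<in>J. c j * \<alpha> j (vs[i := y]))"
    if "y \<in> V"
    unfolding sum.distrib[symmetric]
    by (intro sum.cong refl) (simp add: alt_formsD(1)[OF assms vs that] distrib_left)
  show "(\<Sum>j\<in>J. c j * \<alpha> j (vs[i := mscale d x])) = d * (\<Sum>j\<in>J. c j * \<alpha> j (vs[i := x]))"
    unfolding sum_distrib_left
    by (intro sum.cong refl) (simp add: alt_formsD(2)[OF assms vs])
next
  fix vs i j assume "length vs = k" "set vs \<subseteq> V" "i < k" "j < k" "i \<noteq> j" "vs ! i = vs ! j"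
  then show "(\<Sum>j\<in>J. c j * \<alpha> j vs) = 0"
    by (intro sum.neutral ballI) (simp add: alt_formsD(3)[OF assms, of _ vs i j])
qed

lemma alt_forms_map:
  assumes \<alpha>: "\<alpha> \<in> alt_forms k V" and lin: "linear_on mscale mscale V \<phi>" and V: "\<And>x. x \<in> V \<Longrightarrow> \<phi> x \<in> V"
  shows "(\<lambda>vs. \<alpha> (map \<phi> vs)) \<in> alt_forms k V"
proof (rule alt_formsI)
  fix vs i x y c assume vs: "length vs = k" "set vs \<subseteq> V" "i < k" "x \<in> V"
  have m: "length (map \<phi> vs) = k" "set (map \<phi> vs) \<subseteq> V" using vs V by auto
  show "\<alpha> (map \<phi> (vs[i := x + y])) = \<alpha> (map \<phi> (vs[i := x])) + \<alpha> (map \<phi> (vs[i := y]))" if "y \<in> V"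
    using lin vs that alt_formsD(1)[OF \<alpha> m vs(3) V V, of x y] by (simp add: map_update linear_on_def)
  show "\<alpha> (map \<phi> (vs[i := mscale c x])) = c * \<alpha> (map \<phi> (vs[i := x]))"
    using lin vs alt_formsD(2)[OF \<alpha> m vs(3) V, of x c] by (simp add: map_update linear_on_def)
next
  fix vs i j assume vs: "length vs = k" "set vs \<subseteq> V" "i < k" "j < k" "i \<noteq> j" "vs ! i = vs ! j"
  have m: "length (map \<phi> vs) = k" "set (map \<phi> vs) \<subseteq> V" using vs V by auto
  show "\<alpha> (map \<phi> vs) = 0"
    using alt_formsD(3)[OF \<alpha> m vs(3,4,5)] vs by simp
qed

section \<open>Elements of exterior powers and induced maps\<close>

lemma subspace_ext_power: "cfun.subspace (ext_power k V)"
  unfolding ext_power_def by (rule cfun.subspace_span)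

lemma ext_power_induct [consumes 1, case_names wedge zero add scale]:
  assumes "\<xi> \<in> ext_power k V"
    and "\<And>vs. length vs = k \<Longrightarrow> set vs \<subseteq> V \<Longrightarrow> Q (wedge k V vs)"
    and "Q 0" "\<And>x y. Q x \<Longrightarrow> Q y \<Longrightarrow> Q (x + y)" "\<And>c x. Q x \<Longrightarrow> Q (fscale c x)"
  shows "Q \<xi>"
proof -
  have "cfun.subspace {\<xi>. Q \<xi>}"
    using assms(3-5) by (intro cfun.subspaceI) auto
  then show ?thesis
    using assms(1,2) cfun.span_minimal[of "{wedge k V vs |vs. length vs = k \<and> set vs \<subseteq> V}" "{\<xi>. Q \<xi>}"]
    unfolding ext_power_def by blast
qed

lemma ext_power_not_alt: "\<xi> \<in> ext_power k V \<Longrightarrow> \<alpha> \<notin> alt_forms k V \<Longrightarrow> \<xi> \<alpha> = 0"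
  by (induction rule: ext_power_induct) (simp_all add: wedge_def fscale_def)

lemma ext_power_cong:
  assumes "\<xi> \<in> ext_power k V" and V: "cmat.subspace V" and eq: "\<And>vs. length vs = k \<Longrightarrow> set vs \<subseteq> V \<Longrightarrow> \<alpha> vs = \<beta> vs"
  shows "\<xi> \<alpha> = \<xi> \<beta>"
proof -
  have "\<alpha> \<in> alt_forms k V \<longleftrightarrow> \<beta> \<in> alt_forms k V"
    using alt_forms_cong[OF V, of k \<alpha> \<beta>] alt_forms_cong[OF V, of k \<beta> \<alpha>] eq by metis
  with assms(1) show ?thesis
    by (induction rule: ext_power_induct) (use eq in \<open>simp_all add: wedge_def fscale_def\<close>)
qed

lemma ext_power_lincomb:
  assumes "\<xi> \<in> ext_power k V" and \<alpha>: "\<And>j. j \<in> J \<Longrightarrow> \<alpha> j \<in> alt_forms k V"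
  shows "\<xi> (\<lambda>vs. \<Sum>j\<in>J. c j * \<alpha> j vs) = (\<Sum>j\<in>J. c j * \<xi> (\<alpha> j))"
  using assms(1)
proof (induction rule: ext_power_induct)
  case (wedge vs)
  have "(\<lambda>vs. \<Sum>j\<in>J. c j * \<alpha> j vs) \<in> alt_forms k V" by (rule alt_forms_lincomb[OF \<alpha>])
  then show ?case using \<alpha> by (simp add: wedge_def)
qed (simp_all add: sum.distrib distrib_left fscale_def sum_distrib_left mult_ac)

lemma ext_map_ext_power:
  assumes "\<xi> \<in> ext_power k V" and lin: "linear_on mscale mscale V \<phi>" and V: "\<And>x. x \<in> V \<Longrightarrow> \<phi> x \<in> V"
  shows "ext_map k V \<phi> \<xi> \<in> ext_power k V"
  using assms(1)
proof (induction rule: ext_power_induct)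
  case (wedge vs)
  have "ext_map k V \<phi> (wedge k V vs) = wedge k V (map \<phi> vs)"
    using alt_forms_map[OF _ lin V] by (auto simp: ext_map_def wedge_def fun_eq_iff)
  moreover have "length (map \<phi> vs) = k \<and> set (map \<phi> vs) \<subseteq> V" using wedge V by auto
  ultimately show ?case unfolding ext_power_def by (metis (mono_tags, lifting) cfun.span_base mem_Collect_eq)
next
  case zero
  have "ext_map k V \<phi> 0 = 0" by (simp add: ext_map_def fun_eq_iff)
  then show ?case using cfun.subspace_0[OF subspace_ext_power] by metis
next
  case (add x y)
  have "ext_map k V \<phi> (x + y) = ext_map k V \<phi> x + ext_map k V \<phi> y" by (simp add: ext_map_def fun_eq_iff)
  then show ?case using cfun.subspace_add[OF subspace_ext_power add] by (simp only:)
next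
  case (scale c x)
  have "ext_map k V \<phi> (fscale c x) = fscale c (ext_map k V \<phi> x)" by (simp add: ext_map_def fun_eq_iff fscale_def)
  then show ?case using cfun.subspace_scale[OF subspace_ext_power scale] by simp
qed

lemma ext_map_compose:
  assumes \<xi>: "\<xi> \<in> ext_power k V" and "cmat.subspace V"
    and lin: "linear_on mscale mscale V \<phi>" and V: "\<And>x. x \<in> V \<Longrightarrow> \<phi> x \<in> V" "\<And>x. x \<in> V \<Longrightarrow> \<psi> x \<in> V"
    and comp: "\<And>x. x \<in> V \<Longrightarrow> \<theta> x = \<phi> (\<psi> x)"
  shows "ext_map k V \<theta> \<xi> = ext_map k V \<phi> (ext_map k V \<psi> \<xi>)"
proof
  fix \<alpha>
  have "\<xi> (\<lambda>vs. \<alpha> (map \<theta> vs)) = \<xi> (\<lambda>vs. \<alpha> (map \<phi> (map \<psi> vs)))"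
  proof (rule ext_power_cong[OF \<xi> assms(2)])
    fix vs assume "length vs = k" "set vs \<subseteq> V"
    then have "map \<theta> vs = map \<phi> (map \<psi> vs)" using comp by auto
    then show "\<alpha> (map \<theta> vs) = \<alpha> (map \<phi> (map \<psi> vs))" by (simp only:)
  qed
  then show "ext_map k V \<theta> \<xi> \<alpha> = ext_map k V \<phi> (ext_map k V \<psi> \<xi>) \<alpha>"
    using alt_forms_map[OF _ lin V(1), of \<alpha> k] by (simp add: ext_map_def)
qed

lemma ext_map_ident:
  assumes \<xi>: "\<xi> \<in> ext_power k V" and "cmat.subspace V" and "\<And>x. x \<in> V \<Longrightarrow> \<phi> x = x"
  shows "ext_map k V \<phi> \<xi> = \<xi>"
proof
  fix \<alpha>
  have "\<xi> (\<lambda>vs. \<alpha> (map \<phi> vs)) = \<xi> \<alpha>"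
  proof (rule ext_power_cong[OF \<xi> assms(2)])
    fix vs assume "length vs = k" "set vs \<subseteq> V"
    then have "map \<phi> vs = vs" using assms(3) by (intro map_idI) auto
    then show "\<alpha> (map \<phi> vs) = \<alpha> vs" by simp
  qed
  then show "ext_map k V \<phi> \<xi> \<alpha> = \<xi> \<alpha>"
    using ext_power_not_alt[OF \<xi>] by (simp add: ext_map_def)
qed

lemma sum_apply: "(\<Sum>k\<in>K. F k) x = (\<Sum>k\<in>K. F k x)" for F :: "'k \<Rightarrow> 'x \<Rightarrow> complex"
  by (induction K rule: infinite_finite_induct) simp_all

lemma subspace_pluecker_space: "cfun.subspace (pluecker_space n gr)"
  unfolding pluecker_space_def
  by (rule cfun.subspaceI) (auto simp: contraction_def fscale_def[of _ _] cfun.subspace_0[OF subspace_ext_power]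
    intro: cfun.subspace_add[OF subspace_ext_power] cfun.subspace_scale[OF subspace_ext_power, unfolded fscale_def])

section \<open>The transvectant on the Pluecker space\<close>

context levi_frame
begin

abbreviation V where "V \<equiv> pluecker_space n gr"

text \<open>Classically, up to a constant, the n-th transvectant of the binary form of \<xi> with
  itself; it is identically zero for odd n. Off \<open>V\<close> it is 0 because elements of
  \<open>sym_power_dual\<close> are.\<close>

definition transvectant :: "(('m cmat list \<Rightarrow> complex) \<Rightarrow> complex) \<Rightarrow> complex" where
  "transvectant \<xi> = (if \<xi> \<in> V then apolar n (\<lambda>k. \<xi> (binary_form k)) (\<lambda>k. \<xi> (binary_form k)) else 0)"

lemma transvectant_quadratic: "transvectant \<in> sym_power_dual 2 V"
proof -
  define l where "l k = (\<lambda>\<xi>. if \<xi> \<in> V then \<xi> (binary_form k) else 0)" for k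
  have l: "l k \<in> dual_space fscale V" for k
    using subspace_pluecker_space[of n gr]
    by (auto simp: dual_space_def linear_on_def l_def cfun.subspace_def, simp add: fscale_def)
  define m where "m k = (\<lambda>\<xi>. if \<xi> \<in> V then \<Prod>i<2::nat. (if i = 0 then l (n - k) else l k) \<xi> else 0)" for k
  have "m k \<in> sym_power_dual 2 V" for k
    unfolding sym_power_dual_def m_def using l
    by (intro cfun.span_base CollectI exI[of _ "\<lambda>i::nat. if i = 0 then l (n - k) else l k"]) auto
  then have "(\<Sum>k\<le>n. fscale ((-1) ^ k * fact k * fact (n - k)) (m k)) \<in> sym_power_dual 2 V"
    unfolding sym_power_dual_def by (intro cfun.span_sum cfun.span_scale) auto
  also have "(\<Sum>k\<le>n. fscale ((-1) ^ k * fact k * fact (n - k)) (m k)) = transvectant"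
  proof
    fix \<xi>
    show "(\<Sum>k\<le>n. fscale ((-1) ^ k * fact k * fact (n - k)) (m k)) \<xi> = transvectant \<xi>"
      unfolding sum_apply
      by (cases "\<xi> \<in> V") (simp_all add: m_def l_def fscale_def transvectant_def apolar_def lessThan_Suc numeral_2_eq_2 mult_ac)
  qed
  finally show ?thesis .
qed

lemma G0_linear: "\<phi> \<in> G0 \<Longrightarrow> linear_on mscale mscale (gr i) \<phi>"
  using Aut_so_D(2,3)[OF G0_Aut] gr_so unfolding linear_on_def by blast

lemma V_ext_power: "\<xi> \<in> V \<Longrightarrow> \<xi> \<in> ext_power n (gr (-1))"
  by (simp add: pluecker_space_def)

text \<open>\<phi> respects brackets, so l [\<phi> x, \<phi> y] = (l \<circ> \<phi>) [x, y]. The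
  form l \<circ> \<phi> is cut off outside \<open>gr (-2)\<close> so as to belong to
  \<open>dual_space\<close>.\<close>

lemma wedge_2form_map:
  assumes \<phi>: "\<phi> \<in> G0" and vs: "set vs \<subseteq> gr (-1)"
  shows "wedge_2form (\<lambda>x y. l (lie x y)) \<beta> (map \<phi> vs) =
    wedge_2form (\<lambda>x y. (if lie x y \<in> gr (-2) then l (\<phi> (lie x y)) else 0)) (\<lambda>vs. \<beta> (map \<phi> vs)) vs"
  unfolding wedge_2form_def length_map
proof (intro sum.cong refl)
  fix i j assume "j \<in> {..<length vs}" "i \<in> {..<j}"
  then have ij: "i < length vs" "j < length vs" by auto
  then have m: "vs ! i \<in> gr (-1)" "vs ! j \<in> gr (-1)" using vs by auto
  then have "lie (vs ! i) (vs ! j) \<in> gr (-2)" using gr_lie by fastforce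
  moreover have "\<phi> (lie (vs ! i) (vs ! j)) = lie (\<phi> (vs ! i)) (\<phi> (vs ! j))"
    using Aut_so_D(4)[OF G0_Aut[OF \<phi>]] m gr_so by blast
  ultimately show "(- 1) ^ (i + j + 1) * l (lie (map \<phi> vs ! i) (map \<phi> vs ! j)) * \<beta> (nths (map \<phi> vs) (- {i, j})) =
      (- 1) ^ (i + j + 1) * (if lie (vs ! i) (vs ! j) \<in> gr (-2) then l (\<phi> (lie (vs ! i) (vs ! j))) else 0) *
      \<beta> (map \<phi> (nths vs (- {i, j})))"
    using ij by (simp add: nths_map)
qed

text \<open>Contracting the image of \<xi> with l and \<beta> amounts to contracting \<xi> with l
  and \<beta> pulled back along \<phi>.\<close>

lemma G0_V:
  assumes \<phi>: "\<phi> \<in> G0" and \<xi>: "\<xi> \<in> V"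
  shows "ext_map n (gr (-1)) \<phi> \<xi> \<in> V"
  unfolding pluecker_space_def
proof (intro CollectI conjI ballI)
  show "ext_map n (gr (-1)) \<phi> \<xi> \<in> ext_power n (gr (-1))"
    by (rule ext_map_ext_power[OF V_ext_power[OF \<xi>] G0_linear[OF \<phi>] G0_grading[OF \<phi>]])
  fix l \<beta> assume l: "l \<in> dual_space mscale (gr (-2))" and \<beta>: "\<beta> \<in> alt_forms (n - 2) (gr (-1))"
  define l' where "l' = (\<lambda>x. if x \<in> gr (-2) then l (\<phi> x) else 0)"
  have l': "l' \<in> dual_space mscale (gr (-2))"
    using l G0_linear[OF \<phi>, of "-2"] G0_grading[OF \<phi>, of _ "-2"] gr_closed(1,3)[of _ "-2"]
    by (auto simp: dual_space_def linear_on_def l'_def)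
  have \<beta>': "(\<lambda>vs. \<beta> (map \<phi> vs)) \<in> alt_forms (n - 2) (gr (-1))"
    by (rule alt_forms_map[OF \<beta> G0_linear[OF \<phi>] G0_grading[OF \<phi>]])
  have "\<xi> (\<lambda>vs. wedge_2form (\<lambda>x y. l (lie x y)) \<beta> (map \<phi> vs)) =
      \<xi> (wedge_2form (\<lambda>x y. l' (lie x y)) (\<lambda>vs. \<beta> (map \<phi> vs)))"
    by (rule ext_power_cong[OF V_ext_power[OF \<xi>] gr_subspace]) (simp add: wedge_2form_map[OF \<phi>] l'_def)
  also have "\<dots> = 0"
    using \<xi> l' \<beta>' unfolding pluecker_space_def contraction_def by blast
  finally show "contraction (ext_map n (gr (-1)) \<phi> \<xi>) l \<beta> = 0"
    by (simp add: contraction_def ext_map_def)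
qed

text \<open>The scalar is \<kappa>^2 det(g)^n: one \<kappa> from each argument of the pairing, the
  determinant from \<open>apolar_substitute\<close>.\<close>

lemma G0_transvectant:
  assumes \<phi>: "\<phi> \<in> G0"
  obtains c where "\<And>\<xi>. \<xi> \<in> V \<Longrightarrow> transvectant (ext_map n (gr (-1)) \<phi> \<xi>) = c * transvectant \<xi>"
proof -
  obtain \<kappa> g11 g12 g21 g22 where eq:
    "\<And>k ws. length ws = n \<Longrightarrow> set ws \<subseteq> W \<Longrightarrow> binary_form k (map \<phi> ws) =
        \<kappa> * (\<Sum>j\<le>n. coeff ([:g11, g21:] ^ (n - j) * [:g12, g22:] ^ j) k * binary_form j ws)"
    by (rule G0_binary_form[OF \<phi>]) (rule that)
  let ?S = "[:g11, g21:]" and ?T = "[:g12, g22:]"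
  have "transvectant (ext_map n (gr (-1)) \<phi> \<xi>) = (\<kappa> * \<kappa> * (g11 * g22 - g12 * g21) ^ n) * transvectant \<xi>"
    if \<xi>: "\<xi> \<in> V" for \<xi>
  proof -
    let ?p = "\<lambda>k. \<xi> (binary_form k)"
    have "ext_map n (gr (-1)) \<phi> \<xi> (binary_form k) = \<kappa> * substitute n ?S ?T ?p k" for k
    proof -
      have "\<xi> (\<lambda>vs. binary_form k (map \<phi> vs)) =
          \<xi> (\<lambda>vs. \<Sum>j\<le>n. (\<kappa> * coeff (?S ^ (n - j) * ?T ^ j) k) * binary_form j vs)"
        by (rule ext_power_cong[OF V_ext_power[OF \<xi>] gr_subspace])
           (simp only: gr_m1 eq sum_distrib_left mult.assoc)
      also have "\<dots> = (\<Sum>j\<le>n. (\<kappa> * coeff (?S ^ (n - j) * ?T ^ j) k) * \<xi> (binary_form j))"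
        by (rule ext_power_lincomb[OF V_ext_power[OF \<xi>] binary_form_alt])
      finally show ?thesis
        by (simp only: ext_map_def binary_form_alt if_True substitute_def sum_distrib_left mult.assoc)
    qed
    moreover have "apolar n (\<lambda>k. \<kappa> * p k) (\<lambda>k. \<kappa> * q k) = \<kappa> * \<kappa> * apolar n p q" for p q
      by (simp add: apolar_def sum_distrib_left mult_ac)
    ultimately show ?thesis
      using \<xi> G0_V[OF \<phi> \<xi>] by (simp add: transvectant_def apolar_substitute)
  qed
  then show ?thesis by (rule that)
qed

section \<open>A Lagrangian subspace where the transvectant is nonzero\<close>

definition split_basis :: "nat \<Rightarrow> 'm cmat" where
  "split_basis i = (if i < n div 2 then u else v) \<bowtie> e i"

definition split_list :: "'m cmat list" where
  "split_list = map split_basis [0..<n]"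

lemma split_basis_form:
  "split_basis i = u \<bowtie> (if i < n div 2 then e i else 0) + v \<bowtie> (if i < n div 2 then 0 else e i)"
  by (simp add: split_basis_def skew_simps)

lemma split_basis_W: "i < n \<Longrightarrow> split_basis i \<in> W"
  unfolding split_basis_form W_def
  by (rule CollectI, rule exI[of _ "if i < n div 2 then e i else 0"],
      rule exI[of _ "if i < n div 2 then 0 else e i"]) (simp add: U_closed(3))

lemma split_basis_coords:
  assumes "i < n" "j < n"
  shows "coord_u i (split_basis j) = (if i = j \<and> j < n div 2 then 1 else 0)"
    "coord_v i (split_basis j) = (if i = j \<and> \<not> j < n div 2 then 1 else 0)"
  using assms U_closed(3) unfolding split_basis_form by (subst coords; simp)+

lemma split_basis_isotropic:
  assumes "i < n" "j < n"
  shows "lie (split_basis i) (split_basis j) = 0"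
proof -
  have "lie (f \<bowtie> e i) (g \<bowtie> e j) = mscale (e i \<star> e j) (g \<bowtie> f)"
    if "f \<in> {u, v}" "g \<in> {u, v}" for f g
    using that assms by (auto simp: lie_skew skew_simps)
  then show ?thesis using assms by (auto simp: split_basis_def skew_simps)
qed

lemma split_list_binary_form:
  assumes "even n"
  shows "binary_form k split_list = (if k = n div 2 then 1 else 0)"
proof -
  have "n = n div 2 + n div 2" using assms by auto
  then obtain d where d: "n = d + d" "n div 2 = d" by blast
  \<comment> \<open>Each basis vector has a single nonzero coordinate, so the matrix is diagonal
    with d entries 1 and d entries t, of determinant t^d.\<close>
  have M: "coord_mat split_list = Matrix.mat n n (\<lambda>(i, j). if i = j then (if j < d then 1 else [:0, 1:]) else 0)"
    by (intro eq_matI) (auto simp: coord_mat_def split_list_def split_basis_coords d(2) pCons_one)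
  have "upper_triangular (coord_mat split_list)"
    unfolding M by auto
  then have "Determinant.det (coord_mat split_list) = prod_list (diag_mat (coord_mat split_list))"
    by (rule det_upper_triangular[OF _ coord_mat_carrier])
  also have "diag_mat (coord_mat split_list) = map (\<lambda>j. if j < d then 1 else [:0, 1:]) [0..<n]"
    unfolding M by (auto simp: diag_mat_def)
  also have "prod_list \<dots> = (\<Prod>j<n. if j < d then 1 else [:0, 1:])"
    by (subst prod.distinct_set_conv_list[symmetric]) (simp_all add: lessThan_atLeast0)
  also have "\<dots> = [:0, 1:] ^ d"
  proof -
    have "{..<n} \<inter> - {i. i < d} = {d..<n}" by auto
    then show ?thesis using d by (simp add: prod.If_cases)
  qed
  also have "\<dots> = monom 1 d"
    by (simp add: monom_altdef)
  finally show ?thesis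
    by (auto simp: binary_form_def d(2))
qed

lemma split_list_facts: "length split_list = n" "set split_list \<subseteq> gr (-1)"
  using split_basis_W gr_m1 by (auto simp: split_list_def)

text \<open>The contraction is a sum over pairs of vectors from the list, and all their brackets
  vanish.\<close>

lemma split_wedge_V: "wedge n (gr (-1)) split_list \<in> V"
  unfolding pluecker_space_def
proof (intro CollectI conjI ballI)
  show "wedge n (gr (-1)) split_list \<in> ext_power n (gr (-1))"
    unfolding ext_power_def using split_list_facts by (intro cfun.span_base) blast
  fix l \<beta> assume l: "l \<in> dual_space mscale (gr (-2))"
  have l0: "l 0 = 0"
  proof -
    have "l (mscale 0 0) = 0 * l 0" using l gr_closed(5) unfolding dual_space_def linear_on_def by blast
    then show ?thesis by simp
  qed
  have "wedge_2form (\<lambda>x y. l (lie x y)) \<beta> split_list = 0"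
    unfolding wedge_2form_def
    by (intro sum.neutral ballI) (simp add: split_list_def split_basis_isotropic l0)
  then show "contraction (wedge n (gr (-1)) split_list) l \<beta> = 0"
    by (simp add: contraction_def wedge_def)
qed

text \<open>The binary form is concentrated in degree d = n / 2, so only the middle term (-1)^d d!
  d! of the pairing remains.\<close>

lemma transvectant_nonzero:
  assumes "even n"
  shows "transvectant (wedge n (gr (-1)) split_list) \<noteq> 0"
proof -
  have "n = n div 2 + n div 2" using assms by auto
  then obtain d where d: "n = d + d" "n div 2 = d" by blast
  have "transvectant (wedge n (gr (-1)) split_list) =
      apolar n (\<lambda>k. binary_form k split_list) (\<lambda>k. binary_form k split_list)"
    using split_wedge_V by (simp add: transvectant_def wedge_def binary_form_alt)
  also have "\<dots> = (\<Sum>k\<le>n. if k = d then (-1) ^ d * fact d * fact d else 0)"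
    unfolding apolar_def split_list_binary_form[OF assms] d(2)
    by (intro sum.cong) (auto simp: d(1))
  finally show ?thesis by (simp add: d(1))
qed

lemma split_span_LGr: "cmat.span (split_basis ` {..<n}) \<in> LGr n gr"
proof -
  let ?B = "split_basis ` {..<n}"
  \<comment> \<open>A coordinate functional dual to each basis vector yields both injectivity and
    independence.\<close>
  have coord: "\<exists>f. f (split_basis i) = 1 \<and> (\<forall>j<n. j \<noteq> i \<longrightarrow> f (split_basis j) = 0) \<and>
      (\<forall>x y. f (x + y) = f x + f y) \<and> (\<forall>c x. f (mscale c x) = c * f x)" if "i < n" for i
  proof (cases "i < n div 2")
    case True
    then show ?thesis using that by (intro exI[of _ "coord_u i"]) (auto simp: split_basis_coords coords_linear)
  next
    case False
    then show ?thesis using that by (intro exI[of _ "coord_v i"]) (auto simp: split_basis_coords coords_linear)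
  qed
  have inj: "inj_on split_basis {..<n}"
  proof (rule inj_onI)
    fix i j assume "i \<in> {..<n}" "j \<in> {..<n}" "split_basis i = split_basis j"
    then show "i = j" using coord[of i] by (metis lessThan_iff zero_neq_one)
  qed
  have "cmat.independent ?B"
    unfolding cmat.dependent_def
  proof
    assume "\<exists>a\<in>?B. a \<in> cmat.span (?B - {a})"
    then obtain i where i: "i < n" "split_basis i \<in> cmat.span (?B - {split_basis i})" by auto
    obtain f where f: "f (split_basis i) = 1" "\<And>j. j < n \<Longrightarrow> j \<noteq> i \<Longrightarrow> f (split_basis j) = 0"
      "\<And>x y. f (x + y) = f x + f y" "\<And>c x. f (mscale c x) = c * f x" using coord[OF i(1)] by blast
    have "f 0 = 0" using f(4)[of 0 0] by simp
    then have "cmat.subspace {x. f x = 0}" using f(3,4) by (intro cmat.subspaceI) auto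
    moreover have "?B - {split_basis i} \<subseteq> {x. f x = 0}" using f(2) by auto
    ultimately have "f (split_basis i) = 0" using i(2) cmat.span_minimal by blast
    then show False using f(1) by simp
  qed
  then have "cmat.dim (cmat.span ?B) = n"
    using inj by (simp add: cmat.dim_eq_card_independent card_image)
  moreover have "cmat.span ?B \<subseteq> gr (-1)"
    using split_basis_W gr_m1 by (intro cmat.span_minimal gr_subspace) auto
  moreover have "lie x y = 0" if "x \<in> cmat.span ?B" "y \<in> cmat.span ?B" for x y
  proof -
    have "cmat.subspace {x. \<forall>i<n. lie x (split_basis i) = 0}"
      by (rule cmat.subspaceI) (simp_all add: lie_simps)
    then have "cmat.span ?B \<subseteq> {x. \<forall>i<n. lie x (split_basis i) = 0}"
      by (intro cmat.span_minimal) (auto simp: split_basis_isotropic)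
    then have x: "\<forall>i<n. lie x (split_basis i) = 0" using that(1) by blast
    have "cmat.subspace {y. lie x y = 0}"
      by (rule cmat.subspaceI) (simp_all add: lie_simps)
    then have "cmat.span ?B \<subseteq> {y. lie x y = 0}"
      using x by (intro cmat.span_minimal) auto
    then show ?thesis using that(2) by blast
  qed
  ultimately show ?thesis unfolding LGr_def by (simp add: cmat.subspace_span)
qed

lemma transvectant_not_ideal:
  assumes "even n"
  shows "transvectant \<notin> LGr_ideal n gr 2"
proof
  assume "transvectant \<in> LGr_ideal n gr 2"
  moreover have "wedge n (gr (-1)) split_list \<in> pluecker n (gr (-1)) (cmat.span (split_basis ` {..<n}))"
    unfolding pluecker_def using split_list_facts(1)
    by (intro cfun.span_base CollectI exI[of _ split_list]) (auto simp: split_list_def intro: cmat.span_base)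
  ultimately have "transvectant (wedge n (gr (-1)) split_list) = 0"
    using split_span_LGr unfolding LGr_ideal_def by blast
  then show False using transvectant_nonzero[OF assms] by blast
qed

section \<open>Invariance under commutators\<close>

definition kernel :: "('m cmat \<Rightarrow> 'm cmat) set" where
  "kernel = {\<phi> \<in> G0. \<forall>\<xi>\<in>V. transvectant (ext_map n (gr (-1)) \<phi> \<xi>) = transvectant \<xi>}"

lemma ext_map_mult:
  assumes "\<phi> \<in> G0" "\<psi> \<in> G0" "\<xi> \<in> V"
  shows "ext_map n (gr (-1)) (\<phi> \<otimes>\<^bsub>Perm_so\<^esub> \<psi>) \<xi> = ext_map n (gr (-1)) \<phi> (ext_map n (gr (-1)) \<psi> \<xi>)"
proof (rule ext_map_compose[OF V_ext_power[OF assms(3)] gr_subspace G0_linear[OF assms(1)]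
      G0_grading[OF assms(1)] G0_grading[OF assms(2)]])
  fix x assume "x \<in> gr (-1)"
  moreover have "\<phi> \<in> Bij so" "\<psi> \<in> Bij so" using assms G0_Aut Aut_so_Bij by blast+
  ultimately show "(\<phi> \<otimes>\<^bsub>Perm_so\<^esub> \<psi>) x = \<phi> (\<psi> x)"
    using gr_so by (simp add: Perm_so_simps compose_eq)
qed

lemma ext_map_inv:
  assumes "\<phi> \<in> G0" "\<xi> \<in> V"
  shows "ext_map n (gr (-1)) \<phi> (ext_map n (gr (-1)) (inv\<^bsub>Perm_so\<^esub> \<phi>) \<xi>) = \<xi>"
proof -
  interpret group Perm_so by (rule group_BijGroup)
  have "\<phi> \<in> carrier Perm_so" using subgroup.subset[OF G0_subgroup] assms by blast
  then have "\<phi> \<otimes>\<^bsub>Perm_so\<^esub> inv\<^bsub>Perm_so\<^esub> \<phi> = \<one>\<^bsub>Perm_so\<^esub>" by (rule r_inv)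
  then have "ext_map n (gr (-1)) \<phi> (ext_map n (gr (-1)) (inv\<^bsub>Perm_so\<^esub> \<phi>) \<xi>) = ext_map n (gr (-1)) \<one>\<^bsub>Perm_so\<^esub> \<xi>"
    using ext_map_mult[OF assms(1) G0_inv[OF assms(1)] assms(2)] by simp
  also have "\<dots> = \<xi>"
    by (rule ext_map_ident[OF V_ext_power[OF assms(2)] gr_subspace]) (use gr_so in \<open>simp add: BijGroup_def\<close>)
  finally show ?thesis .
qed

lemma kernel_inv:
  assumes "\<phi> \<in> kernel"
  shows "inv\<^bsub>Perm_so\<^esub> \<phi> \<in> kernel"
proof -
  have \<phi>: "\<phi> \<in> G0" using assms by (simp add: kernel_def)
  show ?thesis
    unfolding kernel_def
  proof (intro CollectI conjI ballI)
    show inv: "inv\<^bsub>Perm_so\<^esub> \<phi> \<in> G0" by (rule G0_inv[OF \<phi>])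
    fix \<xi> assume \<xi>: "\<xi> \<in> V"
    show "transvectant (ext_map n (gr (-1)) (inv\<^bsub>Perm_so\<^esub> \<phi>) \<xi>) = transvectant \<xi>"
      using assms G0_V[OF inv \<xi>] ext_map_inv[OF \<phi> \<xi>] unfolding kernel_def by force
  qed
qed

lemma kernel_mult:
  assumes "\<phi> \<in> kernel" "\<psi> \<in> kernel"
  shows "\<phi> \<otimes>\<^bsub>Perm_so\<^esub> \<psi> \<in> kernel"
  using assms subgroup.m_closed[OF G0_subgroup] unfolding kernel_def
  by (auto simp: ext_map_mult G0_V)

text \<open>\<open>G0\<close> only scales the transvectant, and scalars commute. \<open>c'\<close>
  and \<open>d'\<close> cancel the scalars of \<phi> and \<psi> through the inverse elements,
  without division.\<close>

lemma kernel_commutator: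
  assumes \<phi>: "\<phi> \<in> G0" and \<psi>: "\<psi> \<in> G0"
  shows "\<phi> \<otimes>\<^bsub>Perm_so\<^esub> \<psi> \<otimes>\<^bsub>Perm_so\<^esub> inv\<^bsub>Perm_so\<^esub> \<phi> \<otimes>\<^bsub>Perm_so\<^esub> inv\<^bsub>Perm_so\<^esub> \<psi> \<in> kernel"
proof -
  let ?E = "ext_map n (gr (-1))"
  let ?\<phi>' = "inv\<^bsub>Perm_so\<^esub> \<phi>" and ?\<psi>' = "inv\<^bsub>Perm_so\<^esub> \<psi>"
  note inv = G0_inv[OF \<phi>] G0_inv[OF \<psi>]
  note mult = subgroup.m_closed[OF G0_subgroup]
  obtain c where c: "\<And>\<xi>. \<xi> \<in> V \<Longrightarrow> transvectant (?E \<phi> \<xi>) = c * transvectant \<xi>" using G0_transvectant[OF \<phi>] by blast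
  obtain d where d: "\<And>\<xi>. \<xi> \<in> V \<Longrightarrow> transvectant (?E \<psi> \<xi>) = d * transvectant \<xi>" using G0_transvectant[OF \<psi>] by blast
  have c': "c * transvectant (?E ?\<phi>' \<xi>) = transvectant \<xi>" if "\<xi> \<in> V" for \<xi>
    using c[OF G0_V[OF inv(1) that]] ext_map_inv[OF \<phi> that] by simp
  have d': "d * transvectant (?E ?\<psi>' \<xi>) = transvectant \<xi>" if "\<xi> \<in> V" for \<xi>
    using d[OF G0_V[OF inv(2) that]] ext_map_inv[OF \<psi> that] by simp
  show ?thesis
    unfolding kernel_def
  proof (intro CollectI conjI ballI)
    show "\<phi> \<otimes>\<^bsub>Perm_so\<^esub> \<psi> \<otimes>\<^bsub>Perm_so\<^esub> ?\<phi>' \<otimes>\<^bsub>Perm_so\<^esub> ?\<psi>' \<in> G0"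
      by (intro mult \<phi> \<psi> inv)
    fix \<xi> assume \<xi>: "\<xi> \<in> V"
    let ?a = "?E ?\<psi>' \<xi>"
    have a: "?a \<in> V" "?E ?\<phi>' ?a \<in> V" "?E \<psi> (?E ?\<phi>' ?a) \<in> V"
      using G0_V inv \<psi> \<xi> by blast+
    have "?E (\<phi> \<otimes>\<^bsub>Perm_so\<^esub> \<psi> \<otimes>\<^bsub>Perm_so\<^esub> ?\<phi>' \<otimes>\<^bsub>Perm_so\<^esub> ?\<psi>') \<xi> = ?E \<phi> (?E \<psi> (?E ?\<phi>' ?a))"
      using a \<xi> by (simp add: ext_map_mult mult \<phi> \<psi> inv)
    then have "transvectant (?E (\<phi> \<otimes>\<^bsub>Perm_so\<^esub> \<psi> \<otimes>\<^bsub>Perm_so\<^esub> ?\<phi>' \<otimes>\<^bsub>Perm_so\<^esub> ?\<psi>') \<xi>) =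
        c * (d * transvectant (?E ?\<phi>' ?a))"
      using c[OF a(3)] d[OF a(2)] by simp
    also have "\<dots> = d * (c * transvectant (?E ?\<phi>' ?a))" by (rule mult.left_commute)
    also have "\<dots> = d * transvectant ?a" unfolding c'[OF a(1)] ..
    also have "\<dots> = transvectant \<xi>" by (rule d'[OF \<xi>])
    finally show "transvectant (?E (\<phi> \<otimes>\<^bsub>Perm_so\<^esub> \<psi> \<otimes>\<^bsub>Perm_so\<^esub> ?\<phi>' \<otimes>\<^bsub>Perm_so\<^esub> ?\<psi>') \<xi>) = transvectant \<xi>" .
  qed
qed

lemma semisimple_part_kernel:
  assumes "\<phi> \<in> semisimple_part G0"
  shows "\<phi> \<in> kernel"
proof -
  have "\<phi> \<in> generate Perm_so (derived_set Perm_so G0)"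
    using assms by (simp add: semisimple_part_def derived_def)
  then show ?thesis
  proof (induction rule: generate.induct)
    case one
    have "ext_map n (gr (-1)) \<one>\<^bsub>Perm_so\<^esub> \<xi> = \<xi>" if "\<xi> \<in> V" for \<xi>
      by (rule ext_map_ident[OF V_ext_power[OF that] gr_subspace]) (use gr_so in \<open>simp add: BijGroup_def\<close>)
    then show ?case using subgroup.one_closed[OF G0_subgroup] by (simp add: kernel_def)
  next
    case (incl h)
    then show ?case using kernel_commutator by blast
  next
    case (inv h)
    then show ?case using kernel_commutator kernel_inv by blast
  next
    case (eng h1 h2)
    then show ?case using kernel_mult by blast
  qed
qed

lemma poly_act_transvectant:
  assumes "\<phi> \<in> semisimple_part G0"
  shows "poly_act n gr \<phi> transvectant = transvectant"
proof
  fix \<xi>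
  have "inv\<^bsub>Perm_so\<^esub> \<phi> \<in> kernel"
    by (rule kernel_inv[OF semisimple_part_kernel[OF assms]])
  then show "poly_act n gr \<phi> transvectant \<xi> = transvectant \<xi>"
    by (simp add: poly_act_def kernel_def) (simp add: transvectant_def)
qed

lemma transvectant_proj_invariant_ring:
  assumes "even n"
  shows "range (\<lambda>c. coset n gr 2 (fscale c transvectant)) \<in> proj_invariant_ring n G0 gr 2"
proof -
  \<comment> \<open>As 0 lies in the ideal, the transvectant belongs to its own coset, which
    therefore differs from the ideal.\<close>
  have "0 \<in> LGr_ideal n gr 2"
    by (simp add: LGr_ideal_def sym_power_dual_def cfun.span_zero)
  then have "transvectant \<in> coset n gr 2 transvectant"
    unfolding coset_def by (intro image_eqI[of _ _ 0]) simp_all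
  then have "coset n gr 2 transvectant \<noteq> LGr_ideal n gr 2"
    using transvectant_not_ideal[OF assms] by blast
  moreover have "coset n gr 2 transvectant \<in> invariant_ring n G0 gr 2"
    unfolding invariant_ring_def using transvectant_quadratic poly_act_transvectant by fastforce
  ultimately show ?thesis
    unfolding proj_invariant_ring_def using transvectant_quadratic by blast
qed

end

theorem proposition3:
  fixes n :: nat
    and X :: "'m::finite cmat set set" and p :: "'m cmat set"
    and P G0 Pp :: "('m cmat \<Rightarrow> 'm cmat) set"
    and gr :: "int \<Rightarrow> 'm cmat set"
  assumes "n \<ge> 4" and "even n" and "CARD('m) = n + 4"
    and "adjoint_variety X" and "p \<in> X" and "P = point_stabiliser p"
    and "levi_decomposition P G0 Pp"
    and "contact_grading n P G0 Pp gr"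
  shows "\<exists>B. B \<in> proj_invariant_ring n G0 gr 2"
proof -
  interpret contact n P G0 Pp gr
    by unfold_locales (use assms in auto)
  obtain u v u' v' where hyp: "hyperbolic n u v u' v'" and uv: "u \<bowtie> v \<in> gr (-2)"
    and h: "u \<bowtie> u' + v \<bowtie> v' \<in> gr 0"
    using exists_hyperbolic by blast
  interpret hyperbolic n u v u' v' by (rule hyp)
  obtain e where e: "\<forall>i<n. e i \<in> U" "\<forall>i<n. \<forall>j<n. e i \<star> e j = (if i = j then 1 else 0)"
    using orthonormal_in_U[of n None] by auto
  interpret frame n u v u' v' e
    by unfold_locales (use e in auto)
  have "P \<subseteq> adjoint_group"
    using assms(6) by (auto simp: point_stabiliser_def)
  then interpret levi_frame n P G0 Pp gr u v u' v' e
    by unfold_locales (use uv h assms(7) in \<open>auto simp: h_def\<close>)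
  show ?thesis
    using transvectant_proj_invariant_ring[OF assms(2)] by blast
qed

end
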